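(* Let $T>0$ and $\epsilon>0$. Let $\kappa^0\in \mathrm{Lip}(\mathbb{R})$ and $\rho^0\in C_0^\infty(\mathbb{R})$ satisfy $$\kappa^0_x\ \ge\ \sqrt{(\rho^0_x)^2+\epsilon^2}\quad\text{a.e. in }\mathbb{R}.$$ Let $\rho$ be the solution of the heat equation $\rho_t=\rho_{xx}$ in $Q_T$, $\rho(\cdot,0)=\rho^0$. Then there exists a viscosity solution $\kappa\in\mathrm{Lip}(\overline{Q}_T)$ of $$\kappa_t\kappa_x=\rho_t\rho_x\ \text{ in }Q_T,\qquad \kappa(x,0)=\kappa^0(x)\ \text{ in }\mathbb{R},$$ and it is unique among the viscosity solutions of this problem satisfying $\kappa_x\ge\sqrt{\rho_x^2+\epsilon^2}$ a.e. in $\overline{Q}_T$.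
   Context: $Q_T=\mathbb{R}\times(0,T)$; $\mathrm{Lip}(\Omega)$ is the set of Lipschitz continuous real functions on $\Omega$. The heat equation solution $\rho$ with initial datum in $C_0^\infty(\mathbb{R})$ is the classical smooth bounded solution; note $\rho_t\rho_x=\rho_x\rho_{xx}$. The equation $\kappa_t\kappa_x=\rho_t\rho_x$ is understood as the first-order equation $F((x,t),\nabla\kappa)=0$ with $F((x,t),(p_1,p_2))=p_1p_2-\rho_x(x,t)\rho_{xx}(x,t)$. Viscosity solutions: a continuous $u$ is a viscosity subsolution (resp. supersolution) in $Q_T$ if for every $\phi\in C^1(Q_T)$ and every local maximum (resp. minimum) point $(x_0,t_0)\in Q_T$ of $u-\phi$ one has $F((x_0,t_0),(\phi_x,\phi_t)(x_0,t_0))\le 0$ (resp. $\ge0$); a viscosity solution is both; a viscosity solution of the initial value problem is a $u\in C(\overline{Q}_T)$ that is a viscosity solution in $Q_T$ with $u(\cdot,0)=\kappa^0$. *)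

theory Defs
  imports "HOL-Analysis.Analysis"
begin

definition QT :: "real \<Rightarrow> (real \<times> real) set" where
  "QT T = {p. 0 < snd p \<and> snd p < T}"

definition QTbar :: "real \<Rightarrow> (real \<times> real) set" where
  "QTbar T = {p. 0 \<le> snd p \<and> snd p \<le> T}"

definition Lip :: "'a::metric_space set \<Rightarrow> ('a \<Rightarrow> real) \<Rightarrow> bool" where
  "Lip S f \<longleftrightarrow> (\<exists>L. L-lipschitz_on S f)"

definition C0_infty :: "(real \<Rightarrow> real) \<Rightarrow> bool" where
  "C0_infty f \<longleftrightarrow> (\<forall>n x. ((deriv ^^ n) f) differentiable (at x)) \<and> bounded {x. f x \<noteq> 0}"

text \<open>The classical bounded solution of the heat equation rho_t = rho_xx with
  initial datum rho0, given by convolution with the heat kernel.\<close>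
definition heat_sol :: "(real \<Rightarrow> real) \<Rightarrow> real \<Rightarrow> real \<Rightarrow> real" where
  "heat_sol \<rho>0 x t =
     (if t \<le> 0 then \<rho>0 x
      else (LINT y|lborel. exp (- ((x - y)\<^sup>2) / (4 * t)) / sqrt (4 * pi * t) * \<rho>0 y))"

definition dx :: "(real \<Rightarrow> real \<Rightarrow> real) \<Rightarrow> real \<Rightarrow> real \<Rightarrow> real" where
  "dx u x t = deriv (\<lambda>y. u y t) x"

definition Ham :: "(real \<Rightarrow> real \<Rightarrow> real) \<Rightarrow> real \<times> real \<Rightarrow> real \<Rightarrow> real \<Rightarrow> real" where
  "Ham \<rho> p p1 p2 = p1 * p2 - dx \<rho> (fst p) (snd p) * dx (dx \<rho>) (fst p) (snd p)"

definition C1_with :: "(real \<times> real) set \<Rightarrow> (real \<times> real \<Rightarrow> real)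
    \<Rightarrow> (real \<times> real \<Rightarrow> real) \<Rightarrow> (real \<times> real \<Rightarrow> real) \<Rightarrow> bool" where
  "C1_with S \<phi> \<phi>x \<phi>t \<longleftrightarrow> continuous_on S \<phi>x \<and> continuous_on S \<phi>t \<and>
     (\<forall>p\<in>S. (\<phi> has_derivative (\<lambda>h. \<phi>x p * fst h + \<phi>t p * snd h)) (at p))"

definition local_max_in :: "(real \<times> real) set \<Rightarrow> (real \<times> real \<Rightarrow> real) \<Rightarrow> real \<times> real \<Rightarrow> bool" where
  "local_max_in S f p \<longleftrightarrow> p \<in> S \<and> (\<exists>r>0. \<forall>q\<in>S. dist q p < r \<longrightarrow> f q \<le> f p)"

definition local_min_in :: "(real \<times> real) set \<Rightarrow> (real \<times> real \<Rightarrow> real) \<Rightarrow> real \<times> real \<Rightarrow> bool" where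
  "local_min_in S f p \<longleftrightarrow> p \<in> S \<and> (\<exists>r>0. \<forall>q\<in>S. dist q p < r \<longrightarrow> f p \<le> f q)"

definition visc_sub :: "real \<Rightarrow> (real \<Rightarrow> real \<Rightarrow> real) \<Rightarrow> (real \<times> real \<Rightarrow> real) \<Rightarrow> bool" where
  "visc_sub T \<rho> u \<longleftrightarrow> continuous_on (QT T) u \<and>
     (\<forall>\<phi> \<phi>x \<phi>t p. C1_with (QT T) \<phi> \<phi>x \<phi>t \<and> local_max_in (QT T) (\<lambda>q. u q - \<phi> q) p
        \<longrightarrow> Ham \<rho> p (\<phi>x p) (\<phi>t p) \<le> 0)"

definition visc_super :: "real \<Rightarrow> (real \<Rightarrow> real \<Rightarrow> real) \<Rightarrow> (real \<times> real \<Rightarrow> real) \<Rightarrow> bool" where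
  "visc_super T \<rho> u \<longleftrightarrow> continuous_on (QT T) u \<and>
     (\<forall>\<phi> \<phi>x \<phi>t p. C1_with (QT T) \<phi> \<phi>x \<phi>t \<and> local_min_in (QT T) (\<lambda>q. u q - \<phi> q) p
        \<longrightarrow> Ham \<rho> p (\<phi>x p) (\<phi>t p) \<ge> 0)"

definition visc_sol_IVP :: "real \<Rightarrow> (real \<Rightarrow> real \<Rightarrow> real) \<Rightarrow> (real \<Rightarrow> real)
    \<Rightarrow> (real \<times> real \<Rightarrow> real) \<Rightarrow> bool" where
  "visc_sol_IVP T \<rho> \<kappa>0 u \<longleftrightarrow> continuous_on (QTbar T) u \<and> visc_sub T \<rho> u \<and> visc_super T \<rho> u
     \<and> (\<forall>x. u (x, 0) = \<kappa>0 x)"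

definition grad_cond :: "real \<Rightarrow> real \<Rightarrow> (real \<Rightarrow> real \<Rightarrow> real) \<Rightarrow> (real \<times> real \<Rightarrow> real) \<Rightarrow> bool" where
  "grad_cond T \<epsilon> \<rho> u \<longleftrightarrow> (AE p in lborel. p \<in> QTbar T \<longrightarrow>
      (\<lambda>y. u (y, snd p)) differentiable (at (fst p)) \<and>
      deriv (\<lambda>y. u (y, snd p)) (fst p) \<ge> sqrt ((dx \<rho> (fst p) (snd p))\<^sup>2 + \<epsilon>\<^sup>2))"

end

theory Submission
  imports Defs "HOL-Complex_Analysis.Conformal_Mappings" "HOL-Probability.Distributions"
begin

text \<open>
  Since \<open>\<kappa>_x \<ge> \<epsilon>\<close>, the equation is \<open>\<kappa>_t = G(x, t, \<kappa>_x)\<close> with \<open>G(p, a) = \<rho>_x \<rho>_xx / max a \<epsilon>\<close>,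
  a bounded Hamiltonian that is Lipschitz in all variables. For this equation the supremum of all
  continuous subsolutions below \<open>\<kappa>0 + C t\<close> is a solution (Perron), and it is Lipschitz because the
  class of subsolutions is stable under translations in space and time. The function
  \<open>B = sqrt (\<rho>_x^2 + \<epsilon>^2)\<close> satisfies \<open>B_t \<le> B_xx = (G(x, t, B))_x\<close>, so doubling the variables of
  the solution on \<open>x \<le> y\<close> gives \<open>\<kappa>(y, t) - \<kappa>(x, t) \<ge> \<integral>_x^y B\<close>; hence the solution of the modified
  equation solves the original one and satisfies the gradient bound.

  For uniqueness the difficulty is that a competitor \<open>\<kappa>'\<close> is merely continuous: its gradient bound
  holds almost everywhere, so it might have a decreasing singular part. Where \<open>\<rho>_x \<rho>_xx > 0\<close> no
  test function with \<open>\<phi>_x = 0\<close> can touch \<open>\<kappa>'\<close> from below, so \<open>\<kappa>'(\<cdot>, t)\<close> has no strict valleys; if it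
  were not increasing, it would be nonincreasing on a whole box, against the gradient bound. Where
  \<open>\<rho>_x \<rho>_xx < 0\<close> one argues with peaks, and for \<open>t > 0\<close> the zeros of \<open>\<rho>_x \<rho>_xx\<close> are isolated by
  analyticity unless \<open>\<rho>\<close> vanishes identically, in which case \<open>\<kappa>'\<close> is shown not to depend on time.
  A monotone \<open>\<kappa>'\<close> has slope at least \<open>\<epsilon>\<close> by Fatou's lemma, hence solves the modified equation,
  where the comparison principle holds on truncated cones.
\<close>

section \<open>Semidifferentials\<close>

text \<open>Two test classes keep test functions from ever having to be extended: a competitor is
  tested only with functions that are C1 on the whole plane, the Perron function with all functions
  that are C1 on some ball about the point, and the definition of a viscosity solution on
  \<open>QT T\<close> lies in between. The Perron function lives on the whole half plane, so no
  terminal time interferes with its construction; the strip enters with the competitors.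
  Translations make the function Lipschitz before it is known to be a solution, so the viscosity
  inequalities can be stated for it directly rather than for semicontinuous envelopes. The statement
  asks for a derivative at almost every point of the plane. For the Perron function the exceptional
  points lie in a countable union of Borel subsets of the plane whose horizontal slices are null by
  the Vitali covering theorem. For a competitor the same condition yields lower bounds of
  increments, and these only once monotonicity is known, because a derivative does not see singular
  growth.\<close>

lemma C1_with_subset: "C1_with S \<phi> \<phi>x \<phi>t \<Longrightarrow> S' \<subseteq> S \<Longrightarrow> C1_with S' \<phi> \<phi>x \<phi>t"
  unfolding C1_with_def by (blast intro: continuous_on_subset)

lemma C1_with_add:
  assumes "C1_with S \<phi> \<phi>x \<phi>t" "C1_with S \<psi> \<psi>x \<psi>t"
  shows "C1_with S (\<lambda>p. \<phi> p + \<psi> p) (\<lambda>p. \<phi>x p + \<psi>x p) (\<lambda>p. \<phi>t p + \<psi>t p)"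
proof -
  have "((\<lambda>p. \<phi> p + \<psi> p) has_derivative (\<lambda>h. (\<phi>x p + \<psi>x p) * fst h + (\<phi>t p + \<psi>t p) * snd h)) (at p)"
    if "p \<in> S" for p
  proof (rule has_derivative_eq_rhs[OF has_derivative_add])
    show "(\<phi> has_derivative (\<lambda>h. \<phi>x p * fst h + \<phi>t p * snd h)) (at p)"
      "(\<psi> has_derivative (\<lambda>h. \<psi>x p * fst h + \<psi>t p * snd h)) (at p)"
      using assms that by (auto simp: C1_with_def)
  qed (auto simp: algebra_simps)
  then show ?thesis using assms by (auto simp: C1_with_def intro!: continuous_intros)
qed

lemma C1_with_minus:
  assumes "C1_with S \<phi> \<phi>x \<phi>t"
  shows "C1_with S (\<lambda>p. - \<phi> p) (\<lambda>p. - \<phi>x p) (\<lambda>p. - \<phi>t p)"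
proof -
  have "((\<lambda>p. - \<phi> p) has_derivative (\<lambda>h. - \<phi>x p * fst h + - \<phi>t p * snd h)) (at p)"
    if "p \<in> S" for p
  proof (rule has_derivative_eq_rhs[OF has_derivative_minus])
    show "(\<phi> has_derivative (\<lambda>h. \<phi>x p * fst h + \<phi>t p * snd h)) (at p)"
      using assms that by (auto simp: C1_with_def)
  qed (auto simp: algebra_simps)
  then show ?thesis using assms by (auto simp: C1_with_def intro!: continuous_intros)
qed

lemma C1_with_translate:
  assumes "C1_with S \<phi> \<phi>x \<phi>t"
  shows "C1_with ((\<lambda>p. p - c) ` S) (\<lambda>p. \<phi> (p + c)) (\<lambda>p. \<phi>x (p + c)) (\<lambda>p. \<phi>t (p + c))"
proof -
  have "((\<lambda>p. \<phi> (p + c)) has_derivative (\<lambda>h. \<phi>x (p + c) * fst h + \<phi>t (p + c) * snd h)) (at p)"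
    if "p + c \<in> S" for p
  proof -
    have 1: "((\<lambda>p. p + c) has_derivative (\<lambda>h. h)) (at p)" by (auto intro!: derivative_eq_intros)
    have 2: "(\<phi> has_derivative (\<lambda>h. \<phi>x (p + c) * fst h + \<phi>t (p + c) * snd h)) (at (p + c))"
      using assms that by (auto simp: C1_with_def)
    show ?thesis using has_derivative_compose[OF 1 2] by simp
  qed
  moreover have "continuous_on ((\<lambda>p. p - c) ` S) (\<lambda>p. \<phi>x (p + c))"
    "continuous_on ((\<lambda>p. p - c) ` S) (\<lambda>p. \<phi>t (p + c))"
    using assms by (auto simp: C1_with_def intro!: continuous_on_compose2[of S \<phi>x] continuous_on_compose2[of S \<phi>t] continuous_intros)
  moreover have "p + c \<in> S" if "p \<in> (\<lambda>p. p - c) ` S" for p using that by force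
  ultimately show ?thesis by (simp only: C1_with_def) blast
qed

lemma C1_with_separate:
  assumes f: "\<And>x. (f has_real_derivative f' x) (at x)" and g: "\<And>x. (g has_real_derivative g' x) (at x)"
    and c: "continuous_on UNIV f'" "continuous_on UNIV g'"
  shows "C1_with S (\<lambda>p. f (fst p) + g (snd p)) (\<lambda>p. f' (fst p)) (\<lambda>p. g' (snd p))"
proof -
  have "((\<lambda>p. f (fst p) + g (snd p)) has_derivative (\<lambda>h. f' (fst p) * fst h + g' (snd p) * snd h)) (at p)" for p
    by (rule has_derivative_eq_rhs[OF has_derivative_add[OF
          has_derivative_compose[OF has_derivative_fst[OF has_derivative_ident] f[unfolded has_field_derivative_def]]
          has_derivative_compose[OF has_derivative_snd[OF has_derivative_ident] g[unfolded has_field_derivative_def]]]]) auto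
  then show ?thesis
    by (auto simp: C1_with_def intro!: continuous_on_compose2[OF c(1)] continuous_on_compose2[OF c(2)] continuous_intros)
qed

text \<open>The touching is local, but the test function must be C1 on all of \<open>S\<close>.
  Hence a larger open \<open>S\<close> allows fewer tests: \<open>UNIV\<close> gives the fewest,
  small balls the most, and \<open>superdiff_on_imp_superdiff\<close> passes from one to the other
  by restriction.\<close>

definition superdiff_on where
  "superdiff_on S u p a b \<longleftrightarrow> p \<in> S \<and> (\<exists>\<phi> \<phi>x \<phi>t. C1_with S \<phi> \<phi>x \<phi>t \<and>
     (\<exists>r>0. \<forall>q\<in>ball p r. u q - \<phi> q \<le> u p - \<phi> p) \<and> \<phi>x p = a \<and> \<phi>t p = b)"

definition superdiff where "superdiff u p a b \<longleftrightarrow> (\<exists>r>0. superdiff_on (ball p r) u p a b)"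

definition subdiff_on where "subdiff_on S u p a b \<longleftrightarrow> superdiff_on S (\<lambda>q. - u q) p (- a) (- b)"

definition subdiff where "subdiff u p a b \<longleftrightarrow> superdiff (\<lambda>q. - u q) p (- a) (- b)"

lemma superdiff_onI:
  assumes "p \<in> S" "C1_with S \<phi> \<phi>x \<phi>t" "r > 0" "\<And>q. q \<in> ball p r \<Longrightarrow> u q - \<phi> q \<le> u p - \<phi> p" "\<phi>x p = a" "\<phi>t p = b"
  shows "superdiff_on S u p a b"
  using assms unfolding superdiff_on_def by blast

lemma subdiff_onI:
  assumes "p \<in> S" "C1_with S \<phi> \<phi>x \<phi>t" "r > 0" "\<And>q. q \<in> ball p r \<Longrightarrow> u p - \<phi> p \<le> u q - \<phi> q" "\<phi>x p = a" "\<phi>t p = b"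
  shows "subdiff_on S u p a b"
  unfolding subdiff_on_def
  by (rule superdiff_onI[OF assms(1) C1_with_minus[OF assms(2)] assms(3)]) (use assms(4-6) in force)+

lemma superdiff_onE_ball:
  assumes "superdiff_on (ball p r) u p a b"
  obtains r' \<phi> \<phi>x \<phi>t where "r' > 0" "C1_with (ball p r') \<phi> \<phi>x \<phi>t" "\<And>q. q \<in> ball p r' \<Longrightarrow> u q - \<phi> q \<le> u p - \<phi> p" "\<phi>x p = a" "\<phi>t p = b"
proof -
  obtain \<phi> \<phi>x \<phi>t r1 where *: "p \<in> ball p r" "C1_with (ball p r) \<phi> \<phi>x \<phi>t" "r1 > 0" "\<forall>q\<in>ball p r1. u q - \<phi> q \<le> u p - \<phi> p" "\<phi>x p = a" "\<phi>t p = b"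
    using assms unfolding superdiff_on_def by blast
  show ?thesis
    by (rule that[of "min r r1" \<phi> \<phi>x \<phi>t]) (use * C1_with_subset[OF *(2)] in \<open>auto simp: subset_eq\<close>)
qed

lemma superdiffE:
  assumes "superdiff u p a b"
  obtains r \<phi> \<phi>x \<phi>t where "r > 0" "C1_with (ball p r) \<phi> \<phi>x \<phi>t" "\<And>q. q \<in> ball p r \<Longrightarrow> u q - \<phi> q \<le> u p - \<phi> p" "\<phi>x p = a" "\<phi>t p = b"
  using assms superdiff_onE_ball unfolding superdiff_def by metis

lemma superdiffI:
  assumes "r > 0" "C1_with (ball p r) \<phi> \<phi>x \<phi>t" "\<And>q. q \<in> ball p r \<Longrightarrow> u q - \<phi> q \<le> u p - \<phi> p" "\<phi>x p = a" "\<phi>t p = b"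
  shows "superdiff u p a b"
  unfolding superdiff_def using assms by (intro exI[of _ r] conjI superdiff_onI[of _ _ \<phi> \<phi>x \<phi>t r]) auto

lemma superdiff_on_imp_superdiff:
  assumes "superdiff_on S u p a b" "open S"
  shows "superdiff u p a b"
proof -
  obtain \<phi> \<phi>x \<phi>t r1 where *: "p \<in> S" "C1_with S \<phi> \<phi>x \<phi>t" "r1 > 0" "\<forall>q\<in>ball p r1. u q - \<phi> q \<le> u p - \<phi> p" "\<phi>x p = a" "\<phi>t p = b"
    using assms unfolding superdiff_on_def by blast
  obtain r2 where r2: "r2 > 0" "ball p r2 \<subseteq> S" using assms(2) *(1) open_contains_ball by metis
  show ?thesis
    by (rule superdiffI[of "min r1 r2" _ \<phi> \<phi>x \<phi>t]) (use * r2 C1_with_subset[OF *(2)] in \<open>auto simp: subset_eq\<close>)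
qed

lemma subdiff_on_imp_subdiff: "subdiff_on S u p a b \<Longrightarrow> open S \<Longrightarrow> subdiff u p a b"
  unfolding subdiff_on_def subdiff_def by (rule superdiff_on_imp_superdiff)

lemma superdiff_mono:
  assumes "superdiff u p a b" "r > 0" "\<And>q. q \<in> ball p r \<Longrightarrow> v q \<le> u q" "v p = u p"
  shows "superdiff v p a b"
proof -
  obtain r' \<phi> \<phi>x \<phi>t where *: "r' > 0" "C1_with (ball p r') \<phi> \<phi>x \<phi>t" "\<And>q. q \<in> ball p r' \<Longrightarrow> u q - \<phi> q \<le> u p - \<phi> p" "\<phi>x p = a" "\<phi>t p = b"
    using superdiffE[OF assms(1)] by blast
  show ?thesis
  proof (rule superdiffI[of "min r r'" _ \<phi> \<phi>x \<phi>t])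
    fix q assume "q \<in> ball p (min r r')"
    then have "v q \<le> u q" "u q - \<phi> q \<le> u p - \<phi> p" using assms(3) *(3) by auto
    then show "v q - \<phi> q \<le> v p - \<phi> p" using assms(4) by linarith
  qed (use assms(2) * C1_with_subset[OF *(2)] in \<open>auto simp: subset_eq\<close>)
qed

text \<open>A test function that touches \<open>u\<close> from above dominates \<open>u\<close>
  after normalization at \<open>p\<close>, so its derivative along \<open>h\<close> is at least any
  growth rate of \<open>u\<close> along \<open>h\<close>. The slope bounds on test functions below
  come from here.\<close>

lemma superdiff_direction:
  assumes s: "superdiff u p a b" and d: "d > 0" "\<And>s. 0 < s \<Longrightarrow> s < d \<Longrightarrow> u p + c * s \<le> u (p + s *\<^sub>R h)"
  shows "c \<le> a * fst h + b * snd h"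
proof -
  obtain r \<phi> \<phi>x \<phi>t where *: "r > 0" "C1_with (ball p r) \<phi> \<phi>x \<phi>t" "\<And>q. q \<in> ball p r \<Longrightarrow> u q - \<phi> q \<le> u p - \<phi> p" "\<phi>x p = a" "\<phi>t p = b"
    using superdiffE[OF s] by blast
  have "(\<phi> has_derivative (\<lambda>h. a * fst h + b * snd h)) (at p)" using * by (auto simp: C1_with_def)
  then have D: "(\<phi> has_derivative (\<lambda>h. a * fst h + b * snd h)) (at (p + 0 *\<^sub>R h))" by simp
  have L: "((\<lambda>s. p + s *\<^sub>R h) has_derivative (\<lambda>s. s *\<^sub>R h)) (at 0)" by (auto intro!: derivative_eq_intros)
  have "((\<lambda>s. \<phi> (p + s *\<^sub>R h)) has_derivative (\<lambda>s. a * fst (s *\<^sub>R h) + b * snd (s *\<^sub>R h))) (at 0)"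
    using has_derivative_compose[OF L D] by simp
  then have "((\<lambda>s. \<phi> (p + s *\<^sub>R h)) has_real_derivative (a * fst h + b * snd h)) (at 0)"
    unfolding has_field_derivative_def by (rule has_derivative_eq_rhs) (auto simp: algebra_simps)
  then have "((\<lambda>s. (\<phi> (p + s *\<^sub>R h) - \<phi> p) / s) \<longlongrightarrow> a * fst h + b * snd h) (at 0)"
    by (simp add: DERIV_def)
  then have T: "((\<lambda>s. (\<phi> (p + s *\<^sub>R h) - \<phi> p) / s) \<longlongrightarrow> a * fst h + b * snd h) (at_right 0)"
    by (rule filterlim_mono) (auto simp: at_le)
  have "((\<lambda>s. p + s *\<^sub>R h) \<longlongrightarrow> p + 0 *\<^sub>R h) (at_right 0)" by (intro tendsto_intros)
  then have "\<forall>\<^sub>F s in at_right 0. dist (p + s *\<^sub>R h) (p + 0 *\<^sub>R h) < r" using *(1) by (rule tendstoD)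
  moreover have "\<forall>\<^sub>F s in at_right 0. s \<in> {0<..<d}" using d(1) by (rule eventually_at_right_real)
  ultimately have "\<forall>\<^sub>F s in at_right 0. c \<le> (\<phi> (p + s *\<^sub>R h) - \<phi> p) / s"
  proof eventually_elim
    case (elim s)
    then have "u (p + s *\<^sub>R h) - \<phi> (p + s *\<^sub>R h) \<le> u p - \<phi> p" "u p + c * s \<le> u (p + s *\<^sub>R h)" using *(3) d(2)
      by (auto simp: dist_commute)
    then show ?case using elim by (simp add: field_simps)
  qed
  then show ?thesis using T by (intro tendsto_lowerbound[OF T]) simp_all
qed

text \<open>The growth rates of a differentiable function along \<open>h\<close> and
  \<open>-h\<close> are opposite, so the inequality between the two linear forms is an
  equality.\<close>

lemma superdiff_smooth:
  assumes "superdiff u p a b" "(u has_derivative (\<lambda>h. a' * fst h + b' * snd h)) (at p)"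
  shows "a = a'" "b = b'"
proof -
  have D: "a' * fst h + b' * snd h \<le> a * fst h + b * snd h" for h :: "real \<times> real"
  proof (rule field_le_epsilon)
    fix e :: real assume e: "e > 0"
    have "(u has_derivative (\<lambda>h. a' * fst h + b' * snd h)) (at (p + 0 *\<^sub>R h))" using assms(2) by simp
    moreover have "((\<lambda>s. p + s *\<^sub>R h) has_derivative (\<lambda>s. s *\<^sub>R h)) (at 0)" by (auto intro!: derivative_eq_intros)
    ultimately have "((\<lambda>s. u (p + s *\<^sub>R h)) has_derivative (\<lambda>s. a' * fst (s *\<^sub>R h) + b' * snd (s *\<^sub>R h))) (at 0)"
      by (rule has_derivative_compose[rotated])
    then have "((\<lambda>s. u (p + s *\<^sub>R h)) has_real_derivative (a' * fst h + b' * snd h)) (at 0)"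
      unfolding has_field_derivative_def by (rule has_derivative_eq_rhs) (auto simp: algebra_simps)
    then have "((\<lambda>s. (u (p + s *\<^sub>R h) - u p) / s) \<longlongrightarrow> a' * fst h + b' * snd h) (at 0)"
      by (simp add: DERIV_def)
    then have "\<forall>\<^sub>F s in at 0. a' * fst h + b' * snd h - e < (u (p + s *\<^sub>R h) - u p) / s"
      using e by (intro order_tendstoD(1)) auto
    then obtain d where d: "d > 0" "\<And>s. s \<noteq> 0 \<Longrightarrow> dist s 0 < d \<Longrightarrow> a' * fst h + b' * snd h - e < (u (p + s *\<^sub>R h) - u p) / s"
      unfolding eventually_at by blast
    have "a' * fst h + b' * snd h - e \<le> a * fst h + b * snd h"
    proof (rule superdiff_direction[OF assms(1) d(1)])
      fix s assume "0 < s" "s < d"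
      then show "u p + (a' * fst h + b' * snd h - e) * s \<le> u (p + s *\<^sub>R h)"
        using d(2)[of s] by (simp add: field_simps)
    qed
    then show "a' * fst h + b' * snd h \<le> a * fst h + b * snd h + e" by simp
  qed
  show "a = a'" using D[of "(1,0)"] D[of "(-1,0)"] by simp
  show "b = b'" using D[of "(0,1)"] D[of "(0,-1)"] by simp
qed

text \<open>The translation and the affine correction are moved into the test function, whose time
  slope changes by \<open>\<beta>\<close>.\<close>

lemma superdiff_shift:
  assumes "superdiff (\<lambda>q. u (q + c) - (\<alpha> + \<beta> * snd q)) p a b"
  shows "superdiff u (p + c) a (b + \<beta>)"
proof -
  obtain r \<phi> \<phi>x \<phi>t where *: "r > 0" "C1_with (ball p r) \<phi> \<phi>x \<phi>t"
    "\<And>q. q \<in> ball p r \<Longrightarrow> u (q + c) - (\<alpha> + \<beta> * snd q) - \<phi> q \<le> u (p + c) - (\<alpha> + \<beta> * snd p) - \<phi> p" "\<phi>x p = a" "\<phi>t p = b"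
    using superdiffE[OF assms] by blast
  have "C1_with (ball p r) (\<lambda>q. \<phi> q + (0 + \<beta> * snd q)) (\<lambda>q. \<phi>x q + 0) (\<lambda>q. \<phi>t q + \<beta>)"
    by (rule C1_with_add[OF *(2)], rule C1_with_separate) (auto intro!: derivative_eq_intros)
  from C1_with_translate[OF this, of "-c"]
  have C: "C1_with (ball (p + c) r) (\<lambda>q. \<phi> (q - c) + (\<beta> * snd (q - c))) (\<lambda>q. \<phi>x (q - c)) (\<lambda>q. \<phi>t (q - c) + \<beta>)"
    by (simp add: ball_translation add.commute)
  show ?thesis
  proof (rule superdiffI[OF *(1) C])
    fix q assume "q \<in> ball (p + c) r"
    then have "q - c \<in> ball p r" by (simp add: dist_norm algebra_simps)
    from *(3)[OF this] show "u q - (\<phi> (q - c) + \<beta> * snd (q - c)) \<le> u (p + c) - (\<phi> (p + c - c) + \<beta> * snd (p + c - c))"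
      by (simp add: algebra_simps)
  qed (use * in auto)
qed

section \<open>Perron's method\<close>

definition HJ_sub where "HJ_sub G Q u \<longleftrightarrow> (\<forall>p\<in>Q. \<forall>a b. superdiff u p a b \<longrightarrow> b \<le> G p a)"

definition HJ_super where "HJ_super G Q u \<longleftrightarrow> (\<forall>p\<in>Q. \<forall>a b. subdiff u p a b \<longrightarrow> G p a \<le> b)"

lemma HJ_subD: "HJ_sub G Q u \<Longrightarrow> p \<in> Q \<Longrightarrow> superdiff u p a b \<Longrightarrow> b \<le> G p a"
  unfolding HJ_sub_def by blast

lemma HJ_subI: "(\<And>p a b. p \<in> Q \<Longrightarrow> superdiff u p a b \<Longrightarrow> b \<le> G p a) \<Longrightarrow> HJ_sub G Q u"
  unfolding HJ_sub_def by blast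

lemma HJ_superD: "HJ_super G Q u \<Longrightarrow> p \<in> Q \<Longrightarrow> subdiff u p a b \<Longrightarrow> G p a \<le> b"
  unfolding HJ_super_def by blast

lemma HJ_superI: "(\<And>p a b. p \<in> Q \<Longrightarrow> subdiff u p a b \<Longrightarrow> G p a \<le> b) \<Longrightarrow> HJ_super G Q u"
  unfolding HJ_super_def by blast

text \<open>\<open>L\<close> is independent of the gradient \<open>a\<close>. In the doubling
  arguments the error is therefore \<open>L\<close> times the distance of the two points, however
  steep the penalty between them is. \<open>K\<close> is the speed of propagation.\<close>

locale hamiltonian =
  fixes G :: "real \<times> real \<Rightarrow> real \<Rightarrow> real" and C L K :: real
  assumes C_pos: "C > 0" and L_nonneg: "L \<ge> 0" and K_nonneg: "K \<ge> 0"
    and G_bound: "\<And>p a. \<bar>G p a\<bar> \<le> C"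
    and G_lip: "\<And>x t y s a. \<bar>G (x, t) a - G (y, s) a\<bar> \<le> L * (\<bar>x - y\<bar> + \<bar>t - s\<bar>)"
    and G_lip_grad: "\<And>p a b. \<bar>G p a - G p b\<bar> \<le> K * \<bar>a - b\<bar>"
begin

lemma tendsto_G:
  assumes a: "(a \<longlongrightarrow> a0) F" and q: "(q \<longlongrightarrow> q0) F"
  shows "((\<lambda>i. G (q i) (a i)) \<longlongrightarrow> G q0 a0) F"
proof (rule Lim_transform2[OF tendsto_const])
  have "((\<lambda>i. L * (\<bar>fst (q i) - fst q0\<bar> + \<bar>snd (q i) - snd q0\<bar>) + K * \<bar>a i - a0\<bar>)
      \<longlongrightarrow> L * (\<bar>fst q0 - fst q0\<bar> + \<bar>snd q0 - snd q0\<bar>) + K * \<bar>a0 - a0\<bar>) F"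
    by (intro tendsto_intros a q)
  then have *: "((\<lambda>i. L * (\<bar>fst (q i) - fst q0\<bar> + \<bar>snd (q i) - snd q0\<bar>) + K * \<bar>a i - a0\<bar>) \<longlongrightarrow> 0) F"
    by simp
  have "norm (G q0 a0 - G (q i) (a i)) \<le> L * (\<bar>fst (q i) - fst q0\<bar> + \<bar>snd (q i) - snd q0\<bar>) + K * \<bar>a i - a0\<bar>" for i
    using G_lip[of "fst (q i)" "snd (q i)" "a i" "fst q0" "snd q0"] G_lip_grad[of q0 "a i" a0] by simp
  then show "((\<lambda>i. G q0 a0 - G (q i) (a i)) \<longlongrightarrow> 0) F"
    by (intro tendsto_0_le[OF *, of _ 1] always_eventually) (auto intro: order_trans[OF _ abs_ge_self])
qed

end

abbreviation (input) Qpos :: "(real \<times> real) set" where "Qpos \<equiv> {p. snd p > 0}"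
abbreviation (input) Qnonneg :: "(real \<times> real) set" where "Qnonneg \<equiv> {p. snd p \<ge> 0}"

lemma open_QT: "open (QT T)"
  unfolding QT_def by (intro open_Collect_conj open_Collect_less continuous_intros)

lemma open_Qpos: "open Qpos"
  by (intro open_Collect_less continuous_intros)

locale hamiltonian_ivp = hamiltonian +
  fixes \<kappa>0 :: "real \<Rightarrow> real" and L0 :: real
  assumes L0_nonneg: "L0 \<ge> 0" and \<kappa>0_lip: "\<And>x y. \<bar>\<kappa>0 x - \<kappa>0 y\<bar> \<le> L0 * \<bar>x - y\<bar>"
begin

text \<open>\<open>\<kappa>0 x + C * t\<close> is the upper barrier that belongs to the bound
  \<open>C\<close> of \<open>G\<close>. Imposing it on the class bounds the supremum from above,
  also at time 0, by definition.\<close>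

definition subsols :: "(real \<times> real \<Rightarrow> real) set" where
  "subsols = {u. continuous_on Qnonneg u \<and> HJ_sub G Qpos u \<and> (\<forall>x t. t \<ge> 0 \<longrightarrow> u (x, t) \<le> \<kappa>0 x + C * t)}"

lemma subsolsD:
  assumes "u \<in> subsols"
  shows "continuous_on Qnonneg u" "HJ_sub G Qpos u" "snd p \<ge> 0 \<Longrightarrow> u p \<le> \<kappa>0 (fst p) + C * snd p"
  using assms unfolding subsols_def by (simp, simp, cases p, simp)

lemma subsolsI:
  assumes "continuous_on Qnonneg u" "HJ_sub G Qpos u" "\<And>x t. t \<ge> 0 \<Longrightarrow> u (x, t) \<le> \<kappa>0 x + C * t"
  shows "u \<in> subsols"
  using assms by (simp add: subsols_def)

definition perron :: "real \<times> real \<Rightarrow> real" where "perron p = (SUP u\<in>subsols. u p)"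

definition barrier :: "real \<times> real \<Rightarrow> real" where "barrier p = \<kappa>0 (fst p) - C * snd p"

lemma \<kappa>0_cont: "continuous_on S \<kappa>0"
proof -
  have "L0-lipschitz_on S \<kappa>0"
    using \<kappa>0_lip L0_nonneg by (auto simp: lipschitz_on_def dist_real_def)
  then show ?thesis by (rule lipschitz_on_continuous_on)
qed

lemma barrier_cont: "continuous_on S barrier"
  unfolding barrier_def by (intro continuous_intros continuous_on_compose2[OF \<kappa>0_cont[of UNIV]]) auto

text \<open>One step back in time raises \<open>barrier\<close> at rate \<open>C\<close>, which a
  function touching from above must follow. As \<open>-C \<le> G\<close>, the barrier is a
  subsolution whatever the slope of \<open>\<kappa>0\<close>.\<close>

lemma barrier_sub: "superdiff barrier p a b \<Longrightarrow> b \<le> - C"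
  using superdiff_direction[of barrier p a b 1 C "(0,-1)"] by (auto simp: barrier_def algebra_simps)

lemma barrier_mem: "barrier \<in> subsols"
proof -
  have "b \<le> G p a" if "superdiff barrier p a b" for p a b
    using barrier_sub[OF that] G_bound[of p a] by linarith
  then show ?thesis
    using C_pos barrier_cont unfolding subsols_def by (auto simp: HJ_sub_def barrier_def)
qed

lemma perron_ge: "u \<in> subsols \<Longrightarrow> snd p \<ge> 0 \<Longrightarrow> u p \<le> perron p"
  unfolding perron_def
  by (rule cSUP_upper) (auto intro!: bdd_aboveI[of _ "\<kappa>0 (fst p) + C * snd p"] subsolsD)

lemma perron_le: "(\<And>u. u \<in> subsols \<Longrightarrow> u p \<le> M) \<Longrightarrow> perron p \<le> M"
  unfolding perron_def using barrier_mem by (intro cSUP_least) auto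

lemma perron_gtE:
  assumes "y < perron p" obtains u where "u \<in> subsols" "y < u p"
  using assms perron_le[of p y] by (meson not_le)

lemma perron_upper: "t \<ge> 0 \<Longrightarrow> perron (x, t) \<le> \<kappa>0 x + C * t"
  by (rule perron_le) (auto simp: subsols_def)

lemma perron_lower: "t \<ge> 0 \<Longrightarrow> \<kappa>0 x - C * t \<le> perron (x, t)"
  using perron_ge[OF barrier_mem, of "(x,t)"] by (auto simp: barrier_def)

lemma perron_initial: "perron (x, 0) = \<kappa>0 x"
  using perron_upper[of 0 x] perron_lower[of 0 x] by auto

text \<open>A shifted subsolution satisfies an equation whose Hamiltonian is off by at most
  \<open>L * (\<bar>z\<bar> + \<bar>s\<bar>)\<close>; subtracting that multiple of time pays for
  it.\<close>

lemma shift_subsol: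
  assumes u: "u \<in> subsols" and p: "snd p > 0" "snd p + s > 0"
    and d: "superdiff (\<lambda>q. u (q + (z, s)) - (\<alpha> + L * (\<bar>z\<bar> + \<bar>s\<bar>) * snd q)) p a b"
  shows "b \<le> G p a"
proof -
  have "superdiff u (p + (z, s)) a (b + L * (\<bar>z\<bar> + \<bar>s\<bar>))" by (rule superdiff_shift[OF d])
  then have "b + L * (\<bar>z\<bar> + \<bar>s\<bar>) \<le> G (p + (z, s)) a" using p by (intro HJ_subD[OF subsolsD(2)[OF u]]) auto
  also have "\<dots> \<le> G p a + L * (\<bar>z\<bar> + \<bar>s\<bar>)"
    using G_lip[of "fst p + z" "snd p + s" a "fst p" "snd p"] by (cases p) auto
  finally show ?thesis by simp
qed

text \<open>The constant \<open>L0 * \<bar>z\<bar> + C * s\<close> is the most that the upper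
  barrier can rise under the shift, so the corrected function stays below it.\<close>

lemma translate_mem:
  assumes u: "u \<in> subsols" and s: "s \<ge> 0"
  shows "(\<lambda>q. u (q + (z, s)) - (L0 * \<bar>z\<bar> + C * s + L * (\<bar>z\<bar> + \<bar>s\<bar>) * snd q)) \<in> subsols"
proof -
  have c: "continuous_on Qnonneg u" using u by (auto simp: subsols_def)
  have "continuous_on Qnonneg (\<lambda>q. u (q + (z, s)) - (L0 * \<bar>z\<bar> + C * s + L * (\<bar>z\<bar> + \<bar>s\<bar>) * snd q))"
    by (intro continuous_intros continuous_on_compose2[OF c]) (use s in auto)
  moreover have "HJ_sub G Qpos (\<lambda>q. u (q + (z, s)) - (L0 * \<bar>z\<bar> + C * s + L * (\<bar>z\<bar> + \<bar>s\<bar>) * snd q))"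
    by (rule HJ_subI, rule shift_subsol[OF u, where s = s and z = z]) (use s in auto)
  moreover have "u ((x, t) + (z, s)) - (L0 * \<bar>z\<bar> + C * s + L * (\<bar>z\<bar> + \<bar>s\<bar>) * snd (x, t)) \<le> \<kappa>0 x + C * t"
    if t: "t \<ge> 0" for x t
  proof -
    have "u (x + z, t + s) \<le> \<kappa>0 (x + z) + C * (t + s)" using subsolsD(3)[OF u, of "(x + z, t + s)"] s t by simp
    moreover have "\<kappa>0 (x + z) \<le> \<kappa>0 x + L0 * \<bar>z\<bar>" using \<kappa>0_lip[of "x+z" x] by auto
    moreover have "0 \<le> L * (\<bar>z\<bar> + \<bar>s\<bar>) * t" using L_nonneg t by auto
    ultimately show ?thesis by (simp add: algebra_simps)
  qed
  ultimately show ?thesis by (auto simp: subsols_def)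
qed

lemma perron_translate:
  assumes t: "t \<ge> 0" and s: "s \<ge> 0"
  shows "perron (x + z, t + s) \<le> perron (x, t) + (L0 * \<bar>z\<bar> + C * s + L * (\<bar>z\<bar> + s) * t)"
proof (rule perron_le)
  fix u assume "u \<in> subsols"
  from perron_ge[OF translate_mem[OF this s, of z], of "(x,t)"] t s
  show "u (x + z, t + s) \<le> perron (x, t) + (L0 * \<bar>z\<bar> + C * s + L * (\<bar>z\<bar> + s) * t)" by simp
qed

text \<open>A shift into the past leaves the first \<open>s\<close> units of time uncovered. There
  the lower barrier takes over: the deduction \<open>2 * C * s\<close> puts the shifted function,
  frozen at its initial values by \<open>max 0 (snd q - s)\<close>, below \<open>barrier\<close> as
  long as \<open>snd q \<le> s\<close>.\<close>

lemma delay_mem: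
  assumes u: "u \<in> subsols" and s: "s \<ge> 0"
  shows "(\<lambda>q. max (barrier q) (u (fst q, max 0 (snd q - s)) - (2 * C * s + L * s * snd q))) \<in> subsols"
    (is "?v \<in> _")
proof -
  let ?w = "\<lambda>q. u (fst q, max 0 (snd q - s)) - (2 * C * s + L * s * snd q)"
  have c: "continuous_on Qnonneg u" using u by (auto simp: subsols_def)
  have cw: "continuous_on Qnonneg ?w"
    by (intro continuous_intros continuous_on_compose2[OF c]) (use s in auto)
  then have 1: "continuous_on Qnonneg ?v" by (intro continuous_on_max barrier_cont)
  have 2: "?v (x, t) \<le> \<kappa>0 x + C * t" if t: "t \<ge> 0" for x t
  proof -
    have "u (x, max 0 (t - s)) \<le> \<kappa>0 x + C * (max 0 (t - s))" using u by (auto simp: subsols_def)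
    moreover have "C * max 0 (t - s) \<le> C * t" using C_pos t s by (intro mult_left_mono) auto
    moreover have "0 \<le> L * s * t" "0 \<le> C * s" "0 \<le> C * t" using L_nonneg C_pos s t by auto
    ultimately show ?thesis by (auto simp: barrier_def)
  qed
  have "b \<le> G p a" if p: "snd p > 0" and d: "superdiff ?v p a b" for p a b
  proof (cases "?w p \<le> barrier p")
    case True
    then have "superdiff barrier p a b" by (intro superdiff_mono[OF d, of 1]) auto
    then show ?thesis using p by (intro HJ_subD[OF subsolsD(2)[OF barrier_mem]]) auto
  next
    case False
    have ps: "snd p > s"
    proof (rule ccontr)
      assume n: "\<not> snd p > s"
      then have "max 0 (snd p - s) = 0" by auto
      moreover have "u (fst p, 0) \<le> \<kappa>0 (fst p)" using subsolsD(3)[OF u, of "(fst p, 0)"] by simp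
      moreover have "C * snd p \<le> C * s" using n C_pos by (intro mult_left_mono) auto
      moreover have "0 \<le> L * s * snd p" "0 \<le> C * s" using L_nonneg s p C_pos by auto
      ultimately show False using False by (auto simp: barrier_def)
    qed
    have "superdiff (\<lambda>q. u (q + (0, - s)) - (2 * C * s + L * (\<bar>0\<bar> + \<bar>- s\<bar>) * snd q)) p a b"
    proof (rule superdiff_mono[OF d, of "snd p - s"])
      fix q assume "q \<in> ball p (snd p - s)"
      then have "\<bar>snd q - snd p\<bar> < snd p - s"
        using dist_snd_le[of q p] by (auto simp: dist_real_def dist_commute)
      then have "snd q - s > 0" by auto
      then have "max 0 (snd q - s) = snd q - s" by auto
      then show "u (q + (0, - s)) - (2 * C * s + L * (\<bar>0\<bar> + \<bar>- s\<bar>) * snd q) \<le> ?v q"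
        using s by (cases q) auto
    qed (use ps s False in \<open>auto simp: max_def plus_prod_def\<close>)
    then show ?thesis using shift_subsol[OF u, of p "-s" 0] p ps by auto
  qed
  then have "HJ_sub G Qpos ?v" by (intro HJ_subI) simp
  then show ?thesis by (intro subsolsI 1 2)
qed

lemma perron_delay:
  assumes t: "t \<ge> 0" and s: "s \<ge> 0"
  shows "perron (x, t) \<le> perron (x, t + s) + (2 * C * s + L * s * (t + s))"
proof (rule perron_le)
  fix u assume "u \<in> subsols"
  from perron_ge[OF delay_mem[OF this s], of "(x,t+s)"] t s
  show "u (x, t) \<le> perron (x, t + s) + (2 * C * s + L * s * (t + s))" by simp
qed

section \<open>Lipschitz bounds of the Perron function\<close>

lemma perron_lip_x:
  assumes "0 \<le> t"
  shows "\<bar>perron (x, t) - perron (y, t)\<bar> \<le> (L0 + L * t) * \<bar>x - y\<bar>"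
  using perron_translate[of t 0 x "y - x"] perron_translate[of t 0 y "x - y"] assms
  by (auto simp: algebra_simps abs_le_iff abs_minus_commute)

lemma perron_lip_t:
  assumes "0 \<le> t" "t \<le> T" "0 \<le> s" "s \<le> T"
  shows "\<bar>perron (x, t) - perron (x, s)\<bar> \<le> (2 * C + L * T) * \<bar>t - s\<bar>"
proof -
  have *: "\<bar>perron (x, t) - perron (x, s)\<bar> \<le> (2 * C + L * T) * \<bar>t - s\<bar>" if "0 \<le> t" "t \<le> s" "s \<le> T" for t s
  proof -
    have "perron (x, s) \<le> perron (x, t) + C * (s - t) + L * (s - t) * t"
      using perron_translate[of t "s - t" x 0] that by (simp add: algebra_simps)
    moreover have "perron (x, t) \<le> perron (x, s) + (2 * C * (s - t) + L * (s - t) * s)"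
      using perron_delay[of t "s - t" x] that by simp
    moreover have "L * (s - t) * t \<le> L * (s - t) * T" "L * (s - t) * s \<le> L * (s - t) * T" "0 \<le> C * (s - t)"
      using that L_nonneg C_pos by (auto intro!: mult_left_mono)
    ultimately show ?thesis using that by (auto simp: abs_if algebra_simps)
  qed
  show ?thesis using *[of t s] *[of s t] assms by (cases "t \<le> s") (auto simp: abs_minus_commute)
qed

lemma perron_lip:
  assumes "0 \<le> t" "t \<le> T" "0 \<le> s" "s \<le> T"
  shows "\<bar>perron (x, t) - perron (y, s)\<bar> \<le> (L0 + L * T + 2 * C) * (\<bar>x - y\<bar> + \<bar>t - s\<bar>)"
proof -
  have "\<bar>perron (x, t) - perron (y, t)\<bar> \<le> (L0 + L * t) * \<bar>x - y\<bar>" using perron_lip_x[OF assms(1)] .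
  also have "\<dots> \<le> (L0 + L * T + 2 * C) * \<bar>x - y\<bar>"
    using mult_left_mono[OF assms(2) L_nonneg] L0_nonneg C_pos by (intro mult_right_mono) auto
  finally have 1: "\<bar>perron (x, t) - perron (y, t)\<bar> \<le> (L0 + L * T + 2 * C) * \<bar>x - y\<bar>" .
  have "\<bar>perron (y, t) - perron (y, s)\<bar> \<le> (2 * C + L * T) * \<bar>t - s\<bar>" using perron_lip_t[OF assms] .
  also have "\<dots> \<le> (L0 + L * T + 2 * C) * \<bar>t - s\<bar>" using L0_nonneg by (intro mult_right_mono) auto
  finally have "\<bar>perron (y, t) - perron (y, s)\<bar> \<le> (L0 + L * T + 2 * C) * \<bar>t - s\<bar>" .
  then show ?thesis using 1 unfolding distrib_left by linarith
qed

lemma perron_Lip: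
  assumes "T \<ge> 0" shows "Lip {p. 0 \<le> snd p \<and> snd p \<le> T} perron"
  unfolding Lip_def
proof (intro exI[of _ "2 * (L0 + L * T + 2 * C)"] lipschitz_onI)
  have nn: "0 \<le> L0 + L * T + 2 * C" using L0_nonneg L_nonneg assms C_pos by auto
  then show "0 \<le> 2 * (L0 + L * T + 2 * C)" by simp
  fix p q :: "real \<times> real" assume pq: "p \<in> {p. 0 \<le> snd p \<and> snd p \<le> T}" "q \<in> {p. 0 \<le> snd p \<and> snd p \<le> T}"
  have "\<bar>perron (fst p, snd p) - perron (fst q, snd q)\<bar> \<le> (L0 + L * T + 2 * C) * (\<bar>fst p - fst q\<bar> + \<bar>snd p - snd q\<bar>)"
    by (rule perron_lip) (use pq in auto)
  also have "\<dots> \<le> (L0 + L * T + 2 * C) * (dist p q + dist p q)"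
    using dist_fst_le[of p q] dist_snd_le[of p q] nn by (intro mult_left_mono add_mono) (auto simp: dist_real_def)
  finally show "dist (perron p) (perron q) \<le> 2 * (L0 + L * T + 2 * C) * dist p q"
    by (simp add: dist_real_def algebra_simps)
qed

lemma perron_cont: "continuous_on Qnonneg perron"
proof -
  have "continuous (at p within Qnonneg) perron" if "snd p \<ge> 0" for p
  proof -
    \<comment> \<open>The Lipschitz constant grows with the height of the strip, so continuity is
      obtained on one strip for each point.\<close>
    have c: "continuous_on {q. 0 \<le> snd q \<and> snd q \<le> snd p + 1} perron"
      using perron_Lip[of "snd p + 1"] that by (auto simp: Lip_def intro: lipschitz_on_continuous_on)
    have "at p within Qnonneg = at p within {q. 0 \<le> snd q \<and> snd q \<le> snd p + 1}"
      by (rule at_within_nhd[of _ "{q. snd q < snd p + 1}"])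
        (auto intro!: open_Collect_less continuous_intros)
    moreover have "continuous (at p within {q. 0 \<le> snd q \<and> snd q \<le> snd p + 1}) perron"
      using c that unfolding continuous_on_eq_continuous_within by (auto dest!: bspec[of _ _ p] simp del: split_paired_All)
    ultimately show ?thesis by simp
  qed
  then show ?thesis by (auto simp: continuous_on_eq_continuous_within)
qed


section \<open>The Perron function solves the modified equation\<close>

lemma dist_sq: "(dist q p)\<^sup>2 = (fst q - fst p)\<^sup>2 + (snd q - snd p)\<^sup>2" for p q :: "real \<times> real"
  by (simp add: dist_prod_def dist_real_def)

lemma C1_with_add_dist_sq:
  assumes "C1_with S \<phi> \<phi>x \<phi>t"
  shows "C1_with S (\<lambda>q. \<phi> q + c * (dist q p)\<^sup>2) (\<lambda>q. \<phi>x q + c * (2 * (fst q - fst p))) (\<lambda>q. \<phi>t q + c * (2 * (snd q - snd p)))"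
proof -
  have "C1_with S (\<lambda>q. \<phi> q + (c * (fst q - fst p)\<^sup>2 + c * (snd q - snd p)\<^sup>2)) (\<lambda>q. \<phi>x q + c * (2 * (fst q - fst p))) (\<lambda>q. \<phi>t q + c * (2 * (snd q - snd p)))"
    by (rule C1_with_add[OF assms C1_with_separate[where f = "\<lambda>x. c * (x - fst p)\<^sup>2" and g = "\<lambda>x. c * (x - snd p)\<^sup>2"]])
      (auto intro!: derivative_eq_intros continuous_intros)
  then show ?thesis by (simp add: dist_sq distrib_left)
qed

lemma C1_with_cont:
  assumes "C1_with S \<phi> \<phi>x \<phi>t"
  shows "continuous_on S \<phi>"
proof (unfold continuous_on_eq_continuous_within, intro ballI)
  fix p assume "p \<in> S"
  then have "(\<phi> has_derivative (\<lambda>h. \<phi>x p * fst h + \<phi>t p * snd h)) (at p)"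
    by (rule assms[unfolded C1_with_def, THEN conjunct2, THEN conjunct2, THEN bspec])
  then show "continuous (at p within S) \<phi>"
    by (rule continuous_at_imp_continuous_at_within[OF has_derivative_continuous])
qed

lemma C1_with_tendsto:
  assumes "C1_with (ball p r) \<phi> \<phi>x \<phi>t" "r > 0"
  shows "(\<phi>x \<longlongrightarrow> \<phi>x p) (nhds p)" "(\<phi>t \<longlongrightarrow> \<phi>t p) (nhds p)" "(\<phi> \<longlongrightarrow> \<phi> p) (nhds p)"
proof -
  have "continuous_on (ball p r) \<phi>x" "continuous_on (ball p r) \<phi>t" "continuous_on (ball p r) \<phi>"
    using assms(1) C1_with_cont[OF assms(1)] by (simp_all only: C1_with_def)
  then have "isCont \<phi>x p" "isCont \<phi>t p" "isCont \<phi> p"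
    using assms(2) by (auto simp: continuous_on_eq_continuous_at)
  then show "(\<phi>x \<longlongrightarrow> \<phi>x p) (nhds p)" "(\<phi>t \<longlongrightarrow> \<phi>t p) (nhds p)" "(\<phi> \<longlongrightarrow> \<phi> p) (nhds p)"
    by (auto simp: continuous_at tendsto_at_iff_tendsto_nhds)
qed

text \<open>If the inequality fails for a test function at \<open>p\<close>, it fails on a ball.
  Adding the squared distance makes the touching strict, and then some member of
  \<open>subsols\<close> is touched inside that ball, where its own inequality is
  contradicted.\<close>

lemma perron_sub: "HJ_sub G Qpos perron"
proof (rule HJ_subI, rule ccontr)
  fix p a b assume p: "p \<in> Qpos" and d: "superdiff perron p a b" and "\<not> b \<le> G p a"
  then have n: "G p a < b" by simp
  obtain r \<phi> \<phi>x \<phi>t where *: "r > 0" "C1_with (ball p r) \<phi> \<phi>x \<phi>t" "\<And>q. q \<in> ball p r \<Longrightarrow> perron q - \<phi> q \<le> perron p - \<phi> p" "\<phi>x p = a" "\<phi>t p = b"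
    using superdiffE[OF d] by blast
  define \<psi> where "\<psi> = (\<lambda>q. \<phi> q + 1 * (dist q p)\<^sup>2)"
  define \<psi>x where "\<psi>x = (\<lambda>q. \<phi>x q + 1 * (2 * (fst q - fst p)))"
  define \<psi>t where "\<psi>t = (\<lambda>q. \<phi>t q + 1 * (2 * (snd q - snd p)))"
  have C1: "C1_with (ball p r) \<psi> \<psi>x \<psi>t" unfolding \<psi>_def \<psi>x_def \<psi>t_def by (rule C1_with_add_dist_sq[OF *(2)])
  note t = C1_with_tendsto[OF C1 *(1)]
  have "((\<lambda>q. \<psi>t q - G q (\<psi>x q)) \<longlongrightarrow> \<psi>t p - G p (\<psi>x p)) (nhds p)"
    by (intro tendsto_diff t tendsto_G filterlim_ident)
  then have "\<forall>\<^sub>F q in nhds p. 0 < \<psi>t q - G q (\<psi>x q)"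
    by (rule order_tendstoD(1)) (use * n in \<open>simp add: \<psi>t_def \<psi>x_def\<close>)
  then obtain r0 where r0: "r0 > 0" "\<And>q. dist q p < r0 \<Longrightarrow> 0 < \<psi>t q - G q (\<psi>x q)"
    unfolding eventually_nhds_metric by blast
  define r1 where "r1 = min r (min r0 (snd p)) / 2"
  have r1: "r1 > 0" "r1 < r" "r1 < r0" "r1 < snd p" using *(1) r0 p by (auto simp: r1_def)
  have pos: "snd q > 0" if "dist p q \<le> r1" for q
    using dist_snd_le[of p q] that r1 by (auto simp: dist_real_def)
  \<comment> \<open>\<open>u p\<close> is within \<open>r1^2\<close> of the supremum, the amount by
    which the quadratic term lowers the boundary of the ball; a maximum point of
    \<open>u - \<psi>\<close> therefore lies inside.\<close>
  obtain u where u: "u \<in> subsols" "perron p - r1\<^sup>2 < u p"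
    using perron_gtE[of "perron p - r1\<^sup>2" p] r1 by auto
  have "continuous_on (cball p r1) (\<lambda>q. u q - \<psi> q)"
    by (intro continuous_intros continuous_on_subset[OF subsolsD(1)[OF u(1)]] continuous_on_subset[OF C1_with_cont[OF C1]])
      (use r1 pos less_imp_le in \<open>force+\<close>)
  then obtain q where q: "q \<in> cball p r1" "\<And>q'. q' \<in> cball p r1 \<Longrightarrow> u q' - \<psi> q' \<le> u q - \<psi> q"
    using continuous_attains_sup[of "cball p r1" "\<lambda>q. u q - \<psi> q"] r1 by auto
  have "u p - \<psi> p \<le> u q - \<psi> q" using q(2)[of p] r1 by simp
  moreover have "u q \<le> perron q" using perron_ge[OF u(1), of q] pos[of q] q(1) by simp
  moreover have "perron q - \<phi> q \<le> perron p - \<phi> p" using *(3)[of q] q(1) r1 by simp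
  ultimately have "(dist q p)\<^sup>2 < r1\<^sup>2" using u(2) by (simp add: \<psi>_def)
  then have dq: "dist p q < r1" using r1 by (simp add: power_less_imp_less_base dist_commute)
  have "superdiff u q (\<psi>x q) (\<psi>t q)"
  proof (rule superdiffI)
    show "0 < r1 - dist p q" using dq by simp
    have sub: "ball q (r1 - dist p q) \<subseteq> cball p r1"
    proof
      fix z assume "z \<in> ball q (r1 - dist p q)"
      then show "z \<in> cball p r1" using dist_triangle[of p z q] by simp
    qed
    then show "C1_with (ball q (r1 - dist p q)) \<psi> \<psi>x \<psi>t"
      by (rule C1_with_subset[OF C1 order_trans]) (use r1 in auto)
    show "u z - \<psi> z \<le> u q - \<psi> q" if "z \<in> ball q (r1 - dist p q)" for z
      using q(2) sub that by blast
  qed auto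
  then have "\<psi>t q \<le> G q (\<psi>x q)" using pos[of q] q(1) by (intro HJ_subD[OF subsolsD(2)[OF u(1)]]) auto
  moreover have "0 < \<psi>t q - G q (\<psi>x q)" using r0(2)[of q] dq r1 by (simp add: dist_commute)
  ultimately show False by simp
qed

text \<open>At contact with the upper barrier the Perron function falls at least at rate
  \<open>C\<close> when time runs backwards, so \<open>b \<ge> C\<close>. Where the supersolution
  inequality fails, \<open>b < G \<le> C\<close>, and there is room for a bump.\<close>

lemma perron_strict_upper:
  assumes p: "snd p > 0" and d: "subdiff perron p a b" and b: "b < C"
  shows "perron p < \<kappa>0 (fst p) + C * snd p"
proof (rule ccontr)
  assume "\<not> ?thesis"
  then have eq: "perron p = \<kappa>0 (fst p) + C * snd p" using perron_upper[of "snd p" "fst p"] p by simp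
  have "C \<le> (- a) * fst (0, -1 :: real) + (- b) * snd (0 :: real, -1 :: real)"
  proof (rule superdiff_direction[where d = "snd p"])
    show "superdiff (\<lambda>q. - perron q) p (- a) (- b)" using d by (simp add: subdiff_def)
    fix s assume "0 < s" "s < snd p"
    then have "perron (fst p, snd p - s) \<le> \<kappa>0 (fst p) + C * (snd p - s)" by (intro perron_upper) auto
    then show "- perron p + C * s \<le> - perron (p + s *\<^sub>R (0, - 1))"
      using eq by (simp add: plus_prod_def algebra_simps)
  qed (use p in auto)
  then show False using b by simp
qed

text \<open>Where \<open>perron\<close> fails to be a supersolution, a strict subsolution \<open>\<beta>\<close> that exceeds it near \<open>p\<close> can be
  glued in.\<close>
lemma perron_super: "HJ_super G Qpos perron"
proof (rule HJ_superI, rule ccontr)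
  fix p a b assume p: "p \<in> Qpos" and d: "subdiff perron p a b" and "\<not> G p a \<le> b"
  then have n: "b < G p a" by simp
  have gap: "perron p < \<kappa>0 (fst p) + C * snd p"
    by (rule perron_strict_upper[OF _ d]) (use p n G_bound[of p a] in auto)
  obtain r \<phi>' \<phi>'x \<phi>'t where *: "r > 0" "C1_with (ball p r) \<phi>' \<phi>'x \<phi>'t"
    "\<And>q. q \<in> ball p r \<Longrightarrow> - perron q - \<phi>' q \<le> - perron p - \<phi>' p" "\<phi>'x p = - a" "\<phi>'t p = - b"
    using superdiffE[OF d[unfolded subdiff_def]] by blast
  define \<psi> where "\<psi> = (\<lambda>q. - \<phi>' q + (- 1) * (dist q p)\<^sup>2)"
  define \<psi>x where "\<psi>x = (\<lambda>q. - \<phi>'x q + (- 1) * (2 * (fst q - fst p)))"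
  define \<psi>t where "\<psi>t = (\<lambda>q. - \<phi>'t q + (- 1) * (2 * (snd q - snd p)))"
  have C1: "C1_with (ball p r) \<psi> \<psi>x \<psi>t" unfolding \<psi>_def \<psi>x_def \<psi>t_def
    by (rule C1_with_add_dist_sq[OF C1_with_minus[OF *(2)]])
  note t = C1_with_tendsto[OF C1 *(1)]
  have "((\<lambda>q. G q (\<psi>x q) - \<psi>t q) \<longlongrightarrow> G p (\<psi>x p) - \<psi>t p) (nhds p)"
    by (intro tendsto_diff t tendsto_G filterlim_ident)
  then have "\<forall>\<^sub>F q in nhds p. 0 < G q (\<psi>x q) - \<psi>t q"
    by (rule order_tendstoD(1)) (use * n in \<open>simp add: \<psi>t_def \<psi>x_def\<close>)
  then obtain r0 where r0: "r0 > 0" "\<And>q. dist q p < r0 \<Longrightarrow> 0 < G q (\<psi>x q) - \<psi>t q"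
    unfolding eventually_nhds_metric by blast
  define g where "g = \<kappa>0 (fst p) + C * snd p - perron p"
  have g: "g > 0" using gap by (simp add: g_def)
  have "isCont \<kappa>0 (fst p)" using \<kappa>0_cont[of UNIV] by (simp add: continuous_on_eq_continuous_at)
  then have "((\<lambda>q. \<kappa>0 (fst q)) \<longlongrightarrow> \<kappa>0 (fst p)) (nhds p)"
    by (rule isCont_tendsto_compose) (intro tendsto_fst filterlim_ident)
  then have "((\<lambda>q. \<kappa>0 (fst q) + C * snd q - (\<psi> q - \<psi> p + perron p)) \<longlongrightarrow> \<kappa>0 (fst p) + C * snd p - (\<psi> p - \<psi> p + perron p)) (nhds p)"
    by (intro tendsto_add tendsto_diff tendsto_mult tendsto_const tendsto_snd t filterlim_ident)
  then have "\<forall>\<^sub>F q in nhds p. g / 2 < \<kappa>0 (fst q) + C * snd q - (\<psi> q - \<psi> p + perron p)"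
    by (rule order_tendstoD(1)) (use g in \<open>simp add: g_def\<close>)
  then obtain rg where rg: "rg > 0" "\<And>q. dist q p < rg \<Longrightarrow> g / 2 < \<kappa>0 (fst q) + C * snd q - (\<psi> q - \<psi> p + perron p)"
    unfolding eventually_nhds_metric by blast
  define r1 where "r1 = min (min rg r) (min r0 (snd p)) / 2"
  have r1: "r1 > 0" "r1 < r" "r1 < r0" "r1 < snd p" "r1 < rg" using *(1) r0 rg p by (auto simp: r1_def)
  have pos: "snd q > 0" if "dist q p \<le> r1" for q
    using dist_snd_le[of q p] that r1 by (auto simp: dist_real_def)
  \<comment> \<open>\<open>g / 2\<close> keeps the raised test function below the upper barrier;
    \<open>(r1 / 2)^2\<close> keeps it below \<open>perron\<close> at distances from
    \<open>r1 / 2\<close> to \<open>r1\<close>, so that the gluing at radius \<open>r1\<close> is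
    continuous.\<close>
  define \<delta> where "\<delta> = min (g / 2) ((r1 / 2)\<^sup>2)"
  have \<delta>: "\<delta> > 0" "\<delta> \<le> g / 2" "\<delta> \<le> (r1/2)\<^sup>2" using g r1 by (auto simp: \<delta>_def)
  define \<beta> where "\<beta> = (\<lambda>q. \<psi> q - \<psi> p + perron p + \<delta>)"
  define w where "w = (\<lambda>q. if dist q p \<le> r1 then max (perron q) (\<beta> q) else perron q)"
  have below: "\<beta> q \<le> perron q" if "r1 / 2 \<le> dist q p" "dist q p \<le> r1" for q
  proof -
    have "- perron q - \<phi>' q \<le> - perron p - \<phi>' p" using *(3)[of q] that r1 by (simp add: dist_commute)
    moreover have "(r1/2)\<^sup>2 \<le> (dist q p)\<^sup>2" using that r1 by (intro power_mono) auto
    ultimately show ?thesis using \<delta> by (simp add: \<beta>_def \<psi>_def)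
  qed
  have wge: "perron q \<le> w q" for q by (simp add: w_def)
  have C\<beta>: "continuous_on (cball p r1) \<beta>"
    unfolding \<beta>_def by (intro continuous_intros continuous_on_subset[OF C1_with_cont[OF C1]]) (use r1 in auto)
  have "w \<in> subsols"
  proof (rule subsolsI)
    have "continuous_on ({q \<in> Qnonneg. dist q p \<le> r1} \<union> {q \<in> Qnonneg. r1 \<le> dist q p}) w"
      unfolding w_def
    proof (rule continuous_on_cases_local)
      show "closedin (top_of_set ({q \<in> Qnonneg. dist q p \<le> r1} \<union> {q \<in> Qnonneg. r1 \<le> dist q p})) {q \<in> Qnonneg. dist q p \<le> r1}"
        "closedin (top_of_set ({q \<in> Qnonneg. dist q p \<le> r1} \<union> {q \<in> Qnonneg. r1 \<le> dist q p})) {q \<in> Qnonneg. r1 \<le> dist q p}"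
        by (intro closed_subset; force intro!: closed_Collect_conj closed_Collect_le continuous_intros)+
      show "continuous_on {q \<in> Qnonneg. dist q p \<le> r1} (\<lambda>q. max (perron q) (\<beta> q))"
        by (intro continuous_on_max continuous_on_subset[OF perron_cont] continuous_on_subset[OF C\<beta>]) (auto simp: dist_commute)
      show "continuous_on {q \<in> Qnonneg. r1 \<le> dist q p} perron"
        by (intro continuous_on_subset[OF perron_cont]) auto
      fix x assume "x \<in> {q \<in> Qnonneg. dist q p \<le> r1} \<and> \<not> dist x p \<le> r1 \<or> x \<in> {q \<in> Qnonneg. r1 \<le> dist q p} \<and> dist x p \<le> r1"
      then have "dist x p = r1" by auto
      then have "\<beta> x \<le> perron x" using below[of x] r1 by simp
      then show "max (perron x) (\<beta> x) = perron x" by simp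
    qed
    moreover have "{q \<in> Qnonneg. dist q p \<le> r1} \<union> {q \<in> Qnonneg. r1 \<le> dist q p} = Qnonneg" by auto
    ultimately show "continuous_on Qnonneg w" by simp
    show "HJ_sub G Qpos w"
    proof (rule HJ_subI)
      fix q a' b' assume q: "q \<in> Qpos" and dw: "superdiff w q a' b'"
      show "b' \<le> G q a'"
      proof (cases "w q = perron q")
        case True
        have "superdiff perron q a' b'" by (rule superdiff_mono[OF dw, of 1]) (use True wge in auto)
        then show ?thesis using q by (rule HJ_subD[OF perron_sub, rotated])
      next
        case False
        then have dq: "dist q p \<le> r1" "perron q < \<beta> q" "w q = \<beta> q" by (auto simp: w_def max_def split: if_splits)
        then have dq2: "dist q p < r1 / 2" using below[of q] by force
        have "superdiff \<beta> q a' b'"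
        proof (rule superdiff_mono[OF dw, of "r1 / 2"])
          fix z assume "z \<in> ball q (r1 / 2)"
          then have "dist z p \<le> r1" using dist_triangle[of z p q] dq2 by (simp add: dist_commute)
          then show "\<beta> z \<le> w z" by (simp add: w_def)
        qed (use r1 dq in auto)
        moreover have "(\<psi> has_derivative (\<lambda>h. \<psi>x q * fst h + \<psi>t q * snd h)) (at q)"
          using C1 dq r1 by (auto simp: C1_with_def dist_commute)
        then have "(\<beta> has_derivative (\<lambda>h. \<psi>x q * fst h + \<psi>t q * snd h)) (at q)"
          unfolding \<beta>_def by (auto intro!: derivative_eq_intros)
        ultimately have "a' = \<psi>x q" "b' = \<psi>t q" using superdiff_smooth by blast+
        then show ?thesis using r0(2)[of q] dq r1 by simp
      qed
    qed
    fix x t :: real assume t: "t \<ge> 0"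
    have "\<beta> (x, t) \<le> \<kappa>0 x + C * t" if "dist (x, t) p \<le> r1"
      using rg(2)[of "(x,t)"] that r1 \<delta> by (simp add: \<beta>_def)
    then show "w (x, t) \<le> \<kappa>0 x + C * t" using perron_upper[OF t, of x] by (simp add: w_def)
  qed
  then have "w p \<le> perron p" using p by (intro perron_ge) auto
  moreover have "w p \<ge> perron p + \<delta>" using r1 by (simp add: w_def \<beta>_def)
  ultimately show False using \<delta> by simp
qed

end

section \<open>Doubling of variables\<close>

lemma C1_with_plane:
  assumes f: "\<And>x. (f has_real_derivative f' x) (at x)" and c: "continuous_on UNIV f'"
  shows "C1_with S (\<lambda>p. f (\<alpha> * fst p + \<beta> * snd p + \<gamma>)) (\<lambda>p. \<alpha> * f' (\<alpha> * fst p + \<beta> * snd p + \<gamma>)) (\<lambda>p. \<beta> * f' (\<alpha> * fst p + \<beta> * snd p + \<gamma>))"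
proof -
  have "((\<lambda>p. f (\<alpha> * fst p + \<beta> * snd p + \<gamma>)) has_derivative
      (\<lambda>h. \<alpha> * f' (\<alpha> * fst p + \<beta> * snd p + \<gamma>) * fst h + \<beta> * f' (\<alpha> * fst p + \<beta> * snd p + \<gamma>) * snd h)) (at p)" for p :: "real \<times> real"
  proof (rule has_derivative_eq_rhs[OF has_derivative_compose[OF _ f[unfolded has_field_derivative_def]]])
    show "((\<lambda>p. \<alpha> * fst p + \<beta> * snd p + \<gamma>) has_derivative (\<lambda>h. \<alpha> * fst h + \<beta> * snd h)) (at p)"
      by (auto intro!: derivative_eq_intros)
  qed (auto simp: algebra_simps)
  moreover have "continuous_on S (\<lambda>p. \<alpha> * f' (\<alpha> * fst p + \<beta> * snd p + \<gamma>))" "continuous_on S (\<lambda>p. \<beta> * f' (\<alpha> * fst p + \<beta> * snd p + \<gamma>))"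
    by (intro continuous_intros continuous_on_compose2[OF c] subset_UNIV)+
  ultimately show ?thesis unfolding C1_with_def by (intro conjI ballI)
qed

text \<open>A one-sided penalty that is C1 with derivative \<open>2 * max 0 z\<close>. Its zero half
  line leaves the point of violation unpenalized in the doubling arguments.\<close>

definition pen :: "real \<Rightarrow> real" where "pen z = (max 0 z)\<^sup>2"

lemma pen_DERIV: "(pen has_real_derivative 2 * max 0 z) (at z)"
proof -
  consider "z < 0" | "z = 0" | "z > 0" by linarith
  then show ?thesis
  proof cases
    case 1
    have "(pen has_real_derivative 0) (at z)"
      by (rule has_field_derivative_transform_within_open[where f = "\<lambda>_. 0" and S = "{..<0}"]) (use 1 in \<open>auto simp: pen_def\<close>)
    then show ?thesis using 1 by simp
  next
    case 2
    have "((\<lambda>h. (pen (0 + h) - pen 0) / h) \<longlongrightarrow> 0) (at 0)"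
    proof (rule tendsto_0_le[where K = 1])
      show "((\<lambda>h. h) \<longlongrightarrow> 0) (at (0::real))" by (rule tendsto_ident_at)
      show "\<forall>\<^sub>F h in at 0. norm ((pen (0 + h) - pen 0) / h) \<le> norm h * 1"
        by (rule always_eventually) (auto simp: pen_def max_def power2_eq_square)
    qed
    then show ?thesis using 2 by (simp add: DERIV_def)
  next
    case 3
    have "(pen has_real_derivative 2 * z) (at z)"
      by (rule has_field_derivative_transform_within_open[where f = "\<lambda>x. x\<^sup>2" and S = "{0<..}"])
        (use 3 in \<open>auto simp: pen_def intro!: derivative_eq_intros\<close>)
    then show ?thesis using 3 by simp
  qed
qed

lemma pen_cont: "continuous_on S pen"
  unfolding pen_def by (intro continuous_intros)

lemma pen_0: "z \<le> 0 \<Longrightarrow> pen z = 0"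
  by (simp add: pen_def)

lemma pen_nonneg: "0 \<le> pen z"
  by (simp add: pen_def)

lemma pen_ge_1: "1 \<le> z \<Longrightarrow> 1 \<le> pen z"
  by (simp add: pen_def)

lemma C1_with_pen:
  "C1_with S (\<lambda>p. N * pen (\<alpha> * fst p + \<beta> * snd p + \<gamma>)) (\<lambda>p. \<alpha> * (N * (2 * max 0 (\<alpha> * fst p + \<beta> * snd p + \<gamma>))))
     (\<lambda>p. \<beta> * (N * (2 * max 0 (\<alpha> * fst p + \<beta> * snd p + \<gamma>))))"
  by (rule C1_with_plane[where f = "\<lambda>z. N * pen z" and f' = "\<lambda>z. N * (2 * max 0 z)"])
    (auto intro!: DERIV_cmult pen_DERIV continuous_intros)

lemma compact_uniform:
  fixes u :: "'a::metric_space \<Rightarrow> real"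
  assumes "compact S" "continuous_on S u" "e > 0"
  obtains d where "d > 0" "\<And>p q. p \<in> S \<Longrightarrow> q \<in> S \<Longrightarrow> dist p q < d \<Longrightarrow> \<bar>u p - u q\<bar> < e"
  using compact_uniformly_continuous[OF assms(2,1)] assms(3) unfolding uniformly_continuous_on_def dist_real_def by metis

lemma dist_pair_le: "dist (x, t) (y, s) \<le> \<bar>x - y\<bar> + \<bar>t - s :: real\<bar>" for x y :: real
  unfolding dist_Pair_Pair dist_real_def by (rule order_trans[OF sqrt_sum_squares_le_sum]) auto

lemma compact_bound:
  fixes u :: "'a::topological_space \<Rightarrow> real"
  assumes "compact S" "continuous_on S u"
  obtains M where "M > 0" "\<And>p. p \<in> S \<Longrightarrow> \<bar>u p\<bar> \<le> M"
proof -
  have "bounded (u ` S)" by (intro compact_imp_bounded compact_continuous_image assms)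
  then obtain M where "M > 0" "\<And>x. x \<in> u ` S \<Longrightarrow> norm x \<le> M" unfolding bounded_pos by blast
  then show ?thesis by (intro that[of M]) auto
qed

context hamiltonian
begin

text \<open>The penalty travels inwards with speed \<open>K\<close>, the Lipschitz constant of the Hamiltonian in the
  gradient, which absorbs the gradient that it contributes.\<close>
theorem comparison:
  assumes T: "T > 0" and cu: "continuous_on (QTbar T) u" and cv: "continuous_on (QTbar T) v"
    and sub: "\<And>p a b. p \<in> QT T \<Longrightarrow> superdiff_on UNIV u p a b \<Longrightarrow> b \<le> G p a"
    and super: "\<And>p a b. p \<in> QT T \<Longrightarrow> subdiff_on UNIV v p a b \<Longrightarrow> G p a \<le> b"
    and init: "\<And>x. u (x, 0) \<le> v (x, 0)" and t1: "0 < t1" "t1 < T"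
  shows "u (x1, t1) \<le> v (x1, t1)"
proof (rule ccontr)
  assume neg: "\<not> u (x1, t1) \<le> v (x1, t1)"
  \<comment> \<open>One third covers \<open>\<eta> * t1\<close>, all that the penalties amount to at
    \<open>(x1, t1)\<close>; the other two cover the oscillation of \<open>u\<close> and
    \<open>v\<close> when both points are moved to time 0.\<close>
  define \<sigma> where "\<sigma> = (u (x1, t1) - v (x1, t1)) / 3"
  have \<sigma>: "\<sigma> > 0" and \<sigma>3: "u (x1, t1) - v (x1, t1) = 3 * \<sigma>" using neg by (auto simp: \<sigma>_def)
  \<comment> \<open>Makes \<open>\<bar>x1\<bar> + K * t1 - R = 0\<close>, so the cone penalties
    vanish at \<open>(x1, t1)\<close>.\<close>
  define R where "R = \<bar>x1\<bar> + K * t1"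
  define T1 where "T1 = (t1 + T) / 2"
  define \<eta> where "\<eta> = \<sigma> / T"
  have T1: "t1 < T1" "T1 < T" using t1 by (auto simp: T1_def)
  have \<eta>: "\<eta> > 0" "\<eta> * t1 < \<sigma>" using \<sigma> T t1 by (auto simp: \<eta>_def field_simps)
  have R: "R \<ge> 0" "\<bar>x1\<bar> \<le> R" using K_nonneg t1 by (auto simp: R_def)
  define Du where "Du = {-R-1..R+1} \<times> {0..T1}"
  \<comment> \<open>Wider than \<open>Du\<close> and reaching up to \<open>T > T1\<close>: apart
    from the initial time, a point within \<open>d\<close> of the first maximum point is interior to
    this box.\<close>
  define Dv where "Dv = {-R-2..R+2} \<times> {0..T}"
  have D: "compact Du" "compact Dv" unfolding Du_def Dv_def by (auto intro!: compact_Times)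
  have Dsub: "Du \<subseteq> Dv" "Dv \<subseteq> QTbar T" "Du \<subseteq> QTbar T" using T1 unfolding Du_def Dv_def QTbar_def by force+
  obtain M1 where M1: "M1 > 0" "\<And>p. p \<in> Dv \<Longrightarrow> \<bar>u p\<bar> \<le> M1"
    by (rule compact_bound[OF D(2) continuous_on_subset[OF cu Dsub(2)]]) blast
  obtain M2 where M2: "M2 > 0" "\<And>p. p \<in> Dv \<Longrightarrow> \<bar>v p\<bar> \<le> M2"
    by (rule compact_bound[OF D(2) continuous_on_subset[OF cv Dsub(2)]]) blast
  define M where "M = M1 + M2"
  have M: "M > 0" "\<And>p q. p \<in> Du \<Longrightarrow> q \<in> Dv \<Longrightarrow> u p - v q \<le> M"
    using M1 M2 Dsub(1) by (force simp: M_def)+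
  obtain d1 where d1: "d1 > 0" "\<And>p q. p \<in> Dv \<Longrightarrow> q \<in> Dv \<Longrightarrow> dist p q < d1 \<Longrightarrow> \<bar>u p - u q\<bar> < \<sigma>"
    by (rule compact_uniform[OF D(2) continuous_on_subset[OF cu Dsub(2)] \<sigma>]) blast
  obtain d2 where d2: "d2 > 0" "\<And>p q. p \<in> Dv \<Longrightarrow> q \<in> Dv \<Longrightarrow> dist p q < d2 \<Longrightarrow> \<bar>v p - v q\<bar> < \<sigma>"
    by (rule compact_uniform[OF D(2) continuous_on_subset[OF cv Dsub(2)] \<sigma>]) blast
  define d where "d = min (min (d1 / 3) (d2 / 3)) (min (min (1/2) (T - T1)) (\<eta> / (2 * L + 1)))"
  have "0 < \<eta> / (2 * L + 1)" using \<eta> L_nonneg by simp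
  then have "d > 0" "d \<le> d1 / 3" "d \<le> d2 / 3" "d \<le> 1 / 2" "d \<le> T - T1" and d\<eta>: "d \<le> \<eta> / (2 * L + 1)"
    using d1(1) d2(1) T1(2) unfolding d_def by linarith+
  then have d: "d > 0" "2 * d < d1" "2 * d < d2" "d < 1" "d \<le> T - T1" using d1(1) d2(1) by linarith+
  have "2 * L * d < (2 * L + 1) * d" using d by simp
  also have "\<dots> \<le> (2 * L + 1) * (\<eta> / (2 * L + 1))" using d\<eta> L_nonneg by (intro mult_left_mono) auto
  finally have Ld: "2 * L * d < \<eta>" using L_nonneg by simp
  \<comment> \<open>A quadratic penalty of at most \<open>M\<close> then means a distance of at most
    \<open>d\<close>, so one fixed \<open>\<delta>\<close> replaces the limit
    \<open>\<delta> \<rightarrow> 0\<close>.\<close>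
  define \<delta> where "\<delta> = d\<^sup>2 / (2 * M)"
  have \<delta>: "\<delta> > 0" using d M by (simp add: \<delta>_def)
  \<comment> \<open>Makes the penalties exceed \<open>M\<close> on the boundary: the first summand
    serves at \<open>\<bar>x\<bar> = R + 1\<close>, the second at \<open>t = T1\<close>.\<close>
  define N where "N = (M + 1) + (M + 1) / (T1 - t1)\<^sup>2"
  have sq: "(T1 - t1)\<^sup>2 > 0" using T1 by simp
  have N1: "N \<ge> M + 1" using M(1) sq by (simp add: N_def)
  have "N * (T1 - t1)\<^sup>2 = (M + 1) * (T1 - t1)\<^sup>2 + (M + 1)" using sq by (simp add: N_def distrib_right[of "M + 1"] del: distrib_right_numeral)
  then have N: "N \<ge> M + 1" "N * (T1 - t1)\<^sup>2 \<ge> M + 1" "N > 0"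
    using M(1) sq N1 by auto
  define pu where "pu = (\<lambda>p. N * pen (1 * fst p + K * snd p + (- R)) + N * pen ((-1) * fst p + K * snd p + (- R))
      + N * pen (0 * fst p + 1 * snd p + (- t1)) + \<eta> * snd p)"
  define \<Phi> where "\<Phi> = (\<lambda>(p, q). u p - v q - ((fst p - fst q)\<^sup>2 + (snd p - snd q)\<^sup>2) / (2 * \<delta>) - pu p)"
  have cont: "continuous_on (Du \<times> Dv) \<Phi>"
    unfolding \<Phi>_def pu_def split_beta
    by (intro continuous_intros continuous_on_compose2[OF continuous_on_subset[OF cu Dsub(3)]]
        continuous_on_compose2[OF continuous_on_subset[OF cv Dsub(2)]] continuous_on_compose2[OF pen_cont[of UNIV]])
      (use \<delta> in auto)
  have in1: "(x1, t1) \<in> Du" "(x1, t1) \<in> Dv" using R t1 T1 by (auto simp: Du_def Dv_def)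
  obtain z where z: "z \<in> Du \<times> Dv" "\<And>z'. z' \<in> Du \<times> Dv \<Longrightarrow> \<Phi> z' \<le> \<Phi> z"
    using continuous_attains_sup[OF compact_Times[OF D] _ cont] in1 by blast
  obtain x t y s where zz: "z = ((x, t), (y, s))" by (metis prod.exhaust)
  have pD: "(x, t) \<in> Du" "(y, s) \<in> Dv" using z(1) zz by auto
  have max: "\<Phi> (p, q) \<le> \<Phi> ((x, t), (y, s))" if "p \<in> Du" "q \<in> Dv" for p q
    using z(2)[of "(p, q)"] that zz by simp
  have pu0: "pu (x1, t1) = \<eta> * t1"
  proof -
    have "pen (1 * x1 + K * t1 + (- R)) = 0" "pen ((-1) * x1 + K * t1 + (- R)) = 0" by (intro pen_0; simp add: R_def)+
    then show ?thesis by (simp add: pu_def pen_0)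
  qed
  have low: "2 * \<sigma> < \<Phi> ((x, t), (y, s))"
    using max[OF in1] \<sigma>3 \<eta> by (simp add: \<Phi>_def pu0)
  have pun: "0 \<le> pu (x, t)" using N \<eta> pD pen_nonneg by (auto simp: pu_def Du_def)
  have "((x - y)\<^sup>2 + (t - s)\<^sup>2) / (2 * \<delta>) \<le> M"
    using low M(2)[OF pD] pun \<sigma> by (simp add: \<Phi>_def)
  then have "(x - y)\<^sup>2 + (t - s)\<^sup>2 \<le> d\<^sup>2" using \<delta> M(1) by (simp only: pos_divide_le_eq mult_pos_pos zero_less_numeral) (simp add: \<delta>_def)
  then have "\<bar>x - y\<bar>\<^sup>2 \<le> d\<^sup>2" "\<bar>t - s\<bar>\<^sup>2 \<le> d\<^sup>2" by (auto intro: order_trans[rotated])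
  then have close: "\<bar>x - y\<bar> \<le> d" "\<bar>t - s\<bar> \<le> d" using d(1) power2_le_imp_le by (metis less_imp_le)+
  have uvlow: "2 * \<sigma> < u (x, t) - v (y, s)"
  proof -
    have "0 \<le> ((x - y)\<^sup>2 + (t - s)\<^sup>2) / (2 * \<delta>)" using \<delta> by simp
    then show ?thesis using low pun by (simp add: \<Phi>_def)
  qed
  have pule: "pu (x, t) \<le> M"
  proof -
    have "0 \<le> ((x - y)\<^sup>2 + (t - s)\<^sup>2) / (2 * \<delta>)" using \<delta> by simp
    then show ?thesis using low M(2)[OF pD] \<sigma> by (simp add: \<Phi>_def)
  qed
  have t_ge: "0 \<le> t" "0 \<le> s" "t \<le> T1" "s \<le> T" using pD by (auto simp: Du_def Dv_def)
  have tpos: "0 < t \<and> 0 < s"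
  proof (rule ccontr)
    assume "\<not> (0 < t \<and> 0 < s)"
    then have ts: "t \<le> d" "s \<le> d" using close t_ge by auto
    have mem: "(x, 0) \<in> Dv" "(x, t) \<in> Dv" using pD T T1(2) by (auto simp: Du_def Dv_def)
    have "dist (x, t) (x, 0) < d1" using dist_pair_le[of x t x 0] ts t_ge d by simp
    then have "u (x, t) < u (x, 0) + \<sigma>" using d1(2)[OF mem(2,1)] by auto
    moreover have "dist (y, s) (x, 0) < d2" using dist_pair_le[of y s x 0] ts t_ge d close by simp
    then have "v (x, 0) - \<sigma> < v (y, s)" using d2(2)[OF pD(2) mem(1)] by auto
    ultimately show False using uvlow init[of x] by simp
  qed
  have xint: "\<bar>x\<bar> < R + 1"
  proof (rule ccontr)
    assume n: "\<not> \<bar>x\<bar> < R + 1"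
    have "0 \<le> K * t" using K_nonneg t_ge by simp
    then have "1 \<le> 1 * x + K * t + (- R) \<or> 1 \<le> (-1) * x + K * t + (- R)" using n by linarith
    then have "1 \<le> pen (1 * x + K * t + (- R)) \<or> 1 \<le> pen ((-1) * x + K * t + (- R))" using pen_ge_1 by blast
    then have "1 \<le> pen (1 * x + K * t + (- R)) + pen ((-1) * x + K * t + (- R))"
      using pen_nonneg[of "1 * x + K * t + (- R)"] pen_nonneg[of "(-1) * x + K * t + (- R)"] by linarith
    then have "N * 1 \<le> N * (pen (1 * x + K * t + (- R)) + pen ((-1) * x + K * t + (- R)))" using N by (intro mult_left_mono) auto
    moreover have "0 \<le> N * pen (0 * x + 1 * t + (- t1))" "0 \<le> \<eta> * t" using N \<eta> t_ge pen_nonneg by auto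
    ultimately have "N \<le> pu (x, t)" by (simp add: pu_def distrib_left)
    then show False using pule N by simp
  qed
  have tint: "t < T1"
  proof (rule ccontr)
    assume n: "\<not> t < T1"
    then have "t = T1" using t_ge by simp
    then have "pen (0 * x + 1 * t + (- t1)) = (T1 - t1)\<^sup>2" using T1 by (simp add: pen_def)
    moreover have "0 \<le> N * pen (1 * x + K * t + (- R))" "0 \<le> N * pen ((-1) * x + K * t + (- R))" "0 \<le> \<eta> * t"
      using N \<eta> t_ge pen_nonneg by auto
    ultimately have "N * (T1 - t1)\<^sup>2 \<le> pu (x, t)" by (simp add: pu_def)
    then show False using pule N by simp
  qed
  have sint: "s < T" using close tint d by linarith
  have yint: "\<bar>y\<bar> < R + 2" using xint close d by linarith
  have "(x, t) \<in> {-R-1<..<R+1} \<times> {0<..<T1}" using xint tpos tint by auto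
  then obtain ru where ru: "ru > 0" "ball (x, t) ru \<subseteq> {-R-1<..<R+1} \<times> {0<..<T1}"
    by (rule openE[OF open_Times[OF open_greaterThanLessThan open_greaterThanLessThan]])
  have "(y, s) \<in> {-R-2<..<R+2} \<times> {0<..<T}" using yint tpos sint by auto
  then obtain rv where rv: "rv > 0" "ball (y, s) rv \<subseteq> {-R-2<..<R+2} \<times> {0<..<T}"
    by (rule openE[OF open_Times[OF open_greaterThanLessThan open_greaterThanLessThan]])
  define m1 where "m1 = N * (2 * max 0 (1 * x + K * t + (- R)))"
  define m2 where "m2 = N * (2 * max 0 ((-1) * x + K * t + (- R)))"
  define m3 where "m3 = N * (2 * max 0 (0 * x + 1 * t + (- t1)))"
  have m: "m1 \<ge> 0" "m2 \<ge> 0" "m3 \<ge> 0" using N by (auto simp: m1_def m2_def m3_def)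
  have "superdiff_on UNIV u (x, t) ((x - y) / \<delta> + m1 - m2) ((t - s) / \<delta> + K * m1 + K * m2 + m3 + \<eta>)"
  proof (rule superdiff_onI[OF _ _ ru(1)])
    have 0: "C1_with UNIV (\<lambda>p. (fst p - y)\<^sup>2 / (2 * \<delta>) + ((snd p - s)\<^sup>2 / (2 * \<delta>) + \<eta> * snd p))
        (\<lambda>p. (fst p - y) / \<delta>) (\<lambda>p. (snd p - s) / \<delta> + \<eta>)"
      by (rule C1_with_separate[where f = "\<lambda>x. (x - y)\<^sup>2 / (2 * \<delta>)" and g = "\<lambda>t. (t - s)\<^sup>2 / (2 * \<delta>) + \<eta> * t"
          and f' = "\<lambda>x. (x - y) / \<delta>" and g' = "\<lambda>t. (t - s) / \<delta> + \<eta>"])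
        (use \<delta> in \<open>auto intro!: derivative_eq_intros continuous_intros simp: field_simps\<close>)
    show "C1_with UNIV (\<lambda>p. ((fst p - y)\<^sup>2 / (2 * \<delta>) + ((snd p - s)\<^sup>2 / (2 * \<delta>) + \<eta> * snd p)) +
        (N * pen (1 * fst p + K * snd p + (- R)) + (N * pen ((-1) * fst p + K * snd p + (- R))
      + N * pen (0 * fst p + 1 * snd p + (- t1)))))
      (\<lambda>p. (fst p - y) / \<delta> + (1 * (N * (2 * max 0 (1 * fst p + K * snd p + (- R)))) +
          ((-1) * (N * (2 * max 0 ((-1) * fst p + K * snd p + (- R)))) + 0 * (N * (2 * max 0 (0 * fst p + 1 * snd p + (- t1)))))))
      (\<lambda>p. ((snd p - s) / \<delta> + \<eta>) + (K * (N * (2 * max 0 (1 * fst p + K * snd p + (- R)))) +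
          (K * (N * (2 * max 0 ((-1) * fst p + K * snd p + (- R)))) + 1 * (N * (2 * max 0 (0 * fst p + 1 * snd p + (- t1)))))))"
      by (intro C1_with_add 0 C1_with_pen)
    fix q assume "q \<in> ball (x, t) ru"
    then have "q \<in> {-R-1<..<R+1} \<times> {0<..<T1}" using ru(2) by blast
    then have "q \<in> Du" by (auto simp: Du_def)
    from max[OF this pD(2)]
    show "u q - ((fst q - y)\<^sup>2 / (2 * \<delta>) + ((snd q - s)\<^sup>2 / (2 * \<delta>) + \<eta> * snd q) +
         (N * pen (1 * fst q + K * snd q + - R) +
          (N * pen (- 1 * fst q + K * snd q + - R) + N * pen (0 * fst q + 1 * snd q + - t1))))
         \<le> u (x, t) - ((fst (x, t) - y)\<^sup>2 / (2 * \<delta>) + ((snd (x, t) - s)\<^sup>2 / (2 * \<delta>) + \<eta> * snd (x, t)) +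
         (N * pen (1 * fst (x, t) + K * snd (x, t) + - R) +
          (N * pen (- 1 * fst (x, t) + K * snd (x, t) + - R) + N * pen (0 * fst (x, t) + 1 * snd (x, t) + - t1))))"
      by (simp add: \<Phi>_def pu_def add_divide_distrib)
  qed (auto simp: m1_def m2_def m3_def)
  moreover have "(x, t) \<in> QT T" using tpos tint T1 by (auto simp: QT_def)
  ultimately have 1: "(t - s) / \<delta> + K * m1 + K * m2 + m3 + \<eta> \<le> G (x, t) ((x - y) / \<delta> + m1 - m2)" by (rule sub[rotated])
  have "subdiff_on UNIV v (y, s) ((x - y) / \<delta>) ((t - s) / \<delta>)"
  proof (rule subdiff_onI[OF _ _ rv(1)])
    show "C1_with UNIV (\<lambda>p. - (x - fst p)\<^sup>2 / (2 * \<delta>) + - (t - snd p)\<^sup>2 / (2 * \<delta>))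
        (\<lambda>p. (x - fst p) / \<delta>) (\<lambda>p. (t - snd p) / \<delta>)"
      by (rule C1_with_separate[where f = "\<lambda>y. - (x - y)\<^sup>2 / (2 * \<delta>)" and g = "\<lambda>s. - (t - s)\<^sup>2 / (2 * \<delta>)"
          and f' = "\<lambda>y. (x - y) / \<delta>" and g' = "\<lambda>s. (t - s) / \<delta>"])
        (use \<delta> in \<open>auto intro!: derivative_eq_intros continuous_intros simp: field_simps\<close>)
    fix q assume "q \<in> ball (y, s) rv"
    then have "q \<in> {-R-2<..<R+2} \<times> {0<..<T}" using rv(2) by blast
    then have "q \<in> Dv" by (auto simp: Dv_def)
    from max[OF pD(1) this]
    show "v (y, s) - (- (x - fst (y, s))\<^sup>2 / (2 * \<delta>) + - (t - snd (y, s))\<^sup>2 / (2 * \<delta>))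
         \<le> v q - (- (x - fst q)\<^sup>2 / (2 * \<delta>) + - (t - snd q)\<^sup>2 / (2 * \<delta>))"
      by (simp add: \<Phi>_def add_divide_distrib)
  qed auto
  moreover have "(y, s) \<in> QT T" using tpos sint by (auto simp: QT_def)
  ultimately have 2: "G (y, s) ((x - y) / \<delta>) \<le> (t - s) / \<delta>" by (rule super[rotated])
  have "G (x, t) ((x - y) / \<delta> + m1 - m2) \<le> G (x, t) ((x - y) / \<delta>) + K * \<bar>m1 - m2\<bar>"
    using G_lip_grad[of "(x, t)" "(x - y) / \<delta> + m1 - m2" "(x - y) / \<delta>"] by simp
  also have "K * \<bar>m1 - m2\<bar> \<le> K * (m1 + m2)" using K_nonneg m by (intro mult_left_mono) auto
  finally have 3: "G (x, t) ((x - y) / \<delta> + m1 - m2) \<le> G (x, t) ((x - y) / \<delta>) + K * m1 + K * m2" by (simp add: distrib_left)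
  have "G (x, t) ((x - y) / \<delta>) \<le> G (y, s) ((x - y) / \<delta>) + L * (\<bar>x - y\<bar> + \<bar>t - s\<bar>)"
    using G_lip[of x t "(x - y) / \<delta>" y s] by simp
  also have "L * (\<bar>x - y\<bar> + \<bar>t - s\<bar>) \<le> L * (d + d)" using close L_nonneg by (intro mult_left_mono) auto
  finally have "\<eta> \<le> 2 * L * d" using 1 2 3 m by simp
  then show False using Ld by simp
qed


section \<open>Lower bound for the spatial increments of a solution\<close>

lemma C1_with_frozen_fst:
  assumes "C1_with S \<phi> \<phi>x \<phi>t" "\<And>p. p \<in> S \<Longrightarrow> (c, snd p) \<in> S"
  shows "C1_with S (\<lambda>p. \<phi> (c, snd p)) (\<lambda>p. 0) (\<lambda>p. \<phi>t (c, snd p))"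
proof -
  have "((\<lambda>p. \<phi> (c, snd p)) has_derivative (\<lambda>h. 0 * fst h + \<phi>t (c, snd p) * snd h)) (at p)" if "p \<in> S" for p
  proof -
    have 1: "((\<lambda>p. (c, snd p)) has_derivative (\<lambda>h. (0, snd h))) (at p)"
      by (auto intro!: derivative_eq_intros)
    have 2: "(\<phi> has_derivative (\<lambda>h. \<phi>x (c, snd p) * fst h + \<phi>t (c, snd p) * snd h)) (at (c, snd p))"
      using assms(2)[OF that] by (rule assms(1)[unfolded C1_with_def, THEN conjunct2, THEN conjunct2, THEN bspec])
    show ?thesis using has_derivative_compose[OF 1 2] by simp
  qed
  moreover have "continuous_on S (\<lambda>p. \<phi>t (c, snd p))"
    by (rule continuous_on_compose2[OF assms(1)[unfolded C1_with_def, THEN conjunct2, THEN conjunct1]])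
      (auto intro!: continuous_intros assms(2))
  ultimately show ?thesis unfolding C1_with_def by (intro conjI ballI continuous_on_const)
qed

lemma C1_with_frozen_snd:
  assumes "C1_with S \<phi> \<phi>x \<phi>t" "\<And>p. p \<in> S \<Longrightarrow> (fst p, c) \<in> S"
  shows "C1_with S (\<lambda>p. \<phi> (fst p, c)) (\<lambda>p. \<phi>x (fst p, c)) (\<lambda>p. 0)"
proof -
  have "((\<lambda>p. \<phi> (fst p, c)) has_derivative (\<lambda>h. \<phi>x (fst p, c) * fst h + 0 * snd h)) (at p)" if "p \<in> S" for p
  proof -
    have 1: "((\<lambda>p. (fst p, c)) has_derivative (\<lambda>h. (fst h, 0))) (at p)"
      by (auto intro!: derivative_eq_intros)
    have 2: "(\<phi> has_derivative (\<lambda>h. \<phi>x (fst p, c) * fst h + \<phi>t (fst p, c) * snd h)) (at (fst p, c))"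
      using assms(2)[OF that] by (rule assms(1)[unfolded C1_with_def, THEN conjunct2, THEN conjunct2, THEN bspec])
    show ?thesis using has_derivative_compose[OF 1 2] by simp
  qed
  moreover have "continuous_on S (\<lambda>p. \<phi>x (fst p, c))"
    by (rule continuous_on_compose2[OF assms(1)[unfolded C1_with_def, THEN conjunct1]])
      (auto intro!: continuous_intros assms(2))
  ultimately show ?thesis unfolding C1_with_def by (intro conjI ballI continuous_on_const)
qed

text \<open>Doubling the variables of one and the same solution on the half space \<open>x \<le> y\<close>: the
  hypothesis \<open>flux\<close> says that the increments of \<open>k\<close> grow no faster than those of a solution.\<close>
theorem increment_lower_bound:
  assumes cu: "continuous_on Qnonneg \<kappa>" and sub: "HJ_sub G Qpos \<kappa>" and super: "HJ_super G Qpos \<kappa>"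
    and C1: "C1_with Qpos k B kt" and ck: "continuous_on Qnonneg k"
    and flux: "\<And>x y t. 0 < t \<Longrightarrow> x \<le> y \<Longrightarrow> kt (y, t) - G (y, t) (B (y, t)) \<le> kt (x, t) - G (x, t) (B (x, t))"
    and init: "\<And>x y. x \<le> y \<Longrightarrow> k (y, 0) - k (x, 0) \<le> \<kappa> (y, 0) - \<kappa> (x, 0)"
    and xy1: "x1 \<le> y1" and t1: "0 < t1"
  shows "k (y1, t1) - k (x1, t1) \<le> \<kappa> (y1, t1) - \<kappa> (x1, t1)"
proof (rule ccontr)
  assume neg: "\<not> k (y1, t1) - k (x1, t1) \<le> \<kappa> (y1, t1) - \<kappa> (x1, t1)"
  \<comment> \<open>One fifth covers the penalty \<open>\<eta> * t1\<close>; the other four cover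
    the oscillation of \<open>\<kappa>\<close> and of \<open>k\<close> at both end points when the
    times are moved to 0.\<close>
  define \<sigma> where "\<sigma> = (\<kappa> (x1, t1) - \<kappa> (y1, t1) + k (y1, t1) - k (x1, t1)) / 5"
  have \<sigma>: "\<sigma> > 0" and \<sigma>5: "\<kappa> (x1, t1) - \<kappa> (y1, t1) + k (y1, t1) - k (x1, t1) = 5 * \<sigma>" using neg by (auto simp: \<sigma>_def)
  define R where "R = \<bar>x1\<bar> + \<bar>y1\<bar> + K * t1"
  define \<eta> where "\<eta> = \<sigma> / t1"
  have \<eta>: "\<eta> > 0" "\<eta> * t1 = \<sigma>" using \<sigma> t1 by (auto simp: \<eta>_def field_simps)
  have R: "R \<ge> 0" "\<bar>x1\<bar> \<le> R" "\<bar>y1\<bar> \<le> R" using K_nonneg t1 by (auto simp: R_def)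
  define D where "D = {-R-1..R+1} \<times> {0..t1+2}"
  have D: "compact D" unfolding D_def by (auto intro!: compact_Times)
  have Dsub: "D \<subseteq> Qnonneg" unfolding D_def by force
  obtain M1 where M1: "M1 > 0" "\<And>p. p \<in> D \<Longrightarrow> \<bar>\<kappa> p\<bar> \<le> M1"
    by (rule compact_bound[OF D continuous_on_subset[OF cu Dsub]]) blast
  obtain M2 where M2: "M2 > 0" "\<And>p. p \<in> D \<Longrightarrow> \<bar>k p\<bar> \<le> M2"
    by (rule compact_bound[OF D continuous_on_subset[OF ck Dsub]]) blast
  define M where "M = 2 * M1 + 2 * M2"
  have mix: "(y, t) \<in> D" if "(x, t) \<in> D" "(y, s) \<in> D" for x y t s :: real using that by (auto simp: D_def)
  have M: "M > 0" "\<And>x y t s. (x, t) \<in> D \<Longrightarrow> (y, s) \<in> D \<Longrightarrow> \<kappa> (x, t) - \<kappa> (y, s) + k (y, t) - k (x, t) \<le> M"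
  proof -
    show "M > 0" using M1 M2 by (simp add: M_def)
    fix x y t s assume *: "(x, t) \<in> D" "(y, s) \<in> D"
    show "\<kappa> (x, t) - \<kappa> (y, s) + k (y, t) - k (x, t) \<le> M"
      using M1(2)[OF *(1)] M1(2)[OF *(2)] M2(2)[OF *(1)] M2(2)[OF mix[OF *]] by (simp add: M_def)
  qed
  obtain d1 where d1: "d1 > 0" "\<And>p q. p \<in> D \<Longrightarrow> q \<in> D \<Longrightarrow> dist p q < d1 \<Longrightarrow> \<bar>\<kappa> p - \<kappa> q\<bar> < \<sigma>"
    by (rule compact_uniform[OF D continuous_on_subset[OF cu Dsub] \<sigma>]) blast
  obtain d2 where d2: "d2 > 0" "\<And>p q. p \<in> D \<Longrightarrow> q \<in> D \<Longrightarrow> dist p q < d2 \<Longrightarrow> \<bar>k p - k q\<bar> < \<sigma>"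
    by (rule compact_uniform[OF D continuous_on_subset[OF ck Dsub] \<sigma>]) blast
  define d where "d = min (min (d1 / 2) (d2 / 2)) (min (1/2) (\<eta> / (L + 1)))"
  have "0 < \<eta> / (L + 1)" using \<eta> L_nonneg by simp
  then have "d > 0" "d \<le> d1 / 2" "d \<le> d2 / 2" "d \<le> 1 / 2" and d\<eta>: "d \<le> \<eta> / (L + 1)"
    using d1(1) d2(1) unfolding d_def by linarith+
  then have d: "d > 0" "d < d1" "d < d2" "d < 1" using d1(1) d2(1) by linarith+
  have "L * d < (L + 1) * d" using d by simp
  also have "\<dots> \<le> (L + 1) * (\<eta> / (L + 1))" using d\<eta> L_nonneg by (intro mult_left_mono) auto
  finally have Ld: "L * d < \<eta>" using L_nonneg by simp
  define \<delta> where "\<delta> = d\<^sup>2 / (2 * M)"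
  have \<delta>: "\<delta> > 0" using d M(1) by (simp add: \<delta>_def)
  define N where "N = M + 1"
  have N: "N \<ge> M + 1" "N > 0" using M(1) by (auto simp: N_def)
  \<comment> \<open>\<open>pu\<close> penalizes the left end and \<open>pv\<close> the right end;
    \<open>x < y\<close> supplies the other two spatial bounds.\<close>
  define pu where "pu = (\<lambda>p. N * pen ((-1) * fst p + K * snd p + (- R)) + N * pen (0 * fst p + 1 * snd p + (- t1)) + \<eta> * snd p)"
  define pv where "pv = (\<lambda>p. N * pen (1 * fst p + K * snd p + (- R)))"
  \<comment> \<open>Only time is doubled, since the two space points belong to the problem. Both
    values of \<open>k\<close> are taken at the time of the first point, so that \<open>flux\<close>
    applies at a single time; this is why frozen arguments of \<open>k\<close> appear in the test
    functions.\<close>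
  define \<Phi> where "\<Phi> = (\<lambda>(p, q). \<kappa> p - \<kappa> q + k (fst q, snd p) - k p - (snd p - snd q)\<^sup>2 / (2 * \<delta>) - pu p - pv q)"
  define S where "S = (D \<times> D) \<inter> {z. fst (fst z) \<le> fst (snd z)}"
  have S: "compact S" unfolding S_def
    by (intro compact_Int_closed compact_Times D closed_Collect_le continuous_intros)
  have mixD: "(fst (snd z), snd (fst z)) \<in> D" if "z \<in> S" for z using that by (auto simp: S_def D_def)
  have c\<kappa>: "continuous_on D \<kappa>" and cd: "continuous_on D k" by (rule continuous_on_subset[OF cu Dsub] continuous_on_subset[OF ck Dsub])+
  have fD: "fst z \<in> D" "snd z \<in> D" if "z \<in> S" for z using that unfolding S_def by auto
  have "continuous_on S (\<lambda>z. \<kappa> (fst z))" "continuous_on S (\<lambda>z. \<kappa> (snd z))"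
    "continuous_on S (\<lambda>z. k (fst (snd z), snd (fst z)))" "continuous_on S (\<lambda>z. k (fst z))"
    by (rule continuous_on_compose2[OF c\<kappa>] continuous_on_compose2[OF cd]; use fD mixD in \<open>force intro!: continuous_intros\<close>)+
  moreover have "continuous_on S (\<lambda>z. pu (fst z))" "continuous_on S (\<lambda>z. pv (snd z))"
    unfolding pu_def pv_def
    by (intro continuous_intros continuous_on_compose2[OF pen_cont[of UNIV]] subset_UNIV)+
  moreover have "continuous_on S (\<lambda>z. (snd (fst z) - snd (snd z))\<^sup>2 / (2 * \<delta>))"
    using \<delta> by (intro continuous_intros) auto
  ultimately have cont: "continuous_on S \<Phi>"
    unfolding \<Phi>_def split_beta by (intro continuous_on_add continuous_on_diff)
  have in1: "((x1, t1), (y1, t1)) \<in> S" using R t1 xy1 by (auto simp: S_def D_def)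
  obtain z where z: "z \<in> S" "\<And>z'. z' \<in> S \<Longrightarrow> \<Phi> z' \<le> \<Phi> z"
    using continuous_attains_sup[OF S _ cont] in1 by blast
  obtain x t y s where zz: "z = ((x, t), (y, s))" by (metis prod.exhaust)
  have pD: "(x, t) \<in> D" "(y, s) \<in> D" "x \<le> y" using z(1) zz by (auto simp: S_def)
  have max: "\<Phi> (p, q) \<le> \<Phi> ((x, t), (y, s))" if "p \<in> D" "q \<in> D" "fst p \<le> fst q" for p q
    using z(2)[of "(p, q)"] that zz by (simp add: S_def)
  have pu0: "pu (x1, t1) = \<sigma>" and pv0: "pv (y1, t1) = 0"
  proof -
    have "pen (1 * y1 + K * t1 + (- R)) = 0" "pen ((-1) * x1 + K * t1 + (- R)) = 0" by (intro pen_0; simp add: R_def)+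
    then show "pu (x1, t1) = \<sigma>" "pv (y1, t1) = 0" using \<eta> by (auto simp: pu_def pv_def pen_0)
  qed
  have low: "4 * \<sigma> \<le> \<Phi> ((x, t), (y, s))"
    using z(2)[OF in1] \<sigma>5 zz by (simp add: \<Phi>_def pu0 pv0)
  have pun: "0 \<le> pu (x, t)" "0 \<le> pv (y, s)" using N \<eta> pD pen_nonneg by (auto simp: pu_def pv_def D_def)
  have sqn: "0 \<le> (t - s)\<^sup>2 / (2 * \<delta>)" using \<delta> by simp
  note bd = M(2)[OF pD(1,2)]
  have "(t - s)\<^sup>2 / (2 * \<delta>) \<le> M"
    using low bd pun \<sigma> by (simp add: \<Phi>_def)
  then have "(t - s)\<^sup>2 \<le> d\<^sup>2" using \<delta> M(1) by (simp only: pos_divide_le_eq mult_pos_pos zero_less_numeral) (simp add: \<delta>_def)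
  then have close: "\<bar>t - s\<bar> \<le> d" using d(1) abs_le_square_iff[of "t - s" d] by simp
  have uvlow: "4 * \<sigma> \<le> \<kappa> (x, t) - \<kappa> (y, s) + k (y, t) - k (x, t)"
    using low pun sqn by (simp add: \<Phi>_def)
  have pule: "pu (x, t) \<le> M" "pv (y, s) \<le> M"
    using low bd \<sigma> pun sqn by (simp_all add: \<Phi>_def)
  have t_ge: "0 \<le> t" "0 \<le> s" "t \<le> t1 + 2" "s \<le> t1 + 2" using pD by (auto simp: D_def)
  have tpos: "0 < t \<and> 0 < s"
  proof (rule ccontr)
    assume "\<not> (0 < t \<and> 0 < s)"
    then have ts: "t \<le> d" "s \<le> d" using close t_ge by auto
    have mem: "(x, 0) \<in> D" "(y, 0) \<in> D" "(y, t) \<in> D" using pD t1 by (auto simp: D_def)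
    have dd: "dist (x, t) (x, 0) \<le> d" "dist (y, s) (y, 0) \<le> d" "dist (y, t) (y, 0) \<le> d"
      using dist_pair_le[of x t x 0] dist_pair_le[of y s y 0] dist_pair_le[of y t y 0] ts t_ge by auto
    have "\<bar>\<kappa> (x, t) - \<kappa> (x, 0)\<bar> < \<sigma>" "\<bar>\<kappa> (y, s) - \<kappa> (y, 0)\<bar> < \<sigma>"
      by (rule d1(2)[OF pD(1) mem(1)] d1(2)[OF pD(2) mem(2)], use dd d in simp)+
    moreover have "\<bar>k (x, t) - k (x, 0)\<bar> < \<sigma>" "\<bar>k (y, t) - k (y, 0)\<bar> < \<sigma>"
      by (rule d2(2)[OF pD(1) mem(1)] d2(2)[OF mem(3,2)], use dd d in simp)+
    ultimately show False using uvlow init[OF pD(3)] by linarith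
  qed
  \<comment> \<open>On the diagonal the terms in \<open>k\<close> cancel, and what is left is an
    oscillation of \<open>\<kappa>\<close> in time, too small for
    \<open>4 * \<sigma>\<close>.\<close>
  have xy: "x < y"
  proof (rule ccontr)
    assume "\<not> x < y"
    then have "y = x" using pD by simp
    then have "dist (x, t) (y, s) < d1" using dist_pair_le[of x t y s] close d by simp
    then have "\<bar>\<kappa> (x, t) - \<kappa> (y, s)\<bar> < \<sigma>" by (rule d1(2)[OF pD(1,2)])
    then show False using uvlow \<open>y = x\<close> \<sigma> by simp
  qed
  have xint: "- R - 1 < x"
  proof (rule ccontr)
    assume n: "\<not> - R - 1 < x"
    have "0 \<le> K * t" using K_nonneg t_ge by simp
    then have "1 \<le> pen ((-1) * x + K * t + (- R))" using n by (intro pen_ge_1) linarith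
    then have "N * 1 \<le> N * pen ((-1) * x + K * t + (- R))" using N by (intro mult_left_mono) auto
    moreover have "0 \<le> N * pen (0 * x + 1 * t + (- t1))" "0 \<le> \<eta> * t" using N \<eta> t_ge pen_nonneg by auto
    ultimately have "N \<le> pu (x, t)" by (simp add: pu_def)
    then show False using pule N by simp
  qed
  have yint: "y < R + 1"
  proof (rule ccontr)
    assume n: "\<not> y < R + 1"
    have "0 \<le> K * s" using K_nonneg t_ge by simp
    then have "1 \<le> pen (1 * y + K * s + (- R))" using n by (intro pen_ge_1) linarith
    then have "N * 1 \<le> N * pen (1 * y + K * s + (- R))" using N by (intro mult_left_mono) auto
    then show False using pule(2) N unfolding pv_def fst_conv snd_conv by linarith
  qed
  have tint: "t < t1 + 1"
  proof (rule ccontr)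
    assume n: "\<not> t < t1 + 1"
    then have "1 \<le> pen (0 * x + 1 * t + (- t1))" by (intro pen_ge_1) linarith
    then have "N * 1 \<le> N * pen (0 * x + 1 * t + (- t1))" using N by (intro mult_left_mono) auto
    moreover have "0 \<le> N * pen ((-1) * x + K * t + (- R))" "0 \<le> \<eta> * t"
      using N \<eta> t_ge pen_nonneg by auto
    ultimately have "N \<le> pu (x, t)" by (simp add: pu_def)
    then show False using pule N by simp
  qed
  have sint: "s < t1 + 2" using close tint d by linarith
  have "(x, t) \<in> {-R-1<..<y} \<times> {0<..<t1+2}" using xint xy tpos tint by auto
  then obtain ru where ru: "ru > 0" "ball (x, t) ru \<subseteq> {-R-1<..<y} \<times> {0<..<t1+2}"
    by (rule openE[OF open_Times[OF open_greaterThanLessThan open_greaterThanLessThan]])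
  have "(y, s) \<in> {x<..<R+1} \<times> {0<..<t1+2}" using yint xy tpos sint by auto
  then obtain rv where rv: "rv > 0" "ball (y, s) rv \<subseteq> {x<..<R+1} \<times> {0<..<t1+2}"
    by (rule openE[OF open_Times[OF open_greaterThanLessThan open_greaterThanLessThan]])
  define m1 where "m1 = N * (2 * max 0 (1 * y + K * s + (- R)))"
  define m2 where "m2 = N * (2 * max 0 ((-1) * x + K * t + (- R)))"
  define m3 where "m3 = N * (2 * max 0 (0 * x + 1 * t + (- t1)))"
  have m: "m1 \<ge> 0" "m2 \<ge> 0" "m3 \<ge> 0" using N by (auto simp: m1_def m2_def m3_def)
  have "superdiff_on Qpos \<kappa> (x, t) (B (x, t) - m2) ((t - s) / \<delta> + kt (x, t) - kt (y, t) + K * m2 + m3 + \<eta>)"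
  proof (rule superdiff_onI[OF _ _ ru(1)])
    have 0: "C1_with Qpos (\<lambda>p. 0 + ((snd p - s)\<^sup>2 / (2 * \<delta>) + \<eta> * snd p)) (\<lambda>p. 0) (\<lambda>p. (snd p - s) / \<delta> + \<eta>)"
      by (rule C1_with_separate[where f = "\<lambda>x. 0" and g = "\<lambda>t. (t - s)\<^sup>2 / (2 * \<delta>) + \<eta> * t"
          and f' = "\<lambda>x. 0" and g' = "\<lambda>t. (t - s) / \<delta> + \<eta>"])
        (use \<delta> in \<open>auto intro!: derivative_eq_intros continuous_intros simp: field_simps\<close>)
    have 1: "C1_with Qpos (\<lambda>p. k (y, snd p)) (\<lambda>p. 0) (\<lambda>p. kt (y, snd p))"
      by (rule C1_with_frozen_fst[OF C1]) simp
    show "C1_with Qpos (\<lambda>p. (k p + - k (y, snd p)) + ((0 + ((snd p - s)\<^sup>2 / (2 * \<delta>) + \<eta> * snd p)) +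
        (N * pen ((-1) * fst p + K * snd p + (- R)) + N * pen (0 * fst p + 1 * snd p + (- t1)))))
      (\<lambda>p. (B p + - 0) + (0 + ((-1) * (N * (2 * max 0 ((-1) * fst p + K * snd p + (- R)))) + 0 * (N * (2 * max 0 (0 * fst p + 1 * snd p + (- t1)))))))
      (\<lambda>p. (kt p + - kt (y, snd p)) + (((snd p - s) / \<delta> + \<eta>) +
          (K * (N * (2 * max 0 ((-1) * fst p + K * snd p + (- R)))) + 1 * (N * (2 * max 0 (0 * fst p + 1 * snd p + (- t1)))))))"
      by (intro C1_with_add C1_with_minus C1 0 1 C1_with_pen)
    fix q assume "q \<in> ball (x, t) ru"
    then have "q \<in> {-R-1<..<y} \<times> {0<..<t1+2}" using ru(2) by blast
    then have "q \<in> D" "fst q \<le> fst (y, s)" using yint by (auto simp: D_def)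
    from max[OF this(1) pD(2) this(2)]
    show "\<kappa> q - ((k q + - k (y, snd q)) + ((0 + ((snd q - s)\<^sup>2 / (2 * \<delta>) + \<eta> * snd q)) +
        (N * pen ((-1) * fst q + K * snd q + (- R)) + N * pen (0 * fst q + 1 * snd q + (- t1)))))
      \<le> \<kappa> (x, t) - ((k (x, t) + - k (y, snd (x, t))) + ((0 + ((snd (x, t) - s)\<^sup>2 / (2 * \<delta>) + \<eta> * snd (x, t))) +
        (N * pen ((-1) * fst (x, t) + K * snd (x, t) + (- R)) + N * pen (0 * fst (x, t) + 1 * snd (x, t) + (- t1)))))"
      by (simp add: \<Phi>_def pu_def)
  qed (use tpos in \<open>auto simp: m2_def m3_def\<close>)
  then have 1: "(t - s) / \<delta> + kt (x, t) - kt (y, t) + K * m2 + m3 + \<eta> \<le> G (x, t) (B (x, t) - m2)"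
    by (intro HJ_subD[OF sub] superdiff_on_imp_superdiff[OF _ open_Qpos]) (use tpos in simp)
  have "subdiff_on Qpos \<kappa> (y, s) (B (y, t) - m1) ((t - s) / \<delta> - K * m1)"
  proof (rule subdiff_onI[OF _ _ rv(1)])
    have 0: "C1_with Qpos (\<lambda>p. 0 + - (t - snd p)\<^sup>2 / (2 * \<delta>)) (\<lambda>p. 0) (\<lambda>p. (t - snd p) / \<delta>)"
      by (rule C1_with_separate[where f = "\<lambda>x. 0" and g = "\<lambda>s. - (t - s)\<^sup>2 / (2 * \<delta>)"
          and f' = "\<lambda>x. 0" and g' = "\<lambda>s. (t - s) / \<delta>"])
        (use \<delta> in \<open>auto intro!: derivative_eq_intros continuous_intros simp: field_simps\<close>)
    have 1: "C1_with Qpos (\<lambda>p. k (fst p, t)) (\<lambda>p. B (fst p, t)) (\<lambda>p. 0)"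
      by (rule C1_with_frozen_snd[OF C1]) (use tpos in simp)
    show "C1_with Qpos (\<lambda>p. k (fst p, t) + ((0 + - (t - snd p)\<^sup>2 / (2 * \<delta>)) + - (N * pen (1 * fst p + K * snd p + (- R)))))
        (\<lambda>p. B (fst p, t) + (0 + - (1 * (N * (2 * max 0 (1 * fst p + K * snd p + (- R)))))))
        (\<lambda>p. 0 + ((t - snd p) / \<delta> + - (K * (N * (2 * max 0 (1 * fst p + K * snd p + (- R)))))))"
      by (intro C1_with_add C1_with_minus C1 0 1 C1_with_pen)
    fix q assume "q \<in> ball (y, s) rv"
    then have "q \<in> {x<..<R+1} \<times> {0<..<t1+2}" using rv(2) by blast
    then have "q \<in> D" "fst (x, t) \<le> fst q" using xint by (auto simp: D_def)
    from max[OF pD(1) this]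
    show "\<kappa> (y, s) - (k (fst (y, s), t) + ((0 + - (t - snd (y, s))\<^sup>2 / (2 * \<delta>)) + - (N * pen (1 * fst (y, s) + K * snd (y, s) + (- R)))))
         \<le> \<kappa> q - (k (fst q, t) + ((0 + - (t - snd q)\<^sup>2 / (2 * \<delta>)) + - (N * pen (1 * fst q + K * snd q + (- R)))))"
      by (simp add: \<Phi>_def pv_def)
  qed (use tpos in \<open>auto simp: m1_def\<close>)
  then have 2: "G (y, s) (B (y, t) - m1) \<le> (t - s) / \<delta> - K * m1"
    by (intro HJ_superD[OF super] subdiff_on_imp_subdiff[OF _ open_Qpos]) (use tpos in simp)
  have 3: "G (x, t) (B (x, t) - m2) \<le> G (x, t) (B (x, t)) + K * m2"
    using G_lip_grad[of "(x, t)" "B (x, t) - m2" "B (x, t)"] m by simp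
  have 4: "G (y, s) (B (y, t)) \<le> G (y, s) (B (y, t) - m1) + K * m1"
    using G_lip_grad[of "(y, s)" "B (y, t) - m1" "B (y, t)"] m by simp
  have "G (y, t) (B (y, t)) \<le> G (y, s) (B (y, t)) + L * \<bar>t - s\<bar>"
    using G_lip[of y t "B (y, t)" y s] by simp
  also have "L * \<bar>t - s\<bar> \<le> L * d" using close L_nonneg by (intro mult_left_mono) auto
  \<comment> \<open>When the two viscosity inequalities are subtracted,
    \<open>(t - s) / \<delta>\<close> drops out and \<open>m1\<close>, \<open>m2\<close> are
    absorbed by the moving cones.\<close>
  finally have "\<eta> \<le> L * d" using 1 2 3 4 m flux[OF conjunct1[OF tpos] pD(3)] by linarith
  then show False using Ld by simp
qed

end

section \<open>The heat kernel\<close>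

lemma C0_infty_deriv:
  assumes "C0_infty g" shows "C0_infty (deriv g)"
proof -
  have d: "((deriv ^^ n) g) differentiable (at x)" for n x using assms by (auto simp: C0_infty_def)
  have "((deriv ^^ n) (deriv g)) differentiable (at x)" for n x
    using d[of "Suc n" x] by (simp add: funpow_swap1)
  moreover have "{x. deriv g x \<noteq> 0} \<subseteq> closure {x. g x \<noteq> 0}"
  proof
    fix x assume "x \<in> {x. deriv g x \<noteq> 0}"
    then have n: "deriv g x \<noteq> 0" by simp
    show "x \<in> closure {x. g x \<noteq> 0}"
    proof (rule ccontr)
      assume c: "x \<notin> closure {x. g x \<noteq> 0}"
      have "(g has_field_derivative 0) (at x)"
        by (rule has_field_derivative_transform_within_open[of "\<lambda>_. 0" _ _ "- closure {x. g x \<noteq> 0}"])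
          (use c closure_subset[of "{x. g x \<noteq> 0}"] in auto)
      then show False using n DERIV_imp_deriv by blast
    qed
  qed
  then have "bounded {x. deriv g x \<noteq> 0}"
    by (rule bounded_subset[rotated]) (use assms in \<open>simp add: C0_infty_def bounded_closure\<close>)
  ultimately show ?thesis by (simp add: C0_infty_def)
qed

lemma C0_infty_DERIV: "C0_infty g \<Longrightarrow> (g has_real_derivative deriv g x) (at x)"
  unfolding C0_infty_def DERIV_deriv_iff_real_differentiable by (metis funpow_0)

lemma C0_infty_continuous: "C0_infty g \<Longrightarrow> continuous_on S g"
  by (meson C0_infty_DERIV DERIV_isCont continuous_at_imp_continuous_on)

lemma C0_infty_support:
  assumes "C0_infty g"
  obtains A where "A > 0" "\<And>x. \<bar>x\<bar> \<ge> A \<Longrightarrow> g x = 0"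
proof -
  obtain A where "A > 0" "\<forall>x\<in>{x. g x \<noteq> 0}. norm x \<le> A"
    using assms bounded_pos unfolding C0_infty_def by blast
  then show ?thesis by (intro that[of "A + 1"]) force+
qed

lemma C0_infty_bounded:
  assumes "C0_infty g"
  obtains M where "M \<ge> 0" "\<And>x. \<bar>g x\<bar> \<le> M"
proof -
  obtain A where A: "A > 0" "\<And>x. \<bar>x\<bar> \<ge> A \<Longrightarrow> g x = 0" using C0_infty_support[OF assms] by blast
  have "bounded (g ` {-A..A})"
    by (intro compact_imp_bounded compact_continuous_image C0_infty_continuous[OF assms]) auto
  then obtain M where M: "M > 0" "\<forall>y\<in>g ` {-A..A}. norm y \<le> M" unfolding bounded_pos by blast
  have "\<bar>g x\<bar> \<le> M" for x
  proof (cases "\<bar>x\<bar> \<ge> A")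
    case False
    then have "x \<in> {-A..A}" by auto
    then show ?thesis using M(2) by auto
  qed (use M(1) A(2) in auto)
  then show ?thesis using M by (intro that[of M]) auto
qed

definition hk :: "real \<Rightarrow> real \<Rightarrow> real" where "hk t z = exp (- (z\<^sup>2) / (4 * t)) / sqrt (4 * pi * t)"

lemma hk_normal_density: "t > 0 \<Longrightarrow> hk t (x - y) = normal_density x (sqrt (2 * t)) y"
  by (simp add: hk_def normal_density_def power2_commute[of x y] mult_ac)

lemma heat_sol_pos: "t > 0 \<Longrightarrow> heat_sol g x t = (LINT y|lborel. hk t (x - y) * g y)"
  by (simp add: heat_sol_def hk_def)

lemma heat_sol_nonpos: "t \<le> 0 \<Longrightarrow> heat_sol g x t = g x"
  by (simp add: heat_sol_def)

lemma hk_DERIV: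
  assumes "t > 0" shows "((\<lambda>z. hk t z) has_real_derivative (- z / (2 * t) * hk t z)) (at z)"
  unfolding hk_def using assms by (auto intro!: derivative_eq_intros simp: field_simps)

lemma hk_DERIV_t:
  assumes "t > 0" shows "((\<lambda>t. hk t z) has_real_derivative ((z\<^sup>2 / (4 * t\<^sup>2) - 1 / (2 * t)) * hk t z)) (at t)"
proof -
  have s: "sqrt (4 * pi * t) > 0" using assms by simp
  have "((\<lambda>t. exp (- (z\<^sup>2) / (4 * t)) * inverse (sqrt (4 * pi * t))) has_real_derivative
      (z\<^sup>2 / (4 * t\<^sup>2)) * exp (- (z\<^sup>2) / (4 * t)) * inverse (sqrt (4 * pi * t))
       + exp (- (z\<^sup>2) / (4 * t)) * - (inverse (sqrt (4 * pi * t)) * ((inverse (sqrt (4 * pi * t)) / 2) * (4 * pi)) * inverse (sqrt (4 * pi * t)))) (at t)"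
    using assms s mult_pos_pos[OF pi_gt_zero assms] by (auto intro!: derivative_eq_intros simp: field_simps power2_eq_square mult_less_0_iff)
  moreover have "inverse (sqrt (4 * pi * t)) * ((inverse (sqrt (4 * pi * t)) / 2) * (4 * pi)) = 1 / (2 * t)"
    using assms s by (simp add: field_simps flip: power2_eq_square)
  ultimately have "((\<lambda>t. exp (- (z\<^sup>2) / (4 * t)) * inverse (sqrt (4 * pi * t))) has_real_derivative
      (z\<^sup>2 / (4 * t\<^sup>2)) * exp (- (z\<^sup>2) / (4 * t)) * inverse (sqrt (4 * pi * t))
       + exp (- (z\<^sup>2) / (4 * t)) * - (1 / (2 * t) * inverse (sqrt (4 * pi * t)))) (at t)"
    by (simp only:)
  then show ?thesis unfolding hk_def divide_inverse[of "exp _"]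
    by (rule DERIV_cong) (simp add: algebra_simps)
qed

lemma hk_conv_cont: "t > 0 \<Longrightarrow> continuous_on S (\<lambda>y. hk t (x - y))"
  unfolding hk_def by (intro continuous_intros) auto

text \<open>Compact support turns the integral over the line into one over a fixed compact interval,
  to which the Leibniz rule applies.\<close>

lemma heat_sol_eq_integral:
  assumes t: "t > 0" and supp: "\<And>x. \<bar>x\<bar> > A \<Longrightarrow> h x = 0" and h: "\<And>S. continuous_on S h"
  shows "heat_sol h x t = integral {-A..A} (\<lambda>y. hk t (x - y) * h y)"
proof -
  have c: "continuous_on {-A..A} (\<lambda>y. hk t (x - y) * h y)"
    by (intro continuous_intros hk_conv_cont t h)
  have si: "set_integrable lborel {-A..A} (\<lambda>y. hk t (x - y) * h y)"
    by (rule borel_integrable_atLeastAtMost') (rule c)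
  have "heat_sol h x t = (LINT y:{-A..A}|lborel. hk t (x - y) * h y)"
    unfolding heat_sol_pos[OF t] set_lebesgue_integral_def
  proof (intro Bochner_Integration.integral_cong refl)
    fix y
    show "hk t (x - y) * h y = indicator {-A..A} y *\<^sub>R (hk t (x - y) * h y)"
      using supp[of y] by (cases "\<bar>y\<bar> > A") (auto simp: indicator_def abs_le_iff)
  qed
  also have "\<dots> = integral {-A..A} (\<lambda>y. hk t (x - y) * h y)" by (rule set_borel_integral_eq_integral(2)[OF si])
  finally show ?thesis .
qed

context
  fixes g :: "real \<Rightarrow> real" and A :: real
  assumes g: "C0_infty g" and A: "A > 0" "\<And>x. \<bar>x\<bar> \<ge> A \<Longrightarrow> g x = 0"
begin

lemma deriv_outside_support: "\<bar>x\<bar> > A \<Longrightarrow> deriv g x = 0"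
proof -
  assume x: "\<bar>x\<bar> > A"
  have "(g has_field_derivative 0) (at x)"
    by (rule has_field_derivative_transform_within_open[of "\<lambda>_. 0" _ _ "{x. A < \<bar>x\<bar>}"])
      (use A x in \<open>auto intro!: open_Collect_less continuous_intros\<close>)
  then show ?thesis by (rule DERIV_imp_deriv)
qed

lemma test_continuous: "continuous_on S g" "continuous_on S (deriv g)"
  using C0_infty_continuous g C0_infty_deriv by blast+

text \<open>The boundary terms vanish because \<open>g\<close> is zero at both end points.\<close>

lemma integral_by_parts_test:
  assumes k: "\<And>y. (k has_real_derivative k' y) (at y)" and c: "continuous_on UNIV k'"
  shows "integral {-A..A} (\<lambda>y. k' y * g y) = integral {-A..A} (\<lambda>y. - (k y * deriv g y))"
proof -
  have ck: "continuous_on S k" for S using k by (meson DERIV_isCont continuous_at_imp_continuous_on)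
  have "((\<lambda>y. k' y * g y + deriv g y * k y) has_integral (k A * g A - k (-A) * g (-A))) {-A..A}"
  proof (rule fundamental_theorem_of_calculus)
    show "- A \<le> A" using A by simp
    fix y
    have "((\<lambda>y. k y * g y) has_real_derivative (k' y * g y + deriv g y * k y)) (at y)"
      by (rule DERIV_mult[OF k C0_infty_DERIV[OF g]])
    then show "((\<lambda>y. k y * g y) has_vector_derivative (k' y * g y + deriv g y * k y)) (at y within {-A..A})"
      using has_real_derivative_iff_has_vector_derivative has_vector_derivative_at_within by blast
  qed
  then have 1: "integral {-A..A} (\<lambda>y. k' y * g y + deriv g y * k y) = 0" using A by (simp add: integral_unique)
  have "integral {-A..A} (\<lambda>y. k' y * g y + deriv g y * k y) = integral {-A..A} (\<lambda>y. k' y * g y) + integral {-A..A} (\<lambda>y. deriv g y * k y)"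
    by (intro integral_add integrable_continuous_real continuous_intros ck test_continuous continuous_on_subset[OF c] subset_UNIV)
  then show ?thesis using 1 by (simp add: mult.commute)
qed

text \<open>The derivative first falls on the kernel and is then moved to \<open>g\<close>. In this
  form the space derivatives of the flow are again flows of test functions, with bounds that survive
  as \<open>t\<close> tends to 0.\<close>

lemma heat_sol_DERIV_x_pos:
  assumes t: "t > 0"
  shows "((\<lambda>x. heat_sol g x t) has_real_derivative heat_sol (deriv g) x t) (at x)"
proof -
  let ?k' = "\<lambda>z. - z / (2 * t) * hk t z"
  have ck': "continuous_on S ?k'" for S unfolding hk_def using t by (intro continuous_intros) auto
  have "((\<lambda>x. integral (cbox (-A) A) (\<lambda>y. hk t (x - y) * g y)) has_real_derivative
      integral (cbox (-A) A) (\<lambda>y. ?k' (x - y) * g y)) (at x within UNIV)"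
  proof (rule leibniz_rule_field_derivative)
    fix x y
    have "((\<lambda>x. hk t (x - y)) has_real_derivative ?k' (x - y) * 1) (at x)"
      by (rule DERIV_chain2[OF hk_DERIV[OF t]]) (auto intro!: derivative_eq_intros)
    from DERIV_cmult_right[OF this, of "g y"]
    show "((\<lambda>x. hk t (x - y) * g y) has_real_derivative ?k' (x - y) * g y) (at x within UNIV)" by simp
    show "(\<lambda>y. hk t (x - y) * g y) integrable_on cbox (- A) A"
      by (intro integrable_continuous continuous_intros hk_conv_cont t test_continuous)
    show "continuous_on (UNIV \<times> cbox (- A) A) (\<lambda>(x, y). ?k' (x - y) * g y)"
      unfolding split_beta
      by (intro continuous_on_mult continuous_on_compose2[OF ck'[of UNIV]] continuous_on_compose2[OF test_continuous(1)[of UNIV]]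
          continuous_intros subset_UNIV)
  qed auto
  moreover have "integral {-A..A} (\<lambda>y. ?k' (x - y) * g y) = integral {-A..A} (\<lambda>y. hk t (x - y) * deriv g y)"
  proof -
    have "integral {-A..A} (\<lambda>y. ?k' (x - y) * g y) = integral {-A..A} (\<lambda>y. - ((- hk t (x - y)) * deriv g y))"
    proof (rule integral_by_parts_test)
      fix y
      have "((\<lambda>y. hk t (x - y)) has_real_derivative ?k' (x - y) * - 1) (at y)"
        by (rule DERIV_chain2[OF hk_DERIV[OF t]]) (auto intro!: derivative_eq_intros)
      from DERIV_minus[OF this] show "((\<lambda>y. - hk t (x - y)) has_real_derivative ?k' (x - y)) (at y)" by simp
      show "continuous_on UNIV (\<lambda>y. ?k' (x - y))"
        by (intro continuous_on_compose2[OF ck'[of UNIV]] continuous_intros subset_UNIV)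
    qed
    then show ?thesis by simp
  qed
  moreover have "heat_sol g x t = integral {-A..A} (\<lambda>y. hk t (x - y) * g y)" for x
    by (rule heat_sol_eq_integral[OF t _ test_continuous(1)]) (use A in auto)
  moreover have "heat_sol (deriv g) x t = integral {-A..A} (\<lambda>y. hk t (x - y) * deriv g y)"
    by (rule heat_sol_eq_integral[OF t _ test_continuous(2)]) (use deriv_outside_support in auto)
  ultimately show ?thesis by simp
qed

text \<open>The time derivative of the kernel is its second space derivative, so two integrations by
  parts carry it to \<open>g\<close>. The second one has \<open>deriv g\<close> as its datum and is
  therefore supplied as the hypothesis \<open>g2\<close>.\<close>

lemma heat_sol_DERIV_t_pos:
  assumes t: "t > 0" and g2: "\<And>x t. t > 0 \<Longrightarrow> integral {-A..A} (\<lambda>y. - (x - y) / (2 * t) * hk t (x - y) * deriv g y) = heat_sol (deriv (deriv g)) x t"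
  shows "((\<lambda>t. heat_sol g x t) has_real_derivative heat_sol (deriv (deriv g)) x t) (at t)"
proof -
  let ?k = "\<lambda>t z. (z\<^sup>2 / (4 * t\<^sup>2) - 1 / (2 * t)) * hk t z"
  have "((\<lambda>t. integral (cbox (-A) A) (\<lambda>y. hk t (x - y) * g y)) has_real_derivative
      integral (cbox (-A) A) (\<lambda>y. ?k t (x - y) * g y)) (at t within {0<..})"
  proof (rule leibniz_rule_field_derivative[where fx = "\<lambda>t y. ?k t (x - y) * g y" and f = "\<lambda>t y. hk t (x - y) * g y"])
    fix t y :: real assume t: "t \<in> {0<..}"
    have "((\<lambda>t. hk t (x - y)) has_real_derivative ?k t (x - y)) (at t)" using hk_DERIV_t t by simp
    then show "((\<lambda>t. hk t (x - y) * g y) has_real_derivative ?k t (x - y) * g y) (at t within {0<..})"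
      by (rule DERIV_subset[OF DERIV_cmult_right subset_UNIV])
    show "(\<lambda>y. hk t (x - y) * g y) integrable_on cbox (- A) A"
      using t by (intro integrable_continuous continuous_intros hk_conv_cont test_continuous) auto
  next
    show "continuous_on ({0<..} \<times> cbox (- A) A) (\<lambda>(t, y). ?k t (x - y) * g y)"
      unfolding split_beta hk_def
      by (intro continuous_intros continuous_on_compose2[OF test_continuous(1)[of UNIV]] subset_UNIV) auto
  qed (use t in auto)
  then have "((\<lambda>t. integral (cbox (-A) A) (\<lambda>y. hk t (x - y) * g y)) has_real_derivative
      integral (cbox (-A) A) (\<lambda>y. ?k t (x - y) * g y)) (at t)"
    using t at_within_open[of t "{0<..}"] by simp
  moreover have "integral {-A..A} (\<lambda>y. ?k t (x - y) * g y) = heat_sol (deriv (deriv g)) x t"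
  proof -
    have "integral {-A..A} (\<lambda>y. ?k t (x - y) * g y) = integral {-A..A} (\<lambda>y. - (((x - y) / (2 * t) * hk t (x - y)) * deriv g y))"
    proof (rule integral_by_parts_test)
      fix y
      have "((\<lambda>y. hk t (x - y)) has_real_derivative (- (x - y) / (2 * t) * hk t (x - y)) * - 1) (at y)"
        by (rule DERIV_chain2[OF hk_DERIV[OF t]]) (auto intro!: derivative_eq_intros)
      then have "((\<lambda>y. ((x - y) / (2 * t)) * hk t (x - y)) has_real_derivative
         (-1 / (2 * t)) * hk t (x - y) + (- (x - y) / (2 * t) * hk t (x - y)) * - 1 * ((x - y) / (2 * t))) (at y)"
        by (intro DERIV_mult) (use t in \<open>auto intro!: derivative_eq_intros\<close>)
      then show "((\<lambda>y. (x - y) / (2 * t) * hk t (x - y)) has_real_derivative ?k t (x - y)) (at y)"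
        by (rule DERIV_cong) (use t in \<open>simp add: field_simps power2_eq_square\<close>)
      show "continuous_on UNIV (\<lambda>y. ?k t (x - y))"
        unfolding hk_def using t by (intro continuous_intros) auto
    qed
    also have "\<dots> = heat_sol (deriv (deriv g)) x t"
      unfolding g2[OF t, symmetric] by (intro arg_cong[where f = "integral _"] ext) (simp add: algebra_simps diff_divide_distrib)
    finally show ?thesis .
  qed
  moreover have "\<forall>\<^sub>F t in nhds t. heat_sol g x t = integral {-A..A} (\<lambda>y. hk t (x - y) * g y)"
    using eventually_nhds_in_open[of "{0<..}" t] t
    by (auto elim!: eventually_mono intro!: heat_sol_eq_integral test_continuous A)
  ultimately show ?thesis by (subst DERIV_cong_ev[OF refl _ refl]) auto
qed

end

lemma heat_sol_DERIV_x:
  assumes g: "C0_infty g"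
  shows "((\<lambda>x. heat_sol g x t) has_real_derivative heat_sol (deriv g) x t) (at x)"
proof (cases "t > 0")
  case True
  obtain A where "A > 0" "\<And>x. \<bar>x\<bar> \<ge> A \<Longrightarrow> g x = 0" using C0_infty_support[OF g] by blast
  then show ?thesis using heat_sol_DERIV_x_pos[OF g _ _ True] by blast
next
  case False
  then show ?thesis using C0_infty_DERIV[OF g] by (simp add: heat_sol_nonpos)
qed

lemma dx_heat_sol: "C0_infty g \<Longrightarrow> dx (heat_sol g) = heat_sol (deriv g)"
  unfolding dx_def by (intro ext DERIV_imp_deriv heat_sol_DERIV_x)

lemma heat_sol_DERIV_t:
  assumes g: "C0_infty g" and t: "t > 0"
  shows "((\<lambda>t. heat_sol g x t) has_real_derivative heat_sol (deriv (deriv g)) x t) (at t)"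
proof -
  obtain A where A: "A > 0" "\<And>x. \<bar>x\<bar> \<ge> A \<Longrightarrow> g x = 0" using C0_infty_support[OF g] by blast
  \<comment> \<open>\<open>deriv g\<close> is known to vanish for \<open>\<bar>x\<bar> > A\<close>;
    the closed condition asked of a support radius holds from \<open>A + 1\<close> on.\<close>
  have A': "deriv g x = 0" if "\<bar>x\<bar> \<ge> A + 1" for x using deriv_outside_support[OF g A] that A(1) by simp
  have A1: "A + 1 > 0" "\<And>x. \<bar>x\<bar> \<ge> A + 1 \<Longrightarrow> g x = 0" using A by auto
  have "integral {-(A+1)..A+1} (\<lambda>y. - (x - y) / (2 * t) * hk t (x - y) * deriv g y) = heat_sol (deriv (deriv g)) x t"
    if t: "t > 0" for x t
  proof -
    let ?k' = "\<lambda>z. - z / (2 * t) * hk t z"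
    have ck': "continuous_on S ?k'" for S unfolding hk_def using t by (intro continuous_intros) auto
    have "integral {-(A+1)..A+1} (\<lambda>y. ?k' (x - y) * deriv g y) = integral {-(A+1)..A+1} (\<lambda>y. - ((- hk t (x - y)) * deriv (deriv g) y))"
    proof (rule integral_by_parts_test[OF C0_infty_deriv[OF g] A1(1) A'])
      fix y
      have "((\<lambda>y. hk t (x - y)) has_real_derivative ?k' (x - y) * - 1) (at y)"
        by (rule DERIV_chain2[OF hk_DERIV[OF t]]) (auto intro!: derivative_eq_intros)
      from DERIV_minus[OF this] show "((\<lambda>y. - hk t (x - y)) has_real_derivative ?k' (x - y)) (at y)" by simp
      show "continuous_on UNIV (\<lambda>y. ?k' (x - y))"
        by (intro continuous_on_compose2[OF ck'[of UNIV]] continuous_intros subset_UNIV)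
    qed
    also have "\<dots> = heat_sol (deriv (deriv g)) x t"
      using heat_sol_eq_integral[OF t, of "A + 1" "deriv (deriv g)" x]
        deriv_outside_support[OF C0_infty_deriv[OF g] A1(1)] A' C0_infty_continuous[OF C0_infty_deriv[OF C0_infty_deriv[OF g]]]
      by simp
    finally show ?thesis by simp
  qed
  note * = this
  show ?thesis
    by (rule heat_sol_DERIV_t_pos[OF g A1(1) _ t]) (use A1(2) * in auto)
qed


section \<open>Bounds for the heat flow up to the initial time\<close>

lemma normal_density_integrable_mult:
  assumes g: "C0_infty g" and that: "\<sigma> > 0"
  shows "integrable lborel (\<lambda>y. normal_density x \<sigma> y * g y)"
proof -
  obtain M where M: "M \<ge> 0" "\<And>x. \<bar>g x\<bar> \<le> M" using C0_infty_bounded[OF g] by blast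
  have [measurable]: "g \<in> borel_measurable borel"
    by (rule borel_measurable_continuous_onI[OF C0_infty_continuous[OF g]])
  show ?thesis
  proof (rule Bochner_Integration.integrable_bound)
    show "integrable lborel (\<lambda>y. M * normal_density x \<sigma> y)" using that by auto
    show "AE y in lborel. norm (normal_density x \<sigma> y * g y) \<le> norm (M * normal_density x \<sigma> y)"
      using M by (intro always_eventually allI) (auto simp: abs_mult mult.commute[of M] intro!: mult_left_mono)
  qed measurable
qed

lemma heat_sol_normal: "t > 0 \<Longrightarrow> heat_sol g x t = (LINT y|lborel. normal_density x (sqrt (2 * t)) y * g y)"
  by (simp add: heat_sol_pos hk_normal_density)

text \<open>The kernel is the normal density with variance \<open>2 * t\<close>, of total mass
  one.\<close>

lemma heat_sol_bound:
  assumes g: "C0_infty g" and M: "\<And>x. \<bar>g x\<bar> \<le> M"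
  shows "\<bar>heat_sol g x t\<bar> \<le> M"
proof (cases "t > 0")
  case True
  have s: "sqrt (2 * t) > 0" using True by simp
  have "\<bar>heat_sol g x t\<bar> \<le> (LINT y|lborel. \<bar>normal_density x (sqrt (2 * t)) y * g y\<bar>)"
    unfolding heat_sol_normal[OF True] by (rule integral_abs_bound)
  also have "\<dots> \<le> (LINT y|lborel. M * normal_density x (sqrt (2 * t)) y)"
  proof (rule integral_mono)
    show "integrable lborel (\<lambda>y. \<bar>normal_density x (sqrt (2 * t)) y * g y\<bar>)"
      using normal_density_integrable_mult[OF g s] by (rule integrable_abs)
    show "integrable lborel (\<lambda>y. M * normal_density x (sqrt (2 * t)) y)" using s by auto
    show "\<bar>normal_density x (sqrt (2 * t)) y * g y\<bar> \<le> M * normal_density x (sqrt (2 * t)) y" for y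
      using mult_left_mono[OF M[of y] normal_density_nonneg[of x "sqrt (2 * t)" y]] by (simp add: abs_mult mult.commute)
  qed
  also have "\<dots> = M" using s by simp
  finally show ?thesis .
qed (use M in \<open>simp add: heat_sol_nonpos\<close>)

lemma C0_infty_lipschitz:
  assumes g: "C0_infty g" and M: "\<And>x. \<bar>deriv g x\<bar> \<le> M"
  shows "\<bar>g x - g y\<bar> \<le> M * \<bar>x - y\<bar>"
  using field_differentiable_bound[of UNIV g "deriv g" M x y] C0_infty_DERIV[OF g] M by auto

text \<open>The error is \<open>M\<close> times the first absolute moment of a normal distribution
  with standard deviation \<open>sqrt (2 * t)\<close>.\<close>

lemma heat_sol_near_initial:
  assumes g: "C0_infty g" and M: "\<And>x. \<bar>deriv g x\<bar> \<le> M" and t: "t > 0"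
  shows "\<bar>heat_sol g x t - g x\<bar> \<le> M * (sqrt (2 * t) * sqrt (2 / pi))"
proof -
  have s: "sqrt (2 * t) > 0" using t by simp
  let ?n = "normal_density x (sqrt (2 * t))"
  have i1: "integrable lborel (\<lambda>y. ?n y * g y)" by (rule normal_density_integrable_mult[OF g s])
  have i2: "integrable lborel (\<lambda>y. ?n y * g x)" using s by auto
  have i3: "integrable lborel (\<lambda>y. ?n y * \<bar>y - x\<bar> ^ (2 * 0 + 1))" by (rule integrable_normal_moment_abs[OF s])
  have "heat_sol g x t - g x = (LINT y|lborel. ?n y * g y) - (LINT y|lborel. ?n y * g x)"
    using s by (simp add: heat_sol_normal[OF t])
  also have "\<dots> = (LINT y|lborel. ?n y * g y - ?n y * g x)" by (rule Bochner_Integration.integral_diff[OF i1 i2, symmetric])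
  finally have "\<bar>heat_sol g x t - g x\<bar> \<le> (LINT y|lborel. \<bar>?n y * g y - ?n y * g x\<bar>)"
    using integral_abs_bound by metis
  also have "\<dots> \<le> (LINT y|lborel. M * (?n y * \<bar>y - x\<bar> ^ (2 * 0 + 1)))"
  proof (rule integral_mono)
    show "integrable lborel (\<lambda>y. \<bar>?n y * g y - ?n y * g x\<bar>)" using i1 i2 by auto
    show "integrable lborel (\<lambda>y. M * (?n y * \<bar>y - x\<bar> ^ (2 * 0 + 1)))" using i3 by (rule integrable_mult_right)
    show "\<bar>?n y * g y - ?n y * g x\<bar> \<le> M * (?n y * \<bar>y - x\<bar> ^ (2 * 0 + 1))" for y
      using mult_left_mono[OF C0_infty_lipschitz[OF g M, of y x] normal_density_nonneg[of x "sqrt (2 * t)" y]]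
      by (simp add: abs_mult mult.left_commute flip: right_diff_distrib)
  qed
  also have "\<dots> = M * (sqrt (2 * t) * sqrt (2 / pi))"
    using integral_normal_moment_abs_odd[OF s, of x 0] by simp
  finally show ?thesis .
qed

text \<open>\<open>heat_sol\<close> is constant in time for \<open>t \<le> 0\<close>, so one
  constant serves on the whole plane, as the locale \<open>hamiltonian\<close> demands.\<close>

lemma heat_sol_lipschitz:
  assumes g: "C0_infty g" and M1: "\<And>x. \<bar>deriv g x\<bar> \<le> M" and M2: "\<And>x. \<bar>deriv (deriv g) x\<bar> \<le> M"
  shows "\<bar>heat_sol g x t - heat_sol g y s\<bar> \<le> M * (\<bar>x - y\<bar> + \<bar>t - s\<bar>)"
proof -
  note g1 = C0_infty_deriv[OF g] and g2 = C0_infty_deriv[OF C0_infty_deriv[OF g]]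
  have X: "\<bar>heat_sol g x t - heat_sol g y t\<bar> \<le> M * \<bar>x - y\<bar>"
    using field_differentiable_bound[of UNIV "\<lambda>x. heat_sol g x t" "\<lambda>x. heat_sol (deriv g) x t" M x y]
      heat_sol_DERIV_x[OF g] heat_sol_bound[OF g1 M1] by auto
  have T: "\<bar>heat_sol g y t - heat_sol g y s\<bar> \<le> M * \<bar>t - s\<bar>" if "t > 0" "s > 0" for t s
    using field_differentiable_bound[of "{0<..}" "\<lambda>t. heat_sol g y t" "\<lambda>t. heat_sol (deriv (deriv g)) y t" M t s]
      heat_sol_DERIV_t[OF g, THEN DERIV_subset, OF _ subset_UNIV] heat_sol_bound[OF g2 M2] that by auto
  \<comment> \<open>The square root rate at time 0 gives only continuity there; the linear bound
    between positive times then passes to the limit.\<close>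
  have T0: "\<bar>heat_sol g y t - g y\<bar> \<le> M * \<bar>t\<bar>" if t: "t > 0" for t
  proof -
    have "((\<lambda>s. heat_sol g y s - g y) \<longlongrightarrow> 0) (at_right 0)"
    proof (rule tendsto_0_le[where K = 1])
      have "((\<lambda>s. M * (sqrt (2 * s) * sqrt (2 / pi))) \<longlongrightarrow> M * (sqrt (2 * 0) * sqrt (2 / pi))) (at_right 0)"
        by (intro tendsto_intros)
      then show "((\<lambda>s. M * (sqrt (2 * s) * sqrt (2 / pi))) \<longlongrightarrow> 0) (at_right 0)" by simp
      show "\<forall>\<^sub>F s in at_right 0. norm (heat_sol g y s - g y) \<le> norm (M * (sqrt (2 * s) * sqrt (2 / pi))) * 1"
        using eventually_at_right_less[of "0::real"]
        by eventually_elim (use heat_sol_near_initial[OF g M1] in \<open>auto intro: order_trans[OF _ abs_ge_self]\<close>)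
    qed
    then have "((\<lambda>s. \<bar>heat_sol g y t - g y - (heat_sol g y s - g y)\<bar>) \<longlongrightarrow> \<bar>heat_sol g y t - g y - 0\<bar>) (at_right 0)"
      by (intro tendsto_intros)
    moreover have "((\<lambda>s. M * \<bar>t - s\<bar>) \<longlongrightarrow> M * \<bar>t - 0\<bar>) (at_right 0)" by (intro tendsto_intros)
    moreover have "\<forall>\<^sub>F s in at_right 0. \<bar>heat_sol g y t - g y - (heat_sol g y s - g y)\<bar> \<le> M * \<bar>t - s\<bar>"
      using eventually_at_right_less[of "0::real"] by eventually_elim (use T[OF t] in auto)
    ultimately show ?thesis using tendsto_le[of "at_right (0::real)"] by force
  qed
  have M: "M \<ge> 0" using M1[of 0] by linarith
  have "\<bar>heat_sol g y t - heat_sol g y s\<bar> \<le> M * \<bar>t - s\<bar>"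
  proof (cases "t > 0"; cases "s > 0")
    assume "t > 0" "\<not> s > 0"
    then have "\<bar>heat_sol g y t - heat_sol g y s\<bar> \<le> M * \<bar>t\<bar>" using T0 by (simp add: heat_sol_nonpos)
    also have "\<dots> \<le> M * \<bar>t - s\<bar>" using M \<open>\<not> s > 0\<close> \<open>t > 0\<close> by (intro mult_left_mono) auto
    finally show ?thesis .
  next
    assume "\<not> t > 0" "s > 0"
    then have "\<bar>heat_sol g y t - heat_sol g y s\<bar> \<le> M * \<bar>s\<bar>" using T0[of s] by (simp add: heat_sol_nonpos abs_minus_commute)
    also have "\<dots> \<le> M * \<bar>t - s\<bar>" using M \<open>\<not> t > 0\<close> \<open>s > 0\<close> by (intro mult_left_mono) auto
    finally show ?thesis .
  next
    assume "\<not> t > 0" "\<not> s > 0"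
    then show ?thesis using M by (simp add: heat_sol_nonpos)
  qed (rule T)
  then show ?thesis using X unfolding distrib_left by linarith
qed

lemma heat_sol_lipschitzE:
  assumes g: "C0_infty g"
  obtains M where "M \<ge> 0" "\<And>x t. \<bar>heat_sol g x t\<bar> \<le> M"
    "\<And>x t y s. \<bar>heat_sol g x t - heat_sol g y s\<bar> \<le> M * (\<bar>x - y\<bar> + \<bar>t - s\<bar>)"
proof -
  obtain M0 where M0: "M0 \<ge> 0" "\<And>x. \<bar>g x\<bar> \<le> M0" using C0_infty_bounded[OF g] by blast
  obtain M1 where M1: "M1 \<ge> 0" "\<And>x. \<bar>deriv g x\<bar> \<le> M1" using C0_infty_bounded[OF C0_infty_deriv[OF g]] by blast
  obtain M2 where M2: "M2 \<ge> 0" "\<And>x. \<bar>deriv (deriv g) x\<bar> \<le> M2"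
    using C0_infty_bounded[OF C0_infty_deriv[OF C0_infty_deriv[OF g]]] by blast
  define M where "M = M0 + M1 + M2"
  have b: "\<bar>g x\<bar> \<le> M" "\<bar>deriv g x\<bar> \<le> M" "\<bar>deriv (deriv g) x\<bar> \<le> M" for x
    using M0(1) M1(1) M2(1) M0(2)[of x] M1(2)[of x] M2(2)[of x] unfolding M_def by linarith+
  show ?thesis
    using M0(1) M1(1) M2(1) heat_sol_bound[OF g b(1)] heat_sol_lipschitz[OF g b(2,3)] by (intro that[of M]) (auto simp: M_def)
qed

lemma heat_sol_continuous:
  assumes g: "C0_infty g"
  shows "continuous_on S (\<lambda>p. heat_sol g (fst p) (snd p))"
proof -
  obtain M where M: "M \<ge> 0" "\<And>x t y s. \<bar>heat_sol g x t - heat_sol g y s\<bar> \<le> M * (\<bar>x - y\<bar> + \<bar>t - s\<bar>)"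
    using heat_sol_lipschitzE[OF g] by metis
  have "(2 * M)-lipschitz_on S (\<lambda>p. heat_sol g (fst p) (snd p))"
  proof (rule lipschitz_onI)
    fix p q :: "real \<times> real"
    have "\<bar>heat_sol g (fst p) (snd p) - heat_sol g (fst q) (snd q)\<bar> \<le> M * (\<bar>fst p - fst q\<bar> + \<bar>snd p - snd q\<bar>)" by (rule M)
    also have "\<dots> \<le> M * (dist p q + dist p q)"
      using dist_fst_le[of p q] dist_snd_le[of p q] M(1) by (intro mult_left_mono add_mono) (auto simp: dist_real_def)
    finally show "dist (heat_sol g (fst p) (snd p)) (heat_sol g (fst q) (snd q)) \<le> 2 * M * dist p q" by (simp add: dist_real_def)
  qed (use M in simp)
  then show ?thesis by (rule lipschitz_on_continuous_on)
qed

section \<open>The Hamiltonian and the lower bound of the gradient\<close>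

text \<open>The antiderivative of a continuous \<open>h\<close> that vanishes at 0, on both half
  lines.\<close>

definition sint :: "(real \<Rightarrow> real) \<Rightarrow> real \<Rightarrow> real" where
  "sint h x = (if 0 \<le> x then integral {0..x} h else - integral {x..0} h)"

lemma sint_eq:
  assumes h: "continuous_on UNIV h" and c: "c \<le> 0" "c \<le> x"
  shows "sint h x = integral {c..x} h - integral {c..0} h"
proof -
  have i: "h integrable_on {a..b}" for a b by (intro integrable_continuous_real continuous_on_subset[OF h]) auto
  show ?thesis
    using Henstock_Kurzweil_Integration.integral_combine[of c 0 x h] Henstock_Kurzweil_Integration.integral_combine[of c x 0 h] i c
    by (auto simp: sint_def)
qed

lemma sint_DERIV:
  assumes h: "continuous_on UNIV h"
  shows "(sint h has_real_derivative h x) (at x)"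
proof -
  define c where "c = - \<bar>x\<bar> - 1"
  have x: "x \<in> {c<..<- c}" and c: "c \<le> 0" by (auto simp: c_def)
  have "((\<lambda>y. integral {c..y} h) has_real_derivative h x) (at x within {c..-c})"
    by (rule integral_has_real_derivative) (use x in \<open>auto intro: continuous_on_subset[OF h]\<close>)
  from DERIV_diff[OF this DERIV_const[of "integral {c..0} h"]]
  have "((\<lambda>y. integral {c..y} h - integral {c..0} h) has_real_derivative h x) (at x within {c..-c})" by simp
  then have "((\<lambda>y. integral {c..y} h - integral {c..0} h) has_real_derivative h x) (at x within {c<..<- c})"
    by (rule DERIV_subset) auto
  then have "((\<lambda>y. integral {c..y} h - integral {c..0} h) has_real_derivative h x) (at x)"
    using x by (simp only: at_within_open[OF x open_greaterThanLessThan])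
  then show ?thesis
    by (rule has_field_derivative_transform_within_open[of _ _ _ "{c<..<-c}"]) (use x sint_eq[OF h c] in auto)
qed

lemma sint_0 [simp]: "sint h 0 = 0"
  by (simp add: sint_def)

text \<open>On a fixed interval of integration the end point \<open>x\<close> becomes a parameter of
  the integrand, which gives the joint continuity in \<open>sint_continuous\<close>.\<close>

lemma sint_scale:
  assumes h: "continuous_on UNIV h"
  shows "sint h x = x * integral {0..1} (\<lambda>r. h (x * r))"
proof -
  have "((\<lambda>r. x * h (x * r)) has_integral (sint h (x * 1) - sint h (x * 0))) {0..1}"
  proof (rule fundamental_theorem_of_calculus)
    fix r
    have "((\<lambda>r. sint h (x * r)) has_real_derivative h (x * r) * x) (at r)"
      by (rule DERIV_chain2[OF sint_DERIV[OF h]]) (auto intro!: derivative_eq_intros)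
    then show "((\<lambda>r. sint h (x * r)) has_vector_derivative (x * h (x * r))) (at r within {0..1})"
      by (simp add: has_real_derivative_iff_has_vector_derivative has_vector_derivative_at_within mult.commute)
  qed simp
  from integral_unique[OF this] have "integral {0..1} (\<lambda>r. x * h (x * r)) = sint h x"
    unfolding mult_1_right mult_zero_right sint_0 diff_0_right .
  then show ?thesis by simp
qed

lemma sint_continuous:
  fixes h :: "real \<times> real \<Rightarrow> real"
  assumes h: "continuous_on UNIV h"
  shows "continuous_on UNIV (\<lambda>p. sint (\<lambda>z. h (z, snd p)) (fst p))"
proof -
  have "continuous_on UNIV (\<lambda>z. h (z, t))" for t
    by (intro continuous_on_compose2[OF h] continuous_intros) auto
  then have "sint (\<lambda>z. h (z, snd p)) (fst p) = fst p * integral (cbox 0 1) (\<lambda>r. h (fst p * r, snd p))" for p :: "real \<times> real"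
    by (simp add: sint_scale)
  moreover have "continuous_on UNIV (\<lambda>p :: real \<times> real. fst p * integral (cbox 0 1) (\<lambda>r. h (fst p * r, snd p)))"
    by (intro continuous_intros integral_continuous_on_param)
      (auto simp: split_beta intro!: continuous_on_compose2[OF h] continuous_intros)
  ultimately show ?thesis by simp
qed

lemma sint_DERIV_param:
  assumes h: "\<And>z t. t > 0 \<Longrightarrow> ((\<lambda>t. h (z, t)) has_real_derivative h' (z, t)) (at t)"
    and c: "continuous_on UNIV h" "continuous_on UNIV h'" and t: "t > 0"
  shows "((\<lambda>t. sint (\<lambda>z. h (z, t)) x) has_real_derivative sint (\<lambda>z. h' (z, t)) x) (at t)"
proof -
  have *: "((\<lambda>t. integral (cbox a b) (\<lambda>z. h (z, t))) has_real_derivative integral (cbox a b) (\<lambda>z. h' (z, t))) (at t within {0<..})" for a b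
  proof (rule leibniz_rule_field_derivative[where fx = "\<lambda>t z. h' (z, t)" and f = "\<lambda>t z. h (z, t)"])
    fix t z :: real assume "t \<in> {0<..}"
    then show "((\<lambda>t. h (z, t)) has_real_derivative h' (z, t)) (at t within {0<..})"
      using DERIV_subset[OF h subset_UNIV] by simp
  next
    fix t :: real
    show "(\<lambda>z. h (z, t)) integrable_on cbox a b"
      by (intro integrable_continuous continuous_on_compose2[OF c(1)] continuous_intros) auto
    show "continuous_on ({0<..} \<times> cbox a b) (\<lambda>(t, z). h' (z, t))"
      by (auto simp: split_beta intro!: continuous_on_compose2[OF c(2)] continuous_intros)
  qed (use t in auto)
  have "at t within {0<..} = at t" using t at_within_open[of t "{0<..}"] by simp
  then have *: "((\<lambda>t. integral {a..b} (\<lambda>z. h (z, t))) has_real_derivative integral {a..b} (\<lambda>z. h' (z, t))) (at t)" for a b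
    using *[of a b] by simp
  show ?thesis
    using *[of 0 x] DERIV_minus[OF *[of x 0]] by (cases "0 \<le> x") (simp_all add: sint_def)
qed

text \<open>\<open>C1_with\<close> asks for a total derivative; continuous partial derivatives on
  the open half plane supply it.\<close>

lemma C1_with_partials:
  assumes x: "\<And>x t. t > 0 \<Longrightarrow> ((\<lambda>x. f (x, t)) has_real_derivative fx (x, t)) (at x)"
    and t: "\<And>x t. t > 0 \<Longrightarrow> ((\<lambda>t. f (x, t)) has_real_derivative ft (x, t)) (at t)"
    and c: "continuous_on Qpos fx" "continuous_on Qpos ft"
  shows "C1_with Qpos f fx ft"
proof -
  have Q: "UNIV \<times> {0<..} = Qpos" by auto
  have "(f has_derivative (\<lambda>h. fx p * fst h + ft p * snd h)) (at p)" if p: "p \<in> Qpos" for p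
  proof -
    have pt: "snd p > 0" using p by simp
    have "((\<lambda>(x, t). f (x, t)) has_derivative (\<lambda>(tx, ty). fx p * tx + blinfun_apply (blinfun_mult_right (ft (fst p, snd p))) ty))
       (at (fst p, snd p) within UNIV \<times> {0<..})"
    proof (rule has_derivative_partialsI[where fy = "\<lambda>x y. blinfun_mult_right (ft (x, y))"])
      show "((\<lambda>x. f (x, snd p)) has_derivative (*) (fx p)) (at (fst p))"
        using x[OF pt, of "fst p"] by (simp add: has_field_derivative_def)
      show "((\<lambda>y. f (x, y)) has_derivative blinfun_apply (blinfun_mult_right (ft (x, y)))) (at y within {0<..})" if "y \<in> {0<..}" for x y
        using t[of y x] that unfolding has_field_derivative_eq_has_derivative_blinfun by (auto intro: has_derivative_at_withinI)
      have "continuous_on (UNIV \<times> {0<..}) (\<lambda>p. blinfun_mult_right (ft p))"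
        unfolding Q by (intro continuous_intros c)
      then have "\<forall>q\<in>Qpos. continuous (at q within Qpos) (\<lambda>p. blinfun_mult_right (ft p))"
        by (simp only: Q continuous_on_eq_continuous_within)
      from bspec[OF this p] show "continuous (at (fst p, snd p) within UNIV \<times> {0<..}) (\<lambda>(x, y). blinfun_mult_right (ft (x, y)))"
        unfolding Q split_beta by simp
    qed (use pt in auto)
    moreover have "at p within UNIV \<times> {0<..} = at p" unfolding Q by (rule at_within_open[OF p open_Qpos])
    ultimately show ?thesis by (simp add: case_prod_unfold)
  qed
  then show ?thesis unfolding C1_with_def using c by (intro conjI ballI)
qed

section \<open>The coefficients built from the heat flow\<close>

locale heat_data =
  fixes \<rho>0 :: "real \<Rightarrow> real" and \<epsilon> :: real
  assumes \<rho>0: "C0_infty \<rho>0" and \<epsilon>: "\<epsilon> > 0"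
begin

text \<open>\<open>r1\<close>, \<open>r2\<close>, \<open>r3\<close> stand for \<rho>_x, \<rho>_xx
  and \<rho>_xxx, with the derivatives already on the datum. \<open>Bt\<close> is the time
  derivative of \<open>B\<close>, because \<rho>_xt = \<rho>_xxx.\<close>

definition "r1 = heat_sol (deriv \<rho>0)"
definition "r2 = heat_sol (deriv (deriv \<rho>0))"
definition "r3 = heat_sol (deriv (deriv (deriv \<rho>0)))"
definition "src p = r1 (fst p) (snd p) * r2 (fst p) (snd p)"
definition "B p = sqrt ((r1 (fst p) (snd p))\<^sup>2 + \<epsilon>\<^sup>2)"
definition "Bt p = r1 (fst p) (snd p) * r3 (fst p) (snd p) / B p"
definition "G p a = src p / max a \<epsilon>"
text \<open>Normalized by \<open>k (0, t) = 0\<close>: what matters are its increments in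
  \<open>x\<close>, the integrals of \<open>B\<close>. \<open>kt\<close> is its time
  derivative.\<close>

definition "k p = sint (\<lambda>z. B (z, snd p)) (fst p)"
definition "kt p = sint (\<lambda>z. Bt (z, snd p)) (fst p)"

lemmas \<rho>0_derivs = \<rho>0 C0_infty_deriv[OF \<rho>0] C0_infty_deriv[OF C0_infty_deriv[OF \<rho>0]]
  C0_infty_deriv[OF C0_infty_deriv[OF C0_infty_deriv[OF \<rho>0]]]

lemma dx_\<rho>: "dx (heat_sol \<rho>0) = r1" "dx r1 = r2"
  unfolding r1_def r2_def by (rule dx_heat_sol \<rho>0_derivs)+

lemma Ham_eq: "Ham (heat_sol \<rho>0) p a b = a * b - src p"
  unfolding Ham_def dx_\<rho> by (simp add: src_def)

lemma r_x: "((\<lambda>x. r1 x t) has_real_derivative r2 x t) (at x)" "((\<lambda>x. r2 x t) has_real_derivative r3 x t) (at x)"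
  unfolding r1_def r2_def r3_def by (intro heat_sol_DERIV_x \<rho>0_derivs)+

lemma r1_t: "t > 0 \<Longrightarrow> ((\<lambda>t. r1 x t) has_real_derivative r3 x t) (at t)"
  unfolding r1_def r3_def by (intro heat_sol_DERIV_t \<rho>0_derivs)

lemma r_cont: "continuous_on S (\<lambda>p. r1 (fst p) (snd p))" "continuous_on S (\<lambda>p. r2 (fst p) (snd p))" "continuous_on S (\<lambda>p. r3 (fst p) (snd p))"
  unfolding r1_def r2_def r3_def by (intro heat_sol_continuous \<rho>0_derivs)+

lemma src_cont: "continuous_on S src"
  unfolding src_def by (intro continuous_intros r_cont)

lemma B_ge: "\<epsilon> \<le> B p" and B_pos: "B p > 0"
proof -
  show "\<epsilon> \<le> B p" using \<epsilon> unfolding B_def by (intro real_le_rsqrt) auto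
  then show "B p > 0" using \<epsilon> by simp
qed

lemma B_sq: "(B p)\<^sup>2 = (r1 (fst p) (snd p))\<^sup>2 + \<epsilon>\<^sup>2"
  unfolding B_def by (simp add: add_nonneg_nonneg)

lemma B_cont: "continuous_on S B"
  unfolding B_def by (intro continuous_intros r_cont)

lemma Bt_cont: "continuous_on S Bt"
  unfolding Bt_def using B_pos by (intro continuous_intros r_cont B_cont) (auto simp: less_imp_neq[symmetric])

lemma B_x: "((\<lambda>x. B (x, t)) has_real_derivative src (x, t) / B (x, t)) (at x)"
proof -
  have p: "(r1 x t)\<^sup>2 + \<epsilon>\<^sup>2 > 0" using \<epsilon> by (simp add: add_nonneg_pos)
  have "((\<lambda>x. (r1 x t)\<^sup>2 + \<epsilon>\<^sup>2) has_real_derivative 2 * r1 x t * r2 x t) (at x)"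
    by (auto intro!: derivative_eq_intros r_x)
  from DERIV_chain2[OF DERIV_real_sqrt[OF p] this]
  show ?thesis unfolding B_def src_def fst_conv snd_conv by (rule DERIV_cong) (simp add: field_simps)
qed

lemma B_t: "t > 0 \<Longrightarrow> ((\<lambda>t. B (x, t)) has_real_derivative Bt (x, t)) (at t)"
proof -
  assume t: "t > 0"
  have p: "(r1 x t)\<^sup>2 + \<epsilon>\<^sup>2 > 0" using \<epsilon> by (simp add: add_nonneg_pos)
  have "((\<lambda>t. (r1 x t)\<^sup>2 + \<epsilon>\<^sup>2) has_real_derivative 2 * r1 x t * r3 x t) (at t)"
    by (auto intro!: derivative_eq_intros r1_t t)
  from DERIV_chain2[OF DERIV_real_sqrt[OF p] this]
  show ?thesis unfolding Bt_def B_def fst_conv snd_conv by (rule DERIV_cong) (simp add: field_simps)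
qed

lemma slice_cont: "continuous_on UNIV h \<Longrightarrow> continuous_on UNIV (\<lambda>z. h (z, t))" for h :: "real \<times> real \<Rightarrow> real"
  by (rule continuous_on_compose2[of UNIV h]) (auto intro!: continuous_intros)

lemma k_cont: "continuous_on S k"
  unfolding k_def by (rule continuous_on_subset[OF sint_continuous[OF B_cont]]) simp

lemma k_x: "((\<lambda>x. k (x, t)) has_real_derivative B (x, t)) (at x)"
  unfolding k_def fst_conv snd_conv by (rule sint_DERIV[OF slice_cont[OF B_cont]])

lemma kt_x: "((\<lambda>x. kt (x, t)) has_real_derivative Bt (x, t)) (at x)"
  unfolding kt_def fst_conv snd_conv by (rule sint_DERIV[OF slice_cont[OF Bt_cont]])

lemma k_C1: "C1_with Qpos k B kt"
proof (rule C1_with_partials)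
  show "((\<lambda>x. k (x, t)) has_real_derivative B (x, t)) (at x)" for x t by (rule k_x)
  show "((\<lambda>t. k (x, t)) has_real_derivative kt (x, t)) (at t)" if "t > 0" for x t
    unfolding k_def kt_def fst_conv snd_conv by (rule sint_DERIV_param[OF B_t B_cont Bt_cont that])
  show "continuous_on Qpos kt"
    unfolding kt_def by (rule continuous_on_subset[OF sint_continuous[OF Bt_cont]]) simp
qed (rule B_cont)

lemma G_B: "G p (B p) = src p / B p"
  using B_ge[of p] by (simp add: G_def max_absorb1)

text \<open>With \<open>B_x = src / B\<close>, the inequality says \<open>B_t \<le> B_xx\<close>: along the heat flow,
  \<open>B = sqrt (\<rho>_x^2 + \<epsilon>^2)\<close> is a subsolution of the equation for \<open>\<kappa>_x\<close>.\<close>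
lemma flux_mono:
  assumes xy: "x \<le> y"
  shows "kt (y, t) - G (y, t) (B (y, t)) \<le> kt (x, t) - G (x, t) (B (x, t))"
proof -
  have "\<exists>d. ((\<lambda>x. src (x, t) / B (x, t) - kt (x, t)) has_real_derivative d) (at x) \<and> d \<ge> 0" for x
  proof -
    let ?b = "B (x, t)" and ?r = "r1 x t" and ?s = "r2 x t" and ?q = "r3 x t"
    have b: "?b > 0" by (rule B_pos)
    have "((\<lambda>x. src (x, t)) has_real_derivative ?s * ?s + ?q * ?r) (at x)"
      unfolding src_def fst_conv snd_conv by (rule DERIV_cong[OF DERIV_mult[OF r_x(1) r_x(2)]]) simp
    from DERIV_diff[OF DERIV_divide[OF this B_x] kt_x] b
    have D: "((\<lambda>x. src (x, t) / B (x, t) - kt (x, t)) has_real_derivative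
        ((?s * ?s + ?q * ?r) * ?b - src (x, t) * (src (x, t) / ?b)) / (?b * ?b) - Bt (x, t)) (at x)" by simp
    \<comment> \<open>The left side is \<open>B_xx - B_t\<close>. Since \<open>B_sq\<close> gives
      \<open>B^2 - \<rho>_x^2 = \<epsilon>^2\<close>, it equals
      \<open>\<rho>_xx^2 * \<epsilon>^2 / B^3\<close>.\<close>
    have E: "((?s * ?s + ?q * ?r) * ?b - src (x, t) * (src (x, t) / ?b)) / (?b * ?b) - Bt (x, t)
        = ?s\<^sup>2 * (?b\<^sup>2 - ?r\<^sup>2) / ?b ^ 3"
      using b by (simp add: src_def Bt_def field_simps power2_eq_square power3_eq_cube)
    have "?b\<^sup>2 - ?r\<^sup>2 \<ge> 0" unfolding B_sq by simp
    then have "?s\<^sup>2 * (?b\<^sup>2 - ?r\<^sup>2) / ?b ^ 3 \<ge> 0"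
      using b by (intro divide_nonneg_pos mult_nonneg_nonneg zero_le_power2 zero_less_power)
    then show ?thesis using D unfolding E by (intro exI conjI)
  qed
  then have "src (x, t) / B (x, t) - kt (x, t) \<le> src (y, t) / B (y, t) - kt (y, t)"
    by (intro DERIV_nonneg_imp_nondecreasing[OF xy]) blast
  then show ?thesis by (simp add: G_B)
qed

text \<open>The constants come from \<open>max a \<epsilon> \<ge> \<epsilon>\<close>: one division
  by \<open>\<epsilon>\<close> for the bounds of \<open>src\<close>, two for a difference of
  reciprocals.\<close>

lemma hamiltonian_G: obtains C L K where "hamiltonian G C L K"
proof -
  obtain M1 where M1: "M1 \<ge> 0" "\<And>x t. \<bar>r1 x t\<bar> \<le> M1"
    "\<And>x t y s. \<bar>r1 x t - r1 y s\<bar> \<le> M1 * (\<bar>x - y\<bar> + \<bar>t - s\<bar>)"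
    unfolding r1_def by (rule heat_sol_lipschitzE[OF \<rho>0_derivs(2)]) blast
  obtain M2 where M2: "M2 \<ge> 0" "\<And>x t. \<bar>r2 x t\<bar> \<le> M2"
    "\<And>x t y s. \<bar>r2 x t - r2 y s\<bar> \<le> M2 * (\<bar>x - y\<bar> + \<bar>t - s\<bar>)"
    unfolding r2_def by (rule heat_sol_lipschitzE[OF \<rho>0_derivs(3)]) blast
  have sb: "\<bar>src p\<bar> \<le> M1 * M2" for p
    unfolding src_def abs_mult by (intro mult_mono M1 M2 abs_ge_zero)
  have sl: "\<bar>src (x, t) - src (y, s)\<bar> \<le> 2 * M1 * M2 * (\<bar>x - y\<bar> + \<bar>t - s\<bar>)" for x t y s
  proof -
    let ?d = "\<bar>x - y\<bar> + \<bar>t - s\<bar>"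
    have "src (x, t) - src (y, s) = r1 x t * (r2 x t - r2 y s) + (r1 x t - r1 y s) * r2 y s"
      by (simp add: src_def algebra_simps)
    then have "\<bar>src (x, t) - src (y, s)\<bar> \<le> \<bar>r1 x t\<bar> * \<bar>r2 x t - r2 y s\<bar> + \<bar>r1 x t - r1 y s\<bar> * \<bar>r2 y s\<bar>"
      by (simp flip: abs_mult)
    also have "\<dots> \<le> M1 * (M2 * ?d) + (M1 * ?d) * M2"
      by (intro add_mono mult_mono M1 M2 abs_ge_zero mult_nonneg_nonneg) auto
    finally show ?thesis by (simp add: algebra_simps)
  qed
  \<comment> \<open>The summand \<open>1\<close> makes \<open>C\<close> positive even if
    \<open>M1 * M2 = 0\<close>.\<close>
  have "hamiltonian G (M1 * M2 / \<epsilon> + 1) (2 * M1 * M2 / \<epsilon>) (M1 * M2 / \<epsilon>\<^sup>2)"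
  proof
    show "0 < M1 * M2 / \<epsilon> + 1" "0 \<le> 2 * M1 * M2 / \<epsilon>" "0 \<le> M1 * M2 / \<epsilon>\<^sup>2"
      using M1 M2 \<epsilon> by (auto intro!: add_nonneg_pos)
    fix p a
    have "\<bar>G p a\<bar> = \<bar>src p\<bar> / max a \<epsilon>" using \<epsilon> by (simp add: G_def)
    also have "\<dots> \<le> M1 * M2 / \<epsilon>" by (rule frac_le) (use \<epsilon> sb M1 M2 in auto)
    finally show "\<bar>G p a\<bar> \<le> M1 * M2 / \<epsilon> + 1" by simp
  next
    fix x t y s a
    have "\<bar>G (x, t) a - G (y, s) a\<bar> = \<bar>src (x, t) - src (y, s)\<bar> / max a \<epsilon>"
      using \<epsilon> by (simp add: G_def flip: diff_divide_distrib)
    also have "\<dots> \<le> 2 * M1 * M2 * (\<bar>x - y\<bar> + \<bar>t - s\<bar>) / \<epsilon>" by (rule frac_le) (use \<epsilon> sl M1 M2 in auto)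
    finally show "\<bar>G (x, t) a - G (y, s) a\<bar> \<le> 2 * M1 * M2 / \<epsilon> * (\<bar>x - y\<bar> + \<bar>t - s\<bar>)" by simp
  next
    fix p a b
    have m: "max a \<epsilon> > 0" "max b \<epsilon> > 0" using \<epsilon> by auto
    have "G p a - G p b = src p * (max b \<epsilon> - max a \<epsilon>) / (max a \<epsilon> * max b \<epsilon>)"
      using m unfolding G_def by (simp add: field_simps)
    then have "\<bar>G p a - G p b\<bar> = \<bar>src p\<bar> * \<bar>max b \<epsilon> - max a \<epsilon>\<bar> / (max a \<epsilon> * max b \<epsilon>)"
      using m by (simp add: abs_mult)
    also have "\<dots> \<le> (M1 * M2) * \<bar>a - b\<bar> / (\<epsilon> * \<epsilon>)"
    proof (rule frac_le)
      show "\<bar>src p\<bar> * \<bar>max b \<epsilon> - max a \<epsilon>\<bar> \<le> (M1 * M2) * \<bar>a - b\<bar>"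
        by (intro mult_mono sb) (use M1 M2 in auto)
      show "\<epsilon> * \<epsilon> \<le> max a \<epsilon> * max b \<epsilon>" using \<epsilon> by (intro mult_mono) auto
    qed (use \<epsilon> M1 M2 in auto)
    finally show "\<bar>G p a - G p b\<bar> \<le> M1 * M2 / \<epsilon>\<^sup>2 * \<bar>a - b\<bar>" by (simp add: power2_eq_square)
  qed
  then show ?thesis by (rule that)
qed

end

section \<open>Differentiability almost everywhere\<close>

text \<open>The intervals from \<open>cover\<close> form a Vitali cover, so countably many disjoint
  ones exhaust \<open>E\<close> up to a null set, inside an open set of almost the same measure.
  Their images are disjoint and at most \<open>r\<close> times as long; the Lipschitz bound keeps
  the image of the null set null.\<close>

lemma Vitali_image_le:
  fixes h :: "real \<Rightarrow> real"
  assumes mono: "strict_mono h" and lip: "\<And>x y. \<bar>h x - h y\<bar> \<le> M * \<bar>x - y\<bar>"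
    and E: "E \<in> sets lebesgue" and r: "r > 0"
    and cover: "\<And>x d. x \<in> E \<Longrightarrow> d > 0 \<Longrightarrow> \<exists>a b. a < b \<and> x \<in> {a..b} \<and> b - a < d \<and> h b - h a \<le> r * (b - a)"
  shows "emeasure lebesgue (h ` E) \<le> ennreal r * emeasure lebesgue E"
proof (rule ennreal_le_epsilon)
  fix e :: real assume e: "e > 0"
  then have "e / r > 0" using r by simp
  then obtain U where U: "open U" "E \<subseteq> U" "U - E \<in> lmeasurable" "emeasure lebesgue (U - E) < ennreal (e / r)"
    using sets_lebesgue_outer_open[OF E] by blast
  define I where "I = {i. fst i < snd i \<and> {fst i..snd i} \<subseteq> U \<and> h (snd i) - h (fst i) \<le> r * (snd i - fst i)}"
  have cb: "cball ((fst i + snd i) / 2) ((snd i - fst i) / 2) = {fst i..snd i}" for i :: "real \<times> real"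
    by (simp add: cball_eq_atLeastAtMost field_simps)
  obtain C where C: "countable C" "C \<subseteq> I"
     "pairwise (\<lambda>i j. disjnt (cball ((fst i + snd i) / 2) ((snd i - fst i) / 2)) (cball ((fst j + snd j) / 2) ((snd j - fst j) / 2))) C"
     "negligible (E - (\<Union>i\<in>C. cball ((fst i + snd i) / 2) ((snd i - fst i) / 2)))"
  proof (rule Vitali_covering_theorem_cballs[of I "\<lambda>i. (snd i - fst i) / 2" E "\<lambda>i. (fst i + snd i) / 2"])
    show "0 < (snd i - fst i) / 2" if "i \<in> I" for i using that by (simp add: I_def)
    fix x d :: real assume x: "x \<in> E" and d: "0 < d"
    obtain d' where d': "d' > 0" "ball x d' \<subseteq> U" using U(1,2) x by (meson openE subsetD)
    obtain a b where ab: "a < b" "x \<in> {a..b}" "b - a < min d d'" "h b - h a \<le> r * (b - a)"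
      using cover[OF x, of "min d d'"] d d' by auto
    have "{a..b} \<subseteq> ball x d'"
    proof
      fix y assume "y \<in> {a..b}"
      then show "y \<in> ball x d'" using ab by (auto simp: dist_real_def)
    qed
    then have "(a, b) \<in> I" using ab d' by (auto simp: I_def)
    moreover have "(snd (a, b) - fst (a, b)) / 2 < d" using ab by (simp add: field_simps)
    ultimately show "\<exists>i. i \<in> I \<and> x \<in> cball ((fst i + snd i) / 2) ((snd i - fst i) / 2) \<and> (snd i - fst i) / 2 < d"
      unfolding cb using ab(2) by (intro exI[of _ "(a, b)"]) simp
  qed blast
  note C = C[unfolded cb]
  define X where "X = (\<lambda>i :: real \<times> real. {fst i..snd i})"
  define Y where "Y = (\<lambda>i :: real \<times> real. {h (fst i)..h (snd i)})"
  have hle: "h x \<le> h y \<longleftrightarrow> x \<le> y" for x y using strict_mono_less_eq[OF mono] .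
  have dX: "disjoint_family_on X C"
    using C(3) unfolding disjoint_family_on_def pairwise_def disjnt_def X_def by blast
  have "disjoint_family_on Y C"
  proof (unfold disjoint_family_on_def, intro ballI impI)
    fix i j assume ij: "i \<in> C" "j \<in> C" "i \<noteq> j"
    have l: "fst i < snd i" "fst j < snd j" using ij C(2) by (auto simp: I_def)
    have "X i \<inter> X j = {}" using dX ij by (simp add: disjoint_family_on_def)
    then have "snd i < fst j \<or> snd j < fst i" using l unfolding X_def
      by (metis Int_atLeastAtMost atLeastatMost_empty_iff2 max_def min_def not_le order_less_imp_le)
    then have "h (snd i) < h (fst j) \<or> h (snd j) < h (fst i)" using mono by (simp add: strict_mono_less)
    then show "Y i \<inter> Y j = {}" unfolding Y_def by force
  qed
  note dY = this
  have n: "negligible (h ` (E - (\<Union>i\<in>C. X i)))"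
  proof (rule negligible_locally_Lipschitz_image)
    show "negligible (E - (\<Union>i\<in>C. X i))" using C(4) by (simp add: X_def)
    show "\<exists>T B. open T \<and> x \<in> T \<and> (\<forall>y\<in>(E - (\<Union>i\<in>C. X i)) \<inter> T. norm (h y - h x) \<le> B * norm (y - x))" for x
      using lip by (intro exI[of _ UNIV] exI[of _ M]) auto
  qed simp
  then have nn: "h ` (E - (\<Union>i\<in>C. X i)) \<in> null_sets lebesgue" by (simp add: negligible_iff_null_sets)
  have mX: "X i \<in> sets lebesgue" "Y i \<in> sets lebesgue" for i unfolding X_def Y_def by auto
  have mY: "(\<Union>i\<in>C. Y i) \<in> sets lebesgue" "(\<Union>i\<in>C. X i) \<in> sets lebesgue" using C(1) mX by (auto intro: sets.countable_UN')
  have "h ` E \<subseteq> (\<Union>i\<in>C. Y i) \<union> h ` (E - (\<Union>i\<in>C. X i))"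
  proof
    fix y assume "y \<in> h ` E"
    then obtain x where x: "x \<in> E" "y = h x" by blast
    show "y \<in> (\<Union>i\<in>C. Y i) \<union> h ` (E - (\<Union>i\<in>C. X i))"
    proof (cases "x \<in> (\<Union>i\<in>C. X i)")
      case True
      then show ?thesis using x hle by (force simp: X_def Y_def)
    qed (use x in blast)
  qed
  then have "emeasure lebesgue (h ` E) \<le> emeasure lebesgue ((\<Union>i\<in>C. Y i) \<union> h ` (E - (\<Union>i\<in>C. X i)))"
    by (rule emeasure_mono) (use mY nn in auto)
  also have "\<dots> = emeasure lebesgue (\<Union>i\<in>C. Y i)" by (rule emeasure_Un_null_set[OF mY(1) nn])
  also have "\<dots> = (\<integral>\<^sup>+i. emeasure lebesgue (Y i) \<partial>count_space C)"
    by (rule emeasure_UN_countable[OF mX(2) C(1) dY])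
  also have "\<dots> \<le> (\<integral>\<^sup>+i. ennreal r * emeasure lebesgue (X i) \<partial>count_space C)"
  proof (rule nn_integral_mono)
    fix i assume "i \<in> space (count_space C)"
    then have i: "fst i < snd i" "h (snd i) - h (fst i) \<le> r * (snd i - fst i)" using C(2) by (auto simp: I_def)
    have "emeasure lebesgue (Y i) = ennreal (h (snd i) - h (fst i))"
      unfolding Y_def using i hle by simp
    also have "\<dots> \<le> ennreal (r * (snd i - fst i))" using i by (intro ennreal_leI)
    also have "\<dots> = ennreal r * emeasure lebesgue (X i)"
      unfolding X_def using i r by (simp add: ennreal_mult)
    finally show "emeasure lebesgue (Y i) \<le> ennreal r * emeasure lebesgue (X i)" .
  qed
  also have "\<dots> = ennreal r * (\<integral>\<^sup>+i. emeasure lebesgue (X i) \<partial>count_space C)"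
    by (rule nn_integral_cmult) simp
  also have "(\<integral>\<^sup>+i. emeasure lebesgue (X i) \<partial>count_space C) = emeasure lebesgue (\<Union>i\<in>C. X i)"
    by (rule emeasure_UN_countable[OF mX(1) C(1) dX, symmetric])
  also have "emeasure lebesgue (\<Union>i\<in>C. X i) \<le> emeasure lebesgue (E \<union> (U - E))"
    by (rule emeasure_mono) (use C(2) U E in \<open>auto simp: I_def X_def\<close>)
  also have "\<dots> \<le> emeasure lebesgue E + emeasure lebesgue (U - E)"
    by (rule emeasure_subadditive) (use E U in auto)
  also have "\<dots> \<le> emeasure lebesgue E + ennreal (e / r)" using U(4) by (intro add_left_mono) auto
  finally have "emeasure lebesgue (h ` E) \<le> ennreal r * (emeasure lebesgue E + ennreal (e / r))"
    by (simp add: mult_left_mono)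
  also have "\<dots> = ennreal r * emeasure lebesgue E + ennreal e"
    using r e by (simp add: distrib_left flip: ennreal_mult)
  finally show "emeasure lebesgue (h ` E) \<le> ennreal r * emeasure lebesgue E + ennreal e" .
qed

text \<open>For a difference quotient \<open>q\<close>, these are the points with arbitrarily small
  steps of quotient below \<open>r\<close> and others of quotient above \<open>r'\<close>. The
  thresholds \<open>1 / Suc m\<close> make the condition countable, and the type of \<open>x\<close>
  is left open to cover the line and the plane.\<close>

definition gap_set :: "('a \<Rightarrow> real \<Rightarrow> real) \<Rightarrow> real \<Rightarrow> real \<Rightarrow> 'a set" where
  "gap_set q r r' = {x. \<forall>m::nat. (\<exists>s. s \<noteq> 0 \<and> \<bar>s\<bar> < 1 / Suc m \<and> q x s < r) \<and> (\<exists>s. s \<noteq> 0 \<and> \<bar>s\<bar> < 1 / Suc m \<and> r' < q x s)}"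

text \<open>For fixed \<open>s\<close> each inequality is an open condition on \<open>x\<close>, and
  so is its union over uncountably many \<open>s\<close>; a countable intersection of open sets
  remains.\<close>

lemma gap_set_borel:
  fixes q :: "'a::topological_space \<Rightarrow> real \<Rightarrow> real"
  assumes q: "\<And>s. s \<noteq> 0 \<Longrightarrow> continuous_on UNIV (\<lambda>x. q x s)"
  shows "gap_set q r r' \<in> sets borel"
proof -
  have "gap_set q r r' = (\<Inter>m::nat. (\<Union>s\<in>{s. s \<noteq> 0 \<and> \<bar>s\<bar> < 1 / Suc m}. {x. q x s < r}) \<inter> (\<Union>s\<in>{s. s \<noteq> 0 \<and> \<bar>s\<bar> < 1 / Suc m}. {x. r' < q x s}))"
    unfolding gap_set_def by blast
  also have "\<dots> \<in> sets borel"
    by (intro sets.countable_INT' image_subsetI sets.Int borel_open open_UN ballI)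
      (auto intro!: open_Collect_less continuous_intros q)
  finally show ?thesis .
qed

definition dquot :: "(real \<Rightarrow> real) \<Rightarrow> real \<Rightarrow> real \<Rightarrow> real" where "dquot h x s = (h (x + s) - h x) / s"

lemma ex_inverse_Suc_less: "d > 0 \<Longrightarrow> \<exists>m::nat. 1 / Suc m < (d::real)"
  by (rule nat_approx_posE) auto

text \<open>If no pair of rationals separates the lower from the upper derivate, the two agree. The
  quotients lie in \<open>[m0, M]\<close>, so the common value is finite and positive, and positive
  rationals suffice.\<close>

lemma not_differentiable_gap:
  assumes b: "\<And>s. s \<noteq> 0 \<Longrightarrow> m0 \<le> dquot h x s \<and> dquot h x s \<le> M" and m0: "m0 > 0"
    and nd: "\<not> h differentiable (at x)"
  shows "\<exists>r\<in>\<rat>. \<exists>r'\<in>\<rat>. 0 < r \<and> r < r' \<and> x \<in> gap_set (dquot h) r r'"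
proof (rule ccontr)
  assume no: "\<not> ?thesis"
  have ev: "(\<forall>\<^sub>F s in at 0. r \<le> dquot h x s) \<or> (\<forall>\<^sub>F s in at 0. dquot h x s \<le> r')"
    if r: "r \<in> \<rat>" "r' \<in> \<rat>" "0 < r" "r < r'" for r r'
  proof -
    have "x \<notin> gap_set (dquot h) r r'" using no r by blast
    then obtain m :: nat where m: "(\<forall>s. s \<noteq> 0 \<and> \<bar>s\<bar> < 1 / Suc m \<longrightarrow> r \<le> dquot h x s) \<or> (\<forall>s. s \<noteq> 0 \<and> \<bar>s\<bar> < 1 / Suc m \<longrightarrow> dquot h x s \<le> r')"
      unfolding gap_set_def mem_Collect_eq by (meson not_le)
    have "\<forall>\<^sub>F s in at (0::real). s \<noteq> 0 \<and> \<bar>s\<bar> < 1 / Suc m"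
      unfolding eventually_at by (intro exI[of _ "1 / Suc m"]) auto
    note e = this
    from m show ?thesis
    proof (elim disjE)
      assume *: "\<forall>s. s \<noteq> 0 \<and> \<bar>s\<bar> < 1 / Suc m \<longrightarrow> r \<le> dquot h x s"
      show ?thesis by (rule disjI1, rule eventually_mono[OF e]) (use * in blast)
    next
      assume *: "\<forall>s. s \<noteq> 0 \<and> \<bar>s\<bar> < 1 / Suc m \<longrightarrow> dquot h x s \<le> r'"
      show ?thesis by (rule disjI2, rule eventually_mono[OF e]) (use * in blast)
    qed
  qed
  \<comment> \<open>The eventual lower bounds of the quotients; their supremum is the lower
    derivate, the candidate for the derivative.\<close>
  define S where "S = {r. \<forall>\<^sub>F s in at 0. r \<le> dquot h x s}"
  have nz: "\<forall>\<^sub>F s in at (0::real). s \<noteq> 0" by (simp add: eventually_at_filter)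
  have m0S: "m0 \<in> S" unfolding S_def using b by (auto intro: eventually_mono[OF nz])
  have SM: "r \<le> M" if "r \<in> S" for r
  proof -
    have "\<forall>\<^sub>F s in at (0::real). r \<le> M"
      using that[unfolded S_def mem_Collect_eq] nz by eventually_elim (use b in force)
    then show ?thesis by simp
  qed
  have bdd: "bdd_above S" by (rule bdd_aboveI[of _ M]) (use SM in auto)
  define D where "D = Sup S"
  have D0: "D \<ge> m0" unfolding D_def by (rule cSup_upper[OF m0S bdd])
  have "(dquot h x \<longlongrightarrow> D) (at 0)"
  proof (rule order_tendstoI)
    fix y assume "y < D"
    then obtain r where "r \<in> S" "y < r" unfolding D_def using less_cSup_iff[of S y] m0S bdd by auto
    then show "\<forall>\<^sub>F s in at 0. y < dquot h x s" unfolding S_def by (auto elim: eventually_mono)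
  next
    fix y assume y: "D < y"
    obtain r' where r': "r' \<in> \<rat>" "D < r'" "r' < y" using Rats_dense_in_real[OF y] by blast
    obtain r where r: "r \<in> \<rat>" "D < r" "r < r'" using Rats_dense_in_real[OF r'(2)] by blast
    have "r \<notin> S" using cSup_upper[OF _ bdd, of r] r by (auto simp: D_def)
    then have "\<forall>\<^sub>F s in at 0. dquot h x s \<le> r'" using ev[OF r(1) r'(1)] r D0 m0 by (auto simp: S_def)
    then show "\<forall>\<^sub>F s in at 0. dquot h x s < y" using r'(3) by (auto elim: eventually_mono)
  qed
  then have "(h has_real_derivative D) (at x)" by (simp add: DERIV_def dquot_def[abs_def])
  then show False using nd real_differentiable_def by blast
qed

text \<open>The Vitali covering theorem gives \<open>|h E| \<le> r |E|\<close> for the gap set \<open>E\<close>, and \<open>|E| \<le> |h E| / r'\<close> when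
  it is applied to the inverse of \<open>h\<close>.\<close>
lemma gap_set_null:
  fixes h :: "real \<Rightarrow> real"
  assumes m0: "m0 > 0" and low: "\<And>x y. x \<le> y \<Longrightarrow> m0 * (y - x) \<le> h y - h x"
    and lip: "\<And>x y. \<bar>h x - h y\<bar> \<le> M * \<bar>x - y\<bar>" and r: "0 < r" "r < r'"
  shows "gap_set (dquot h) r r' \<in> null_sets lebesgue"
proof -
  have mono: "strict_mono h"
  proof (rule strict_monoI)
    fix x y :: real assume "x < y"
    then have "0 < m0 * (y - x)" using m0 by simp
    then show "h x < h y" using low[of x y] \<open>x < y\<close> by simp
  qed
  have cont: "continuous_on S h" for S
  proof -
    have "M \<ge> 0" using lip[of 0 1] by simp
    then have "M-lipschitz_on S h" using lip by (auto simp: lipschitz_on_def dist_real_def)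
    then show ?thesis by (rule lipschitz_on_continuous_on)
  qed
  have surj: "\<exists>x. h x = y" for y
  proof -
    define R where "R = (\<bar>y\<bar> + \<bar>h 0\<bar>) / m0"
    have R: "R \<ge> 0" "m0 * R = \<bar>y\<bar> + \<bar>h 0\<bar>" using m0 by (auto simp: R_def)
    have "h (-R) \<le> y" "y \<le> h R" using low[of "-R" 0] low[of 0 R] R by auto
    then show ?thesis using IVT'[of h "-R" y R] R cont by auto
  qed
  define k where "k = inv h"
  have kh: "k (h x) = x" for x unfolding k_def using strict_mono_imp_inj_on[OF mono] by simp
  have hk: "h (k y) = y" for y unfolding k_def by (rule f_inv_into_f) (use surj[of y] in auto)
  have monok: "strict_mono k"
    by (rule strict_monoI) (metis hk mono strict_mono_less)
  have lipk: "\<bar>k x - k y\<bar> \<le> (1 / m0) * \<bar>x - y\<bar>" for x y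
    using low[of "k x" "k y"] low[of "k y" "k x"] m0 by (auto simp: hk field_simps abs_if)
  have contk: "continuous_on UNIV k"
  proof -
    have "(1 / m0)-lipschitz_on UNIV k" using lipk m0 by (auto simp: lipschitz_on_def dist_real_def)
    then show ?thesis by (rule lipschitz_on_continuous_on)
  qed
  have M: "M > 0" using low[of 0 1] lip[of 0 1] m0 by auto
  \<comment> \<open>Bounded pieces have finite measure, which is what allows \<open>c = 0\<close> to
    be concluded from \<open>r' * c \<le> r * c\<close>.\<close>
  have null: "gap_set (dquot h) r r' \<inter> {- real n..real n} \<in> null_sets lebesgue" for n
  proof -
    define E where "E = gap_set (dquot h) r r' \<inter> {- real n..real n}"
    have "gap_set (dquot h) r r' \<in> sets borel"
      by (rule gap_set_borel) (auto simp: dquot_def intro!: continuous_intros continuous_on_compose2[OF cont[of UNIV]])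
    then have Eb: "E \<in> sets borel" by (simp add: E_def)
    then have El: "E \<in> sets lebesgue" by simp
    have hE: "h ` E = k -` E" 
    proof (intro set_eqI iffI)
      fix y assume "y \<in> k -` E"
      then show "y \<in> h ` E" using hk[of y] by (metis imageI vimageD)
    qed (auto simp: kh)
    have "k \<in> borel_measurable borel" by (rule borel_measurable_continuous_onI[OF contk])
    from measurable_sets[OF this Eb] have hEl: "h ` E \<in> sets lebesgue" by (simp add: hE)
    have 1: "emeasure lebesgue (h ` E) \<le> ennreal r * emeasure lebesgue E"
    proof (rule Vitali_image_le[OF mono lip El r(1)])
      fix x d :: real assume x: "x \<in> E" and d: "d > 0"
      obtain m :: nat where m: "1 / Suc m < d" using ex_inverse_Suc_less[OF d] by blast
      obtain s where s: "s \<noteq> 0" "\<bar>s\<bar> < 1 / Suc m" "dquot h x s < r" using x unfolding E_def gap_set_def by blast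
      have sd: "\<bar>s\<bar> < d" using s m by linarith
      show "\<exists>a b. a < b \<and> x \<in> {a..b} \<and> b - a < d \<and> h b - h a \<le> r * (b - a)"
      proof (cases "s > 0")
        case True
        then show ?thesis using s(1,3) sd by (intro exI[of _ x] exI[of _ "x + s"]) (auto simp: dquot_def field_simps)
      next
        case False
        then show ?thesis using s(1,3) sd by (intro exI[of _ "x + s"] exI[of _ x]) (auto simp: dquot_def field_simps)
      qed
    qed
    have r': "r' > 0" using r by simp
    have 2: "emeasure lebesgue (k ` h ` E) \<le> ennreal (1 / r') * emeasure lebesgue (h ` E)"
    proof (rule Vitali_image_le[OF monok lipk hEl])
      show "1 / r' > 0" using r' by simp
      fix y d :: real assume y: "y \<in> h ` E" and d: "d > 0"
      then obtain x where x: "x \<in> E" "y = h x" by blast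
      \<comment> \<open>\<open>h\<close> stretches lengths by at most \<open>M\<close>, so steps
        below \<open>d / M\<close> give image intervals shorter than \<open>d\<close>.\<close>
      obtain m :: nat where m: "1 / Suc m < d / M" using ex_inverse_Suc_less[of "d / M"] d M by auto
      obtain s where s: "s \<noteq> 0" "\<bar>s\<bar> < 1 / Suc m" "r' < dquot h x s" using x unfolding E_def gap_set_def by blast
      have "\<bar>s\<bar> < d / M" using s m by linarith
      then have Ms: "M * \<bar>s\<bar> < d" using M by (simp add: field_simps)
      show "\<exists>a b. a < b \<and> y \<in> {a..b} \<and> b - a < d \<and> k b - k a \<le> 1 / r' * (b - a)"
      proof (cases "s > 0")
        case True
        have "h x < h (x + s)" using True mono by (simp add: strict_mono_less)
        moreover have "h (x + s) - h x < d" using lip[of "x + s" x] Ms by simp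
        moreover have "s \<le> 1 / r' * (h (x + s) - h x)" using s True r' by (simp add: dquot_def field_simps)
        ultimately show ?thesis using x by (intro exI[of _ "h x"] exI[of _ "h (x + s)"]) (auto simp: kh)
      next
        case False
        have "h (x + s) < h x" using False s mono by (simp add: strict_mono_less)
        moreover have "h x - h (x + s) < d" using lip[of x "x + s"] Ms by simp
        moreover have "- s \<le> 1 / r' * (h x - h (x + s))" using s False r' by (simp add: dquot_def field_simps)
        ultimately show ?thesis using x by (intro exI[of _ "h (x + s)"] exI[of _ "h x"]) (auto simp: kh)
      qed
    qed
    have kE: "k ` h ` E = E" using kh by (force simp: image_image)
    have fin: "emeasure lebesgue E < \<infinity>"
    proof -
      have "emeasure lebesgue E \<le> emeasure lebesgue {- real n..real n}" by (rule emeasure_mono) (auto simp: E_def)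
      also have "\<dots> < \<infinity>" by simp
      finally show ?thesis .
    qed
    then obtain c where c: "emeasure lebesgue E = ennreal c" "c \<ge> 0"
      by (cases "emeasure lebesgue E" rule: ennreal_cases) auto
    have "emeasure lebesgue E \<le> ennreal (1 / r') * (ennreal r * emeasure lebesgue E)"
      using order_trans[OF 2 mult_left_mono[OF 1]] by (simp add: kE)
    also have "ennreal r * emeasure lebesgue E = ennreal (r * c)"
      unfolding c(1) by (rule ennreal_mult[symmetric]) (use r c(2) in auto)
    also have "ennreal (1 / r') * ennreal (r * c) = ennreal (1 / r' * (r * c))"
      by (rule ennreal_mult[symmetric]) (use r r' c(2) in auto)
    finally have "ennreal c \<le> ennreal (1 / r' * (r * c))" unfolding c(1) .
    moreover have "0 \<le> 1 / r' * (r * c)" using r r' c by simp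
    ultimately have "c \<le> 1 / r' * (r * c)" using ennreal_le_iff by blast
    then have "r' * c \<le> r * c" using r' by (simp add: field_simps)
    then have "c = 0" using r c(2) by (simp add: mult_le_cancel_right)
    then show ?thesis using c El by (simp add: null_sets_def E_def)
  qed
  have "gap_set (dquot h) r r' = (\<Union>n. gap_set (dquot h) r r' \<inter> {- real n..real n})"
  proof -
    have "\<exists>n. x \<in> {- real n..real n}" for x
    proof -
      obtain n where "\<bar>x\<bar> \<le> real n" using real_arch_simple by blast
      then show ?thesis by (intro exI[of _ n]) auto
    qed
    then show ?thesis by blast
  qed
  also have "\<dots> \<in> null_sets lebesgue" by (intro null_sets_UN null)
  finally show ?thesis .
qed

text \<open>A monotone continuous function can also grow on a null set, so its derivative bounds the
  increments only from below. This is Fatou's lemma for the difference quotients, which monotonicity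
  makes nonnegative.\<close>

lemma increment_ge_sint:
  assumes mono: "mono g" and cont: "continuous_on UNIV g" and w: "continuous_on UNIV w" "\<And>x. 0 \<le> w x"
    and ae: "AE x in lborel. g differentiable (at x) \<and> w x \<le> deriv g x" and ab: "a \<le> b"
  shows "sint w b - sint w a \<le> g b - g a"
proof -
  define c where "c = (\<lambda>n. 1 / real (Suc n))"
  have c: "c n > 0" for n by (simp add: c_def)
  define q where "q = (\<lambda>n x. dquot g x (c n))"
  have qn: "0 \<le> q n x" for n x using c[of n] monoD[OF mono, of x "x + c n"] by (simp add: q_def dquot_def)
  have qc: "continuous_on UNIV (q n)" for n
    unfolding q_def dquot_def using c[of n] by (intro continuous_intros continuous_on_compose2[OF cont]) auto
  have qm: "q n \<in> borel_measurable borel" for n by (rule borel_measurable_continuous_onI[OF qc])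
  have wm: "w \<in> borel_measurable borel" by (rule borel_measurable_continuous_onI[OF w(1)])
  have int: "(\<integral>\<^sup>+x. ennreal (q n x) * indicator {a..b} x \<partial>lborel) \<le> ennreal (g (b + c n) - g a)" for n
  proof -
    \<comment> \<open>An antiderivative of the quotient. \<open>F x\<close> is the mean of
      \<open>g\<close> over \<open>[x, x + c n]\<close> and thus lies between \<open>g x\<close> and
      \<open>g (x + c n)\<close>.\<close>
    define F where "F = (\<lambda>x. (sint g (x + c n) - sint g x) / c n)"
    have "((\<lambda>x. sint g (x + c n)) has_real_derivative g (x + c n) * 1) (at x)" for x
      by (rule DERIV_chain2[OF sint_DERIV[OF cont]]) (auto intro!: derivative_eq_intros)
    then have "(F has_real_derivative q n x) (at x)" for x
      unfolding F_def q_def dquot_def mult_1_right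
      by (intro DERIV_cdivide DERIV_diff sint_DERIV[OF cont])
    then have "(\<integral>\<^sup>+x. ennreal (q n x) * indicator {a..b} x \<partial>lborel) = ennreal (F b - F a)"
      using qn by (intro nn_integral_FTC_Icc[OF qm _ _ ab]) (auto intro: DERIV_subset)
    also have "F b - F a \<le> g (b + c n) - g a"
    proof -
      have "sint g (b + c n) - sint g b \<le> g (b + c n) * c n"
      proof -
        obtain z where "z > b" "z < b + c n" "sint g (b + c n) - sint g b = (b + c n - b) * g z"
          using MVT2[of b "b + c n" "sint g" g] c[of n] sint_DERIV[OF cont] by auto
        then show ?thesis using c[of n] monoD[OF mono, of z "b + c n"] by (simp add: mult.commute)
      qed
      moreover have "g a * c n \<le> sint g (a + c n) - sint g a"
      proof -
        obtain z where "z > a" "z < a + c n" "sint g (a + c n) - sint g a = (a + c n - a) * g z"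
          using MVT2[of a "a + c n" "sint g" g] c[of n] sint_DERIV[OF cont] by auto
        then show ?thesis using c[of n] monoD[OF mono, of a z] by (simp add: mult.commute)
      qed
      ultimately have "F b \<le> g (b + c n)" "g a \<le> F a" using c[of n] by (simp_all add: F_def field_simps)
      then show ?thesis by simp
    qed
    finally show ?thesis by (simp add: ennreal_leI)
  qed
  have c0: "c \<longlonglongrightarrow> 0" unfolding c_def by (rule LIMSEQ_Suc[OF lim_1_over_n])
  have "ennreal (sint w b - sint w a) = (\<integral>\<^sup>+x. ennreal (w x) * indicator {a..b} x \<partial>lborel)"
    by (rule nn_integral_FTC_Icc[OF wm _ w(2) ab, symmetric]) (auto intro: DERIV_subset[OF sint_DERIV[OF w(1)]])
  also have "\<dots> \<le> (\<integral>\<^sup>+x. liminf (\<lambda>n. ennreal (q n x) * indicator {a..b} x) \<partial>lborel)"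
  proof (rule nn_integral_mono_AE, use ae in eventually_elim)
    case (elim x)
    then have "(g has_real_derivative deriv g x) (at x)" by (simp add: DERIV_deriv_iff_real_differentiable)
    then have "(dquot g x \<longlongrightarrow> deriv g x) (at 0)" by (simp add: DERIV_def dquot_def[abs_def])
    moreover have "filterlim c (at 0) sequentially"
      by (rule filterlim_atI[OF c0]) (use c in \<open>auto simp: less_imp_neq[symmetric]\<close>)
    ultimately have "(\<lambda>n. q n x) \<longlonglongrightarrow> deriv g x" unfolding q_def by (rule filterlim_compose)
    then have "(\<lambda>n. ennreal (q n x)) \<longlonglongrightarrow> ennreal (deriv g x)" by (rule tendsto_ennrealI)
    then have "liminf (\<lambda>n. ennreal (q n x)) = ennreal (deriv g x)" by (intro lim_imp_Liminf) auto
    then show "ennreal (w x) * indicator {a..b} x \<le> liminf (\<lambda>n. ennreal (q n x) * indicator {a..b} x)"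
      using elim by (cases "x \<in> {a..b}") (auto intro: ennreal_leI)
  qed
  also have "\<dots> \<le> liminf (\<lambda>n. \<integral>\<^sup>+x. ennreal (q n x) * indicator {a..b} x \<partial>lborel)"
    using qm by (intro nn_integral_liminf) auto
  also have "\<dots> \<le> liminf (\<lambda>n. ennreal (g (b + c n) - g a))"
    by (intro Liminf_mono always_eventually allI int)
  also have "\<dots> = ennreal (g b - g a)"
  proof (rule lim_imp_Liminf)
    have "isCont g b" using cont by (simp add: continuous_on_eq_continuous_at)
    moreover have "(\<lambda>n. b + c n) \<longlonglongrightarrow> b" using tendsto_add[OF tendsto_const c0, of b] by simp
    ultimately have "(\<lambda>n. g (b + c n)) \<longlonglongrightarrow> g b" by (rule isCont_tendsto_compose)
    then show "(\<lambda>n. ennreal (g (b + c n) - g a)) \<longlonglongrightarrow> ennreal (g b - g a)"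
      by (intro tendsto_ennrealI tendsto_diff tendsto_const)
  qed simp
  finally show ?thesis using monoD[OF mono ab] by (simp add: ennreal_le_iff)
qed

section \<open>Zeros of the source term\<close>

text \<open>Evaluating the solution at \<open>2 t n\<close> shows that \<open>g\<close> times a Gaussian is orthogonal to all powers of
  \<open>exp y\<close>, hence to itself by the Weierstrass theorem.\<close>
lemma heat_sol_injective:
  assumes g: "C0_infty g" and t: "t > 0" and z: "\<And>x. heat_sol g x t = 0"
  shows "g y = 0"
proof -
  obtain A where A: "A > 0" "\<And>x. \<bar>x\<bar> \<ge> A \<Longrightarrow> g x = 0" using C0_infty_support[OF g] by blast
  \<comment> \<open>Completing the square splits the kernel into this Gaussian in \<open>y\<close>,
    a factor independent of \<open>y\<close>, and \<open>exp (x * y / (2 * t))\<close>, which is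
    \<open>exp y ^ n\<close> at \<open>x = 2 * t * n\<close>.\<close>
  define w where "w = (\<lambda>y. g y * exp (- (y\<^sup>2) / (4 * t)))"
  have cg: "continuous_on S g" for S by (rule C0_infty_continuous[OF g])
  have cw: "continuous_on S w" for S unfolding w_def using t by (intro continuous_intros cg) auto
  have moment: "integral {-A..A} (\<lambda>y. w y * exp y ^ n) = 0" for n
  proof -
    have "hk t (2 * t * n - y) * g y = (exp (- t * real n ^ 2) / sqrt (4 * pi * t)) * (w y * exp y ^ n)" for y
    proof -
      have "- ((2 * t * n - y)\<^sup>2) / (4 * t) = - t * real n ^ 2 + (- (y\<^sup>2) / (4 * t) + n * y)"
        using t by (simp add: field_simps power2_eq_square)
      then show ?thesis unfolding hk_def w_def
        by (simp only: exp_add exp_of_nat_mult) (simp add: mult_ac)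
    qed
    then have "heat_sol g (2 * t * n) t = integral {-A..A} (\<lambda>y. (exp (- t * real n ^ 2) / sqrt (4 * pi * t)) * (w y * exp y ^ n))"
      using heat_sol_eq_integral[OF t _ cg, of A "2 * t * n"] A by simp
    then show ?thesis using z[of "2 * t * n"] t by simp
  qed
  have poly: "integral {-A..A} (\<lambda>y. w y * p (exp y)) = 0" if p: "real_polynomial_function p" for p
  proof -
    obtain a n where pa: "p = (\<lambda>x. \<Sum>i\<le>n. a i * x ^ i)" using p real_polynomial_function_iff_sum by blast
    have "(\<lambda>y. w y * p (exp y)) = (\<lambda>y. \<Sum>i\<le>n. a i * (w y * exp y ^ i))"
      unfolding pa by (simp add: sum_distrib_left mult_ac)
    moreover have "integral {-A..A} (\<lambda>y. \<Sum>i\<le>n. a i * (w y * exp y ^ i)) = (\<Sum>i\<le>n. integral {-A..A} (\<lambda>y. a i * (w y * exp y ^ i)))"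
      by (intro integral_sum integrable_continuous_real continuous_intros cw) auto
    ultimately show ?thesis by (simp add: moment)
  qed
  obtain Mw where Mw: "Mw \<ge> 0" "\<And>y. y \<in> {-A..A} \<Longrightarrow> \<bar>w y\<bar> \<le> Mw"
  proof -
    have "bounded (w ` {-A..A})" by (intro compact_imp_bounded compact_continuous_image cw) auto
    then obtain M where "M > 0" "\<forall>x\<in>w ` {-A..A}. norm x \<le> M" unfolding bounded_pos by blast
    then show ?thesis by (intro that[of M]) auto
  qed
  have i2: "integral {-A..A} (\<lambda>y. w y * w y) \<le> e * (Mw * (2 * A))" if e: "e > 0" for e
  proof -
    \<comment> \<open>The substitution \<open>s = exp y\<close> turns sums of powers of
      \<open>exp y\<close> into polynomials on a compact interval.\<close>
    have "continuous_on {exp (-A)..exp A} (\<lambda>s. w (ln s))"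
    proof (rule continuous_on_compose2[OF cw[of UNIV]])
      show "continuous_on {exp (-A)..exp A} ln"
        by (intro continuous_on_ln continuous_on_id) (use exp_gt_zero[of "-A"] in force)
    qed simp
    then obtain p where p: "real_polynomial_function p" "\<And>s. s \<in> {exp (-A)..exp A} \<Longrightarrow> \<bar>w (ln s) - p s\<bar> < e"
      using Stone_Weierstrass_real_polynomial_function[of "{exp (-A)..exp A}" "\<lambda>s. w (ln s)" e] e by auto
    have cp: "continuous_on UNIV p"
      using p(1) continuous_on_polymonial_function real_polynomial_function_eq by blast
    have i: "(\<lambda>y. w y * w y) integrable_on {-A..A}" "(\<lambda>y. w y * p (exp y)) integrable_on {-A..A}"
      by (intro integrable_continuous_real continuous_intros cw continuous_on_compose2[OF cp] subset_UNIV)+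
    have "integral {-A..A} (\<lambda>y. w y * w y) = integral {-A..A} (\<lambda>y. w y * w y - w y * p (exp y))"
      using integral_diff[OF i] poly[OF p(1)] by simp
    also have "\<dots> \<le> integral {-A..A} (\<lambda>y. e * Mw)"
    proof (rule integral_le)
      show "(\<lambda>y. w y * w y - w y * p (exp y)) integrable_on {-A..A}" using i by (rule integrable_diff)
      fix y assume y: "y \<in> {-A..A}"
      have "\<bar>w y - p (exp y)\<bar> \<le> e" using p(2)[of "exp y"] y by auto
      then have "\<bar>w y\<bar> * \<bar>w y - p (exp y)\<bar> \<le> Mw * e" using Mw y by (intro mult_mono) auto
      then have "\<bar>w y * (w y - p (exp y))\<bar> \<le> Mw * e" by (simp add: abs_mult)
      then show "w y * w y - w y * p (exp y) \<le> e * Mw" by (simp add: algebra_simps)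
    qed auto
    also have "\<dots> = e * (Mw * (2 * A))" using A by simp
    finally show ?thesis .
  qed
  have "integral {-A..A} (\<lambda>y. w y * w y) \<le> 0"
  proof (rule field_le_epsilon)
    fix e :: real assume e: "e > 0"
    have c: "Mw * (2 * A) + 1 > 0" using Mw A by (auto intro: add_nonneg_pos)
    have "integral {-A..A} (\<lambda>y. w y * w y) \<le> e / (Mw * (2 * A) + 1) * (Mw * (2 * A))"
      by (rule i2) (use e c in simp)
    also have "\<dots> \<le> e" using e c by (simp add: field_simps)
    finally show "integral {-A..A} (\<lambda>y. w y * w y) \<le> 0 + e" by simp
  qed
  moreover have "0 \<le> integral {-A..A} (\<lambda>y. w y * w y)"
    by (rule integral_nonneg) (auto intro!: integrable_continuous_real continuous_intros cw)
  ultimately have "integral {-A..A} (\<lambda>y. w y * w y) = 0" by simp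
  then have "\<forall>y\<in>{-A..A}. w y * w y = 0"
    using A by (subst (asm) integral_eq_0_iff) (auto intro!: continuous_intros cw)
  then have "\<forall>y\<in>{-A..A}. g y = 0" by (simp add: w_def)
  then show ?thesis using A(2)[of y] by (cases "y \<in> {-A..A}") auto
qed

text \<open>For fixed \<open>t > 0\<close> the convolution extends to an entire function of
  \<open>x\<close>, which is not identically zero by \<open>heat_sol_injective\<close>.
  \<open>H\<close> omits the normalizing factor of the kernel.\<close>

lemma heat_sol_isolated_zeros:
  assumes g: "C0_infty g" and t: "t > 0" and nz: "g y0 \<noteq> 0"
  shows "\<exists>r>0. \<forall>y. 0 < \<bar>y - x0\<bar> \<and> \<bar>y - x0\<bar> < r \<longrightarrow> heat_sol g y t \<noteq> 0"
proof -
  obtain A where A: "A > 0" "\<And>x. \<bar>x\<bar> \<ge> A \<Longrightarrow> g x = 0" using C0_infty_support[OF g] by blast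
  have cg: "continuous_on S g" for S by (rule C0_infty_continuous[OF g])
  define k where "k = (\<lambda>(z::complex) (y::real). complex_of_real (g y) * exp (- ((z - of_real y)\<^sup>2) / of_real (4 * t)))"
  define H where "H = (\<lambda>z. integral (cbox (-A) A) (k z))"
  have hol: "H holomorphic_on UNIV"
    unfolding H_def
  proof (rule leibniz_rule_holomorphic)
    fix z y
    show "((\<lambda>z. k z y) has_field_derivative k z y * (- (2 * (z - of_real y)) / of_real (4 * t))) (at z within UNIV)"
      unfolding k_def using t by (auto intro!: derivative_eq_intros simp: field_simps)
  next
    show "k z integrable_on cbox (-A) A" for z
      unfolding k_def using t by (intro integrable_continuous continuous_intros cg) auto
    show "continuous_on (UNIV \<times> cbox (-A) A) (\<lambda>(z, y). k z y * (- (2 * (z - of_real y)) / of_real (4 * t)))"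
      unfolding k_def split_beta using t
      by (intro continuous_intros continuous_on_compose2[OF cg[of UNIV]]) auto
  qed simp
  have H: "H (of_real x) = of_real (sqrt (4 * pi * t) * heat_sol g x t)" for x
  proof -
    have "k (of_real x) y = of_real (sqrt (4 * pi * t) * (hk t (x - y) * g y))" for y
      using t by (simp add: k_def hk_def exp_of_real[symmetric])
    then have "k (of_real x) = (\<lambda>y. complex_of_real (sqrt (4 * pi * t) * (hk t (x - y) * g y)))" by (rule ext)
    then have "H (of_real x) = integral {-A..A} (\<lambda>y. complex_of_real (sqrt (4 * pi * t) * (hk t (x - y) * g y)))"
      by (simp only: H_def interval_cbox)
    also have "\<dots> = of_real (integral {-A..A} (\<lambda>y. sqrt (4 * pi * t) * (hk t (x - y) * g y)))"
      by (intro integral_unique has_integral_of_real integrable_integral integrable_continuous_real continuous_intros cg hk_conv_cont t)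
    also have "\<dots> = of_real (sqrt (4 * pi * t) * heat_sol g x t)"
      using heat_sol_eq_integral[OF t _ cg, of A x] A by simp
    finally show ?thesis .
  qed
  have s: "sqrt (4 * pi * t) \<noteq> 0" using t by simp
  obtain x1 where x1: "heat_sol g x1 t \<noteq> 0" using heat_sol_injective[OF g t] nz by blast
  have H1: "H (of_real x1) \<noteq> 0" using H[of x1] x1 s by simp
  have "\<exists>r>0. \<forall>y. 0 < \<bar>y - x0\<bar> \<and> \<bar>y - x0\<bar> < r \<longrightarrow> H (of_real y) \<noteq> 0"
  proof (cases "H (of_real x0) = 0")
    case True
    obtain r where r: "0 < r" "\<And>z. z \<in> ball (of_real x0) r - {of_real x0} \<Longrightarrow> H z \<noteq> 0"
      by (rule isolated_zeros[OF hol open_UNIV connected_UNIV UNIV_I True UNIV_I H1]) blast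
    have "H (of_real y) \<noteq> 0" if "0 < \<bar>y - x0\<bar> \<and> \<bar>y - x0\<bar> < r" for y
      using that by (intro r(2)) (auto simp: dist_norm norm_minus_commute simp flip: of_real_diff)
    then show ?thesis using r(1) by blast
  next
    case False
    have "continuous_on UNIV H" by (rule holomorphic_on_imp_continuous_on[OF hol])
    then have "continuous_on UNIV (\<lambda>x. H (of_real x))" by (rule continuous_on_compose2) (auto intro!: continuous_intros)
    then have "isCont (\<lambda>x. H (of_real x)) x0" by (simp add: continuous_on_eq_continuous_at)
    from continuous_at_avoid[OF this False] obtain e where e: "e > 0" "\<forall>y. dist x0 y < e \<longrightarrow> H (of_real y) \<noteq> 0" by blast
    then show ?thesis by (intro exI[of _ e]) (auto simp: dist_real_def abs_minus_commute)
  qed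
  then show ?thesis using H s by auto
qed

context heat_data
begin

text \<open>A nonzero function of compact support is not constant, hence has a nonzero derivative.
  Applied twice, this gives nonzero data for both factors \<rho>_x and \<rho>_xx.\<close>

lemma src_isolated_zeros:
  assumes nz: "\<rho>0 y0 \<noteq> 0" and t: "t > 0"
  shows "\<exists>r>0. \<forall>y. 0 < \<bar>y - x0\<bar> \<and> \<bar>y - x0\<bar> < r \<longrightarrow> src (y, t) \<noteq> 0"
proof -
  have D: "\<exists>y. deriv g y \<noteq> 0" if g: "C0_infty g" "g y \<noteq> 0" for g y
  proof (rule ccontr)
    assume "\<not> ?thesis"
    then have "\<bar>g x - g y\<bar> \<le> 0 * \<bar>x - y\<bar>" for x by (intro C0_infty_lipschitz[OF g(1)]) simp
    then have "g x = g y" for x by simp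
    moreover obtain A where "A > 0" "\<And>x. \<bar>x\<bar> \<ge> A \<Longrightarrow> g x = 0" using C0_infty_support[OF g(1)] by blast
    ultimately show False using g(2) by (metis abs_of_pos order_refl)
  qed
  obtain y1 where y1: "deriv \<rho>0 y1 \<noteq> 0" using D[OF \<rho>0 nz] by blast
  obtain y2 where y2: "deriv (deriv \<rho>0) y2 \<noteq> 0" using D[OF \<rho>0_derivs(2) y1] by blast
  obtain e1 where e1: "e1 > 0" "\<And>y. 0 < \<bar>y - x0\<bar> \<and> \<bar>y - x0\<bar> < e1 \<Longrightarrow> r1 y t \<noteq> 0"
    using heat_sol_isolated_zeros[OF \<rho>0_derivs(2) t y1, of x0] unfolding r1_def by blast
  obtain e2 where e2: "e2 > 0" "\<And>y. 0 < \<bar>y - x0\<bar> \<and> \<bar>y - x0\<bar> < e2 \<Longrightarrow> r2 y t \<noteq> 0"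
    using heat_sol_isolated_zeros[OF \<rho>0_derivs(3) t y2, of x0] unfolding r2_def by blast
  show ?thesis using e1 e2 by (intro exI[of _ "min e1 e2"]) (auto simp: src_def)
qed

lemma src_eq_0:
  assumes "\<And>y. \<rho>0 y = 0" shows "src p = 0"
proof -
  have "\<rho>0 = (\<lambda>_. 0)" using assms by auto
  then have "deriv \<rho>0 = (\<lambda>_. 0)" by auto
  then show ?thesis by (simp add: src_def r1_def heat_sol_def)
qed

end

section \<open>Monotonicity of continuous solutions\<close>

text \<open>Viscosity inequalities for \<open>u_x u_t = s\<close>. Test functions on the whole plane suffice for uniqueness.\<close>
definition prod_sub where "prod_sub T s u \<longleftrightarrow> (\<forall>p\<in>QT T. \<forall>a b. superdiff_on UNIV u p a b \<longrightarrow> a * b \<le> s p)"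
definition prod_super where "prod_super T s u \<longleftrightarrow> (\<forall>p\<in>QT T. \<forall>a b. subdiff_on UNIV u p a b \<longrightarrow> s p \<le> a * b)"

text \<open>The reflection changes the sign of \<open>u_t\<close> but not of \<open>u_x\<close>, and exchanges sub- and supersolutions.\<close>
definition reflect :: "(real \<times> real \<Rightarrow> real) \<Rightarrow> real \<times> real \<Rightarrow> real" where "reflect u p = - u (- fst p, snd p)"

lemma reflect_zero: "reflect (\<lambda>_. 0) = (\<lambda>_. 0)"
  by (rule ext) (simp add: reflect_def)

lemma C1_with_reflect:
  assumes "C1_with UNIV \<phi> \<phi>x \<phi>t"
  shows "C1_with UNIV (reflect \<phi>) (\<lambda>p. \<phi>x (- fst p, snd p)) (\<lambda>p. - \<phi>t (- fst p, snd p))"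
proof -
  have "(reflect \<phi> has_derivative (\<lambda>h. \<phi>x (- fst p, snd p) * fst h + - \<phi>t (- fst p, snd p) * snd h)) (at p)" for p
  proof -
    have 1: "((\<lambda>p. (- fst p, snd p)) has_derivative (\<lambda>h. (- fst h, snd h))) (at p)" by (auto intro!: derivative_eq_intros)
    have 2: "(\<phi> has_derivative (\<lambda>h. \<phi>x (- fst p, snd p) * fst h + \<phi>t (- fst p, snd p) * snd h)) (at (- fst p, snd p))"
      using UNIV_I by (rule assms[unfolded C1_with_def, THEN conjunct2, THEN conjunct2, THEN bspec])
    show ?thesis using has_derivative_minus[OF has_derivative_compose[OF 1 2]] by (simp add: reflect_def[abs_def])
  qed
  moreover have "continuous_on UNIV (\<lambda>p. \<phi>x (- fst p, snd p))"
    by (rule continuous_on_compose2[OF assms[unfolded C1_with_def, THEN conjunct1]]) (auto intro!: continuous_intros)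
  moreover have "continuous_on UNIV (\<lambda>p. - \<phi>t (- fst p, snd p))"
    by (intro continuous_intros continuous_on_compose2[OF assms[unfolded C1_with_def, THEN conjunct2, THEN conjunct1]]) auto
  ultimately show ?thesis unfolding C1_with_def by (intro conjI ballI)
qed

lemma dist_reflect: "dist (- fst p, snd p) (- fst q, snd q) = dist p q" for p q :: "real \<times> real"
  by (simp add: dist_prod_def dist_real_def abs_minus_commute)

lemma superdiff_reflect:
  assumes "superdiff_on UNIV (\<lambda>q. c * reflect u q) p a b"
  shows "superdiff_on UNIV (\<lambda>q. - (c * u q)) (- fst p, snd p) (- a) b"
proof -
  obtain \<phi> \<phi>x \<phi>t r where *: "C1_with UNIV \<phi> \<phi>x \<phi>t" "r > 0" "\<And>q. q \<in> ball p r \<Longrightarrow> c * reflect u q - \<phi> q \<le> c * reflect u p - \<phi> p" "\<phi>x p = a" "\<phi>t p = b"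
    using assms unfolding superdiff_on_def by blast
  show ?thesis
  proof (rule superdiff_onI[OF _ C1_with_minus[OF C1_with_reflect[OF *(1)]] *(2)])
    fix q assume "q \<in> ball (- fst p, snd p) r"
    then have "dist (- fst p, snd p) q < r" by simp
    then have "dist p (- fst q, snd q) < r" using dist_reflect[of p "(- fst q, snd q)"] by simp
    from *(3)[of "(- fst q, snd q)"] this
    show "- (c * u q) - - reflect \<phi> q \<le> - (c * u (- fst p, snd p)) - - reflect \<phi> (- fst p, snd p)"
      by (simp add: reflect_def)
  qed (use * in auto)
qed

lemma prod_sub_reflect: "prod_sub T s u \<Longrightarrow> prod_super T (reflect s) (reflect u)"
  unfolding prod_super_def
proof (intro ballI allI impI)
  fix p a b assume s: "prod_sub T s u" and p: "p \<in> QT T" and d: "subdiff_on UNIV (reflect u) p a b"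
  have "superdiff_on UNIV (\<lambda>q. - (-1 * u q)) (- fst p, snd p) (- (- a)) (- b)"
    by (rule superdiff_reflect) (use d in \<open>simp add: subdiff_on_def\<close>)
  then have "superdiff_on UNIV u (- fst p, snd p) a (- b)" by simp
  moreover have "(- fst p, snd p) \<in> QT T" using p by (simp add: QT_def)
  ultimately have "a * (- b) \<le> s (- fst p, snd p)" using s unfolding prod_sub_def by blast
  then show "reflect s p \<le> a * b" by (simp add: reflect_def)
qed

lemma prod_super_reflect: "prod_super T s u \<Longrightarrow> prod_sub T (reflect s) (reflect u)"
  unfolding prod_sub_def
proof (intro ballI allI impI)
  fix p a b assume s: "prod_super T s u" and p: "p \<in> QT T" and d: "superdiff_on UNIV (reflect u) p a b"
  have "superdiff_on UNIV (\<lambda>q. - (1 * u q)) (- fst p, snd p) (- a) b"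
    by (rule superdiff_reflect) (use d in simp)
  then have "subdiff_on UNIV u (- fst p, snd p) a (- b)" by (simp add: subdiff_on_def)
  moreover have "(- fst p, snd p) \<in> QT T" using p by (simp add: QT_def)
  ultimately have "s (- fst p, snd p) \<le> a * (- b)" using s unfolding prod_super_def by blast
  then show "a * b \<le> reflect s p" by (simp add: reflect_def)
qed

lemma reflect_cont:
  assumes "continuous_on S u" "\<And>p. p \<in> S' \<Longrightarrow> (- fst p, snd p) \<in> S"
  shows "continuous_on S' (reflect u)"
  unfolding reflect_def by (intro continuous_intros continuous_on_compose2[OF assms(1)]) (use assms(2) in auto)

lemma QT_reflect: "p \<in> QT T \<Longrightarrow> (- fst p, snd p) \<in> QT T" "p \<in> QTbar T \<Longrightarrow> (- fst p, snd p) \<in> QTbar T"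
  by (auto simp: QT_def QTbar_def)

text \<open>Minimize \<open>u\<close> plus a steep parabola in time over a thin box. The side walls
  are higher than the valley and the parabola excludes the ends of the time interval, so the minimum
  is interior. The test function depends on time alone, and a product with
  \<open>\<phi>_x = 0\<close> cannot reach \<open>s > 0\<close>.\<close>

lemma no_valley:
  assumes cu: "continuous_on (QT T) u" and sup: "prod_super T s u"
    and pos: "\<And>x t. x1 \<le> x \<Longrightarrow> x \<le> x3 \<Longrightarrow> \<bar>t - t0\<bar> < \<tau> \<Longrightarrow> 0 < s (x, t)"
    and \<tau>: "\<tau> > 0" and t0: "0 < t0" "t0 < T" and x: "x1 < x2" "x2 < x3"
    and v: "u (x2, t0) < u (x1, t0)" "u (x2, t0) < u (x3, t0)"
  shows False
proof -
  have ev: "\<forall>\<^sub>F t in nhds t0. u (x2, t0) < u (y, t)" if "u (x2, t0) < u (y, t0)" for y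
  proof -
    have "isCont u (y, t0)" using cu t0 open_QT by (simp add: continuous_on_eq_continuous_at QT_def)
    then have "((\<lambda>t. u (y, t)) \<longlongrightarrow> u (y, t0)) (nhds t0)"
      by (rule isCont_tendsto_compose) (intro tendsto_Pair tendsto_const filterlim_ident)
    then show ?thesis using that by (rule order_tendstoD(1))
  qed
  have "\<forall>\<^sub>F t in nhds t0. t \<in> {0<..<T}" using t0 by (intro eventually_nhds_in_open) auto
  with ev[OF v(1)] ev[OF v(2)]
  have "\<forall>\<^sub>F t in nhds t0. u (x2, t0) < u (x1, t) \<and> u (x2, t0) < u (x3, t) \<and> t \<in> {0<..<T}" by eventually_elim simp
  then obtain e where e: "e > 0" "\<And>t. dist t t0 < e \<Longrightarrow> u (x2, t0) < u (x1, t) \<and> u (x2, t0) < u (x3, t) \<and> t \<in> {0<..<T}"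
    unfolding eventually_nhds_metric by blast
  define d where "d = min e \<tau> / 2"
  have d: "d > 0" "d < e" "d < \<tau>" using e \<tau> by (auto simp: d_def)
  define R where "R = {x1..x3} \<times> {t0-d..t0+d}"
  have tR: "u (x2, t0) < u (x1, t) \<and> u (x2, t0) < u (x3, t) \<and> 0 < t \<and> t < T" if "t \<in> {t0-d..t0+d}" for t
    using e(2)[of t] that d by (auto simp: dist_real_def)
  have RQ: "R \<subseteq> QT T" using tR by (auto simp: R_def QT_def)
  have cR: "compact R" unfolding R_def by (intro compact_Times) auto
  obtain M where M: "M > 0" "\<And>p. p \<in> R \<Longrightarrow> \<bar>u p\<bar> \<le> M"
    by (rule compact_bound[OF cR continuous_on_subset[OF cu RQ]]) blast
  \<comment> \<open>At \<open>\<bar>t - t0\<bar> = d\<close> the parabola adds more than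
    \<open>2 * M\<close>, a bound for the oscillation of \<open>u\<close> on the box.\<close>
  define N where "N = (2 * M + 1) / d\<^sup>2"
  have N: "N > 0" "N * d\<^sup>2 = 2 * M + 1" using M d by (auto simp: N_def)
  define \<Psi> where "\<Psi> = (\<lambda>p. u p + N * (snd p - t0)\<^sup>2)"
  have "continuous_on R \<Psi>" unfolding \<Psi>_def by (intro continuous_intros continuous_on_subset[OF cu RQ])
  moreover have in2: "(x2, t0) \<in> R" using x d by (auto simp: R_def)
  ultimately obtain p where p: "p \<in> R" "\<And>q. q \<in> R \<Longrightarrow> \<Psi> p \<le> \<Psi> q"
    using continuous_attains_inf[OF cR] by blast
  obtain y t where yt: "p = (y, t)" by (cases p)
  have low: "u (y, t) + N * (t - t0)\<^sup>2 \<le> u (x2, t0)" using p(2)[OF in2] by (simp add: \<Psi>_def yt)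
  have yt_in: "y \<in> {x1..x3}" "t \<in> {t0-d..t0+d}" using p(1) yt by (auto simp: R_def)
  have "0 \<le> N * (t - t0)\<^sup>2" using N by simp
  then have y: "x1 < y" "y < x3" using low tR[OF yt_in(2)] yt_in(1) by (cases "y = x1"; cases "y = x3"; force)+
  have t: "t0 - d < t \<and> t < t0 + d"
  proof (rule ccontr)
    assume "\<not> ?thesis"
    then have "t - t0 = d \<or> t - t0 = - d" using yt_in(2) by auto
    then have "(t - t0)\<^sup>2 = d\<^sup>2" by auto
    then have "u (y, t) + (2 * M + 1) \<le> u (x2, t0)" using low N by simp
    moreover have "- M \<le> u (y, t)" "u (x2, t0) \<le> M" using M(2)[OF p(1)] M(2)[OF in2] yt by auto
    ultimately show False using M(1) by linarith
  qed
  have "(y, t) \<in> {x1<..<x3} \<times> {t0-d<..<t0+d}" using y t by auto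
  then obtain r where r: "r > 0" "ball (y, t) r \<subseteq> {x1<..<x3} \<times> {t0-d<..<t0+d}"
    by (rule openE[OF open_Times[OF open_greaterThanLessThan open_greaterThanLessThan]])
  have "subdiff_on UNIV u (y, t) 0 (- (2 * N * (t - t0)))"
  proof (rule subdiff_onI[OF _ _ r(1)])
    show "C1_with UNIV (\<lambda>p. 0 + - (N * (snd p - t0)\<^sup>2)) (\<lambda>p. 0) (\<lambda>p. - (2 * N * (snd p - t0)))"
      by (rule C1_with_separate[where f = "\<lambda>x. 0" and g = "\<lambda>t. - (N * (t - t0)\<^sup>2)" and f' = "\<lambda>x. 0" and g' = "\<lambda>t. - (2 * N * (t - t0))"])
        (auto intro!: derivative_eq_intros continuous_intros)
    fix q assume "q \<in> ball (y, t) r"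
    then have "q \<in> {x1<..<x3} \<times> {t0-d<..<t0+d}" using r(2) by blast
    then have "q \<in> R" by (auto simp: R_def)
    from p(2)[OF this] show "u (y, t) - (0 + - (N * (snd (y, t) - t0)\<^sup>2)) \<le> u q - (0 + - (N * (snd q - t0)\<^sup>2))"
      by (simp add: \<Psi>_def yt)
  qed auto
  moreover have "(y, t) \<in> QT T" using RQ p(1) yt by auto
  ultimately have "s (y, t) \<le> 0 * (- (2 * N * (t - t0)))" using sup unfolding prod_super_def by blast
  moreover have "0 < s (y, t)" using y t d by (intro pos) auto
  ultimately show False by simp
qed

text \<open>This is what the proof of monotonicity retains of the gradient bound; it involves no
  derivatives and is preserved by \<open>reflect\<close>.\<close>

definition no_flat :: "real \<Rightarrow> (real \<times> real \<Rightarrow> real) \<Rightarrow> bool" where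
  "no_flat T u \<longleftrightarrow> (\<forall>a b t1 t2. a < b \<longrightarrow> t1 < t2 \<longrightarrow> 0 < t1 \<longrightarrow> t2 < T \<longrightarrow>
     \<not> (\<forall>t x y. t1 < t \<and> t < t2 \<and> a < x \<and> x \<le> y \<and> y < b \<longrightarrow> u (y, t) \<le> u (x, t)))"

lemma no_flat_reflect: "no_flat T u \<Longrightarrow> no_flat T (reflect u)"
  unfolding no_flat_def
proof (intro allI impI notI)
  fix a b t1 t2
  assume nf: "\<forall>a b t1 t2. a < b \<longrightarrow> t1 < t2 \<longrightarrow> 0 < t1 \<longrightarrow> t2 < T \<longrightarrow>
     \<not> (\<forall>t x y. t1 < t \<and> t < t2 \<and> a < x \<and> x \<le> y \<and> y < b \<longrightarrow> u (y, t) \<le> u (x, t))"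
    and ab: "a < b" "t1 < t2" "0 < t1" "t2 < T"
    and *: "\<forall>t x y. t1 < t \<and> t < t2 \<and> a < x \<and> x \<le> y \<and> y < b \<longrightarrow> reflect u (y, t) \<le> reflect u (x, t)"
  have "u (y, t) \<le> u (x, t)" if "t1 < t \<and> t < t2 \<and> - b < x \<and> x \<le> y \<and> y < - a" for t x y
    using *[rule_format, of t "- y" "- x"] that by (simp add: reflect_def)
  moreover have "- b < - a" using ab by simp
  ultimately show False using nf[rule_format, OF _ ab(2-4), of "-b" "-a"] by blast
qed

text \<open>A drop from \<open>x1\<close> to \<open>x2\<close> persists for nearby times, and any
  rise to the right of \<open>x2\<close> would complete a valley. So \<open>u\<close> is
  nonincreasing on a whole box there, against \<open>no_flat\<close>.\<close>

lemma mono_where_positive: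
  assumes cu: "continuous_on (QT T) u" and sup: "prod_super T s u" and nf: "no_flat T u"
    and pos: "\<And>x t. a < x \<Longrightarrow> x < b \<Longrightarrow> \<bar>t - t0\<bar> < \<tau> \<Longrightarrow> 0 < s (x, t)"
    and \<tau>: "\<tau> > 0" and t0: "0 < t0" "t0 < T" and xy: "a < x1" "x1 \<le> x2" "x2 < b"
  shows "u (x1, t0) \<le> u (x2, t0)"
proof (rule ccontr)
  assume "\<not> ?thesis"
  then have n: "u (x2, t0) < u (x1, t0)" by simp
  then have x12: "x1 < x2" using xy by (cases "x1 = x2") auto
  have lim: "((\<lambda>t. u (y, t)) \<longlongrightarrow> u (y, t0)) (nhds t0)" for y
  proof -
    have "isCont u (y, t0)" using cu t0 open_QT by (simp add: continuous_on_eq_continuous_at QT_def)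
    then show ?thesis by (rule isCont_tendsto_compose) (intro tendsto_Pair tendsto_const filterlim_ident)
  qed
  have "((\<lambda>t. u (x1, t) - u (x2, t)) \<longlongrightarrow> u (x1, t0) - u (x2, t0)) (nhds t0)" by (intro tendsto_diff lim)
  then have "\<forall>\<^sub>F t in nhds t0. 0 < u (x1, t) - u (x2, t)" by (rule order_tendstoD(1)) (use n in simp)
  moreover have "\<forall>\<^sub>F t in nhds t0. t \<in> {0<..<T}" using t0 by (intro eventually_nhds_in_open) auto
  ultimately have "\<forall>\<^sub>F t in nhds t0. u (x2, t) < u (x1, t) \<and> t \<in> {0<..<T}" by eventually_elim simp
  then obtain e where e: "e > 0" "\<And>t. dist t t0 < e \<Longrightarrow> u (x2, t) < u (x1, t) \<and> t \<in> {0<..<T}"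
    unfolding eventually_nhds_metric by blast
  define d where "d = min e \<tau> / 2"
  have d: "d > 0" "d < e" "d < \<tau>" using e \<tau> by (auto simp: d_def)
  have nv: False if "\<bar>t - t0\<bar> \<le> d" "x1 \<le> y1" "y1 < y2" "y2 < y3" "y3 < b" "u (y2, t) < u (y1, t)" "u (y2, t) < u (y3, t)" for t y1 y2 y3
  proof (rule no_valley[OF cu sup, where ?x1.0 = y1 and ?x2.0 = y2 and ?x3.0 = y3 and ?t0.0 = t and \<tau> = "\<tau> - d"])
    show "0 < s (x, t')" if "y1 \<le> x" "x \<le> y3" "\<bar>t' - t\<bar> < \<tau> - d" for x t'
      using that \<open>\<bar>t - t0\<bar> \<le> d\<close> \<open>x1 \<le> y1\<close> \<open>y3 < b\<close> xy by (intro pos) auto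
    show "0 < t" "t < T" using e(2)[of t] \<open>\<bar>t - t0\<bar> \<le> d\<close> d by (auto simp: dist_real_def)
  qed (use that d in auto)
  have "u (z, t) \<le> u (y, t)" if "t0 - d < t" "t < t0 + d" "x2 < y" "y \<le> z" "z < b" for t y z
  proof (rule ccontr)
    assume "\<not> ?thesis"
    then have l: "u (y, t) < u (z, t)" by simp
    have tt: "\<bar>t - t0\<bar> \<le> d" using that by auto
    have e': "u (x2, t) < u (x1, t)" using e(2)[of t] tt d by (auto simp: dist_real_def)
    have yz: "y < z" using l that by (cases "y = z") auto
    show False
    proof (cases "u (y, t) < u (x1, t)")
      case True
      show False by (rule nv[of t x1 y z]) (use tt l yz True that x12 in auto)
    next
      case False
      show False by (rule nv[of t x1 x2 y]) (use tt e' yz False that x12 in auto)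
    qed
  qed
  moreover have "0 < t0 - d" "t0 + d < T" using e(2)[of "t0 - d"] e(2)[of "t0 + d"] d by (auto simp: dist_real_def)
  ultimately show False
    using nf[unfolded no_flat_def, rule_format, OF xy(3), of "t0 - d" "t0 + d"] d by auto
qed

text \<open>The test function \<open>\<eta> (x + t)\<close>, steepened beyond the corner, has \<open>\<phi>_x \<phi>_t > 0\<close>.\<close>
lemma corner:
  assumes cu: "continuous_on (QT T) u" and sub: "prod_sub T (\<lambda>_. 0) u"
    and ab: "a \<le> b" and t: "0 < t1" "t1 \<le> t2" "t2 < T"
    and left: "\<And>t. t1 \<le> t \<Longrightarrow> t \<le> t2 \<Longrightarrow> u (a, t) < u (b, t2)"
    and bottom: "\<And>x. a \<le> x \<Longrightarrow> x \<le> b \<Longrightarrow> u (x, t1) < u (b, t2)"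
  shows False
proof -
  define d where "d = u (b, t2)"
  have ab': "a < b" using ab left[of t2] t by (cases "a = b") auto
  have t12: "t1 < t2" using t bottom[of b] ab by (cases "t1 = t2") auto
  define S0 where "S0 = {a} \<times> {t1..t2} \<union> {a..b} \<times> {t1}"
  have cS0: "compact S0" unfolding S0_def by (intro compact_Un compact_Times) auto
  have S0Q: "S0 \<subseteq> QT T" using t by (auto simp: S0_def QT_def)
  obtain p0 where p0: "p0 \<in> S0" "\<And>p. p \<in> S0 \<Longrightarrow> u p \<le> u p0"
    using continuous_attains_sup[OF cS0 _ continuous_on_subset[OF cu S0Q]] t by (auto simp: S0_def)
  \<comment> \<open>\<open>u\<close> lies \<open>4 * m\<close> below \<open>d\<close> on the left
    and bottom sides. At most \<open>m\<close> is lost to the tilt \<open>\<eta>\<close> and at most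
    \<open>m\<close> to continuity, so the maximum point stays off these sides.\<close>
  define m where "m = (d - u p0) / 4"
  have m: "m > 0" using p0(1) left bottom by (auto simp: m_def d_def S0_def)
  have S0m: "u p \<le> d - 4 * m" if "p \<in> S0" for p using p0(2)[OF that] by (simp add: m_def field_simps)
  define D where "D = {a..b+1} \<times> {t1..(t2+T)/2}"
  have cD: "compact D" unfolding D_def by (intro compact_Times) auto
  have DQ: "D \<subseteq> QT T" using t by (auto simp: D_def QT_def)
  obtain M where M: "M > 0" "\<And>p. p \<in> D \<Longrightarrow> \<bar>u p\<bar> \<le> M"
    by (rule compact_bound[OF cD continuous_on_subset[OF cu DQ]]) blast
  obtain e where e: "e > 0" "\<And>p q. p \<in> D \<Longrightarrow> q \<in> D \<Longrightarrow> dist p q < e \<Longrightarrow> \<bar>u p - u q\<bar> < m"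
    by (rule compact_uniform[OF cD continuous_on_subset[OF cu DQ] m]) blast
  \<comment> \<open>The box will overhang the corner by \<open>r\<close>, so that the maximum can be
    interior. With \<open>r < e\<close> the additional boundary points on the left and at the bottom
    are close to \<open>S0\<close>, where \<open>u\<close> is low.\<close>
  define r where "r = min (min 1 ((T - t2) / 2)) (e / 2)"
  have "r > 0" using t e(1) by (simp add: r_def)
  moreover have "r \<le> 1" "r \<le> (T - t2) / 2" "r \<le> e / 2"
    unfolding r_def by (rule min.coboundedI1[OF min.cobounded1] min.coboundedI1[OF min.cobounded2] min.cobounded2)+
  ultimately have r: "r > 0" "r \<le> 1" "t2 + r \<le> (t2 + T) / 2" "r < e" using e(1) by (auto simp: field_simps)
  define R where "R = {a..b+r} \<times> {t1..t2+r}"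
  have RD: "R \<subseteq> D" using r by (auto simp: R_def D_def)
  have cR: "compact R" unfolding R_def by (intro compact_Times) auto
  \<comment> \<open>Makes the penalty beat the oscillation of \<open>u\<close> on the outer sides
    \<open>b + r\<close> and \<open>t2 + r\<close>.\<close>
  define N where "N = (2 * M + 2) / r\<^sup>2"
  have N: "N > 0" "N * r\<^sup>2 = 2 * M + 2" using M r by (auto simp: N_def)
  define c where "c = (b + r - a) + (t2 + r - t1)"
  have c: "c > 0" using r ab t by (auto simp: c_def)
  define \<eta> where "\<eta> = min m 1 / c"
  have \<eta>: "\<eta> > 0" "\<eta> * c \<le> m" "\<eta> * c \<le> 1" using m c by (auto simp: \<eta>_def)
  define A where "A = (\<lambda>p. (\<eta> * (fst p - a) + \<eta> * (snd p - t1)) + (N * pen (1 * fst p + 0 * snd p + (- b)) + N * pen (0 * fst p + 1 * snd p + (- t2))))"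
  have lin: "0 \<le> \<eta> * (fst p - a) + \<eta> * (snd p - t1) \<and> \<eta> * (fst p - a) + \<eta> * (snd p - t1) \<le> \<eta> * c" if "p \<in> R" for p
  proof -
    have "fst p - a \<ge> 0" "snd p - t1 \<ge> 0" "(fst p - a) + (snd p - t1) \<le> c" using that by (auto simp: R_def c_def)
    then show ?thesis using \<eta>(1) mult_left_mono[of "(fst p - a) + (snd p - t1)" c \<eta>] by (auto simp: distrib_left)
  qed
  have penN: "0 \<le> N * pen z" for z using N pen_nonneg by simp
  have "continuous_on R (\<lambda>p. u p - A p)"
    unfolding A_def by (intro continuous_intros continuous_on_subset[OF cu order_trans[OF RD DQ]] continuous_on_compose2[OF pen_cont[of UNIV]] subset_UNIV)
  moreover have in2: "(b, t2) \<in> R" using r ab t by (auto simp: R_def)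
  ultimately obtain p where p: "p \<in> R" "\<And>q. q \<in> R \<Longrightarrow> u q - A q \<le> u p - A p"
    using continuous_attains_sup[OF cR] by blast
  obtain y s where ys: "p = (y, s)" by (cases p)
  have inR: "a \<le> y" "y \<le> b + r" "t1 \<le> s" "s \<le> t2 + r" using p(1) ys by (auto simp: R_def)
  have "A (b, t2) \<le> \<eta> * c" using lin[OF in2] by (simp add: A_def pen_0)
  then have low: "d - \<eta> * c \<le> u p - A p" using p(2)[OF in2] by (simp add: d_def)
  have An: "0 \<le> A p"
    using lin[OF p(1)] penN[of "1 * fst p + 0 * snd p + (- b)"] penN[of "0 * fst p + 1 * snd p + (- t2)"] unfolding A_def by linarith
  have up: "d - m \<le> u p" using low An \<eta> by linarith
  have near: "u p < d - 2 * m" if "q \<in> S0" "dist p q < e" for q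
  proof -
    have "q \<in> D" using that(1) r t ab by (auto simp: S0_def D_def)
    then show ?thesis using e(2)[of p q] that p(1) RD S0m[OF that(1)] m by force
  qed
  have y1: "a < y"
  proof (rule ccontr)
    assume "\<not> a < y"
    then have ya: "y = a" using inR by simp
    have "(a, min s t2) \<in> S0" using inR t by (auto simp: S0_def)
    moreover have "dist p (a, min s t2) < e" using dist_pair_le[of y s a "min s t2"] ya ys inR r by (auto simp: min_def)
    ultimately show False using near up m by force
  qed
  have s1: "t1 < s"
  proof (rule ccontr)
    assume "\<not> t1 < s"
    then have sa: "s = t1" using inR by simp
    have "(min y b, t1) \<in> S0" using inR ab by (auto simp: S0_def)
    moreover have "dist p (min y b, t1) < e" using dist_pair_le[of y s "min y b" t1] sa ys inR r by (auto simp: min_def)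
    ultimately show False using near up m by force
  qed
  have big: "N * pen z \<le> 2 * M + 1" if z: "z = 1 * y + 0 * s + (- b) \<or> z = 0 * y + 1 * s + (- t2)" for z
  proof -
    have "N * pen z \<le> A p" unfolding A_def ys fst_conv snd_conv using z lin[OF p(1)] penN[of "1 * y + 0 * s + (- b)"] penN[of "0 * y + 1 * s + (- t2)"]
      by (auto simp: ys)
    moreover have "\<bar>u p\<bar> \<le> M" "\<bar>d\<bar> \<le> M"
      using M(2)[OF subsetD[OF RD p(1)]] M(2)[OF subsetD[OF RD in2]] by (auto simp: d_def)
    ultimately show ?thesis using low \<eta>(3) by linarith
  qed
  have y2: "y < b + r"
  proof (rule ccontr)
    assume "\<not> y < b + r"
    then have "1 * y + 0 * s + (- b) = r" using inR by simp
    then have "N * pen r \<le> 2 * M + 1" using big by metis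
    then show False using N r by (simp add: pen_def)
  qed
  have s2: "s < t2 + r"
  proof (rule ccontr)
    assume "\<not> s < t2 + r"
    then have "0 * y + 1 * s + (- t2) = r" using inR by simp
    then have "N * pen r \<le> 2 * M + 1" using big by metis
    then show False using N r by (simp add: pen_def)
  qed
  have "(y, s) \<in> {a<..<b+r} \<times> {t1<..<t2+r}" using y1 y2 s1 s2 by auto
  then obtain \<rho> where \<rho>: "\<rho> > 0" "ball (y, s) \<rho> \<subseteq> {a<..<b+r} \<times> {t1<..<t2+r}"
    by (rule openE[OF open_Times[OF open_greaterThanLessThan open_greaterThanLessThan]])
  define px where "px = N * (2 * max 0 (1 * y + 0 * s + (- b)))"
  define ps where "ps = N * (2 * max 0 (0 * y + 1 * s + (- t2)))"
  have "superdiff_on UNIV u (y, s) (\<eta> + px) (\<eta> + ps)"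
  proof (rule superdiff_onI[OF _ _ \<rho>(1)])
    have 0: "C1_with UNIV (\<lambda>p. \<eta> * (fst p - a) + \<eta> * (snd p - t1)) (\<lambda>p. \<eta>) (\<lambda>p. \<eta>)"
      by (rule C1_with_separate[where f = "\<lambda>x. \<eta> * (x - a)" and g = "\<lambda>t. \<eta> * (t - t1)" and f' = "\<lambda>x. \<eta>" and g' = "\<lambda>t. \<eta>"])
        (auto intro!: derivative_eq_intros)
    show "C1_with UNIV A (\<lambda>p. \<eta> + (1 * (N * (2 * max 0 (1 * fst p + 0 * snd p + (- b)))) + 0 * (N * (2 * max 0 (0 * fst p + 1 * snd p + (- t2))))))
      (\<lambda>p. \<eta> + (0 * (N * (2 * max 0 (1 * fst p + 0 * snd p + (- b)))) + 1 * (N * (2 * max 0 (0 * fst p + 1 * snd p + (- t2))))))"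
      unfolding A_def by (intro C1_with_add 0 C1_with_pen)
    fix q assume "q \<in> ball (y, s) \<rho>"
    then have "q \<in> {a<..<b+r} \<times> {t1<..<t2+r}" using \<rho>(2) by blast
    then have "q \<in> R" by (auto simp: R_def)
    from p(2)[OF this] show "u q - A q \<le> u (y, s) - A (y, s)" by (simp add: ys)
  qed (auto simp: px_def ps_def)
  moreover have "(y, s) \<in> QT T" using RD DQ p(1) ys by auto
  ultimately have "(\<eta> + px) * (\<eta> + ps) \<le> 0" using sub unfolding prod_sub_def by blast
  moreover have "0 < (\<eta> + px) * (\<eta> + ps)" using \<eta> N by (intro mult_pos_pos add_pos_nonneg) (auto simp: px_def ps_def)
  ultimately show False by simp
qed


text \<open>At the first time that admits a pair \<open>a \<le> b\<close> with \<open>u (a, t) \<le> lo < hi \<le> u (b, t)\<close>, the corner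
  principle for \<open>u\<close> and its reflection produces such a pair at an earlier time.\<close>
lemma zero_source_decreasing:
  assumes cu: "continuous_on (QTbar T) u" and sub: "prod_sub T (\<lambda>_. 0) u" and super: "prod_super T (\<lambda>_. 0) u"
    and init: "\<And>x y. x \<le> y \<Longrightarrow> u (x, 0) \<le> u (y, 0)"
    and ab: "a0 \<le> b0" "b0 \<le> c" and t0: "0 < t0" "t0 < T" and k: "u (c, 0) < u (b0, t0)"
  shows "u (b0, t0) \<le> u (a0, t0)"
proof (rule ccontr)
  define hi where "hi = u (b0, t0)"
  define lo where "lo = u (a0, t0)"
  assume "\<not> u (b0, t0) \<le> u (a0, t0)"
  then have lh: "lo < hi" by (simp add: hi_def lo_def)
  have cQ: "continuous_on (QT T) u" using cu by (rule continuous_on_subset) (auto simp: QT_def QTbar_def)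
  define D where "D = {a0..b0} \<times> {0..t0}"
  have cD: "compact D" unfolding D_def by (intro compact_Times) auto
  have DQ: "D \<subseteq> QTbar T" using t0 by (auto simp: D_def QTbar_def)
  have cuD: "continuous_on D u" by (rule continuous_on_subset[OF cu DQ])
  define P where "P = ({a0..b0} \<times> {a0..b0}) \<times> {0..t0}"
  \<comment> \<open>Pairs together with their time, as a compact set, so that an earliest time
    exists.\<close>
  define Z where "Z = {z \<in> P. fst (fst z) \<le> snd (fst z) \<and> hi \<le> u (snd (fst z), snd z) \<and> u (fst (fst z), snd z) \<le> lo}"
  have cP: "compact P" unfolding P_def by (intro compact_Times) auto
  have c1: "continuous_on P (\<lambda>z. u (snd (fst z), snd z))" "continuous_on P (\<lambda>z. u (fst (fst z), snd z))"
    by (rule continuous_on_compose2[OF cuD]; force simp: P_def D_def intro!: continuous_intros)+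
  have "closedin (top_of_set P) (P \<inter> (\<lambda>z. (fst (fst z) - snd (fst z), hi - u (snd (fst z), snd z), u (fst (fst z), snd z) - lo)) -` ({..0} \<times> {..0} \<times> {..0}))"
    by (intro continuous_closedin_preimage closed_Times closed_atMost continuous_on_Pair continuous_on_diff continuous_on_const c1
        continuous_on_fst continuous_on_snd continuous_on_id)
  also have "P \<inter> (\<lambda>z. (fst (fst z) - snd (fst z), hi - u (snd (fst z), snd z), u (fst (fst z), snd z) - lo)) -` ({..0} \<times> {..0} \<times> {..0}) = Z"
    unfolding Z_def by (auto simp del: split_paired_All)
  finally obtain T' where "closed T'" "Z = P \<inter> T'" unfolding closedin_closed by blast
  then have cZ: "compact Z" using cP by auto
  have in0: "((a0, b0), t0) \<in> Z" using ab t0 by (auto simp: Z_def P_def hi_def lo_def)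
  obtain z where z: "z \<in> Z" "\<And>z'. z' \<in> Z \<Longrightarrow> snd z \<le> snd z'"
    using continuous_attains_inf[OF cZ _ continuous_on_snd[OF continuous_on_id]] in0 by blast
  obtain a b t where abt: "z = ((a, b), t)" by (metis prod.exhaust)
  have m: "a0 \<le> a" "a \<le> b" "b \<le> b0" "0 \<le> t" "t \<le> t0" "hi \<le> u (b, t)" "u (a, t) \<le> lo"
    using z(1) by (auto simp: abt Z_def P_def)
  have min: "t \<le> t'" if "a0 \<le> a'" "a' \<le> b'" "b' \<le> b0" "0 \<le> t'" "t' \<le> t0" "hi \<le> u (b', t')" "u (a', t') \<le> lo" for a' b' t'
    using z(2)[of "((a', b'), t')"] that by (auto simp: abt Z_def P_def)
  \<comment> \<open>At time 0 the monotone data and \<open>u (c, 0) < hi\<close> exclude the value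
    \<open>hi\<close> at any \<open>b \<le> c\<close>.\<close>
  have tpos: "t > 0"
  proof (rule ccontr)
    assume "\<not> t > 0"
    then have "u (b, 0) \<ge> hi" using m by simp
    moreover have "u (b, 0) \<le> u (c, 0)" using m ab by (intro init) auto
    ultimately show False using k by (simp add: hi_def)
  qed
  obtain e where e: "e > 0" "\<And>p q. p \<in> D \<Longrightarrow> q \<in> D \<Longrightarrow> dist p q < e \<Longrightarrow> \<bar>u p - u q\<bar> < hi - lo"
    by (rule compact_uniform[OF cD cuD, of "hi - lo"]) (use lh in auto)
  \<comment> \<open>So close to \<open>t\<close> that values at a fixed \<open>x\<close> change by
    less than \<open>hi - lo\<close>; in particular the left side of the box stays below
    \<open>hi\<close>, as \<open>corner\<close> requires.\<close>
  define t1 where "t1 = max (t / 2) (t - e / 2)"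
  have t1: "0 < t1" "t1 < t" "t - t1 < e" using tpos e by (auto simp: t1_def)
  have close: "\<bar>u (x, s) - u (x, s')\<bar> < hi - lo" if "a \<le> x" "x \<le> b" "t1 \<le> s" "s \<le> t" "t1 \<le> s'" "s' \<le> t" for x s s'
    using e(2)[of "(x, s)" "(x, s')"] dist_pair_le[of x s x s'] that m t1 by (auto simp: D_def)
  have "\<exists>b'. a \<le> b' \<and> b' \<le> b \<and> hi \<le> u (b', t1)"
  proof (rule ccontr)
    assume n: "\<not> ?thesis"
    show False
    proof (rule corner[OF cQ sub m(2) t1(1)])
      show "u (a, s) < u (b, t)" if "t1 \<le> s" "s \<le> t" for s using close[of a s t] that m t1 by auto
      show "u (x, t1) < u (b, t)" if "a \<le> x" "x \<le> b" for x using n that m by force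
    qed (use t1 m t0 in auto)
  qed
  then obtain b' where b': "a \<le> b'" "b' \<le> b" "hi \<le> u (b', t1)" by blast
  have "\<exists>a'. a \<le> a' \<and> a' \<le> b' \<and> u (a', t1) \<le> lo"
  proof (rule ccontr)
    assume n: "\<not> ?thesis"
    have subr: "prod_sub T (\<lambda>_. 0) (reflect u)"
      using prod_super_reflect[OF super] by (simp only: reflect_zero)
    have cr: "continuous_on (QT T) (reflect u)" by (rule reflect_cont[OF cQ QT_reflect(1)])
    show False
    proof (rule corner[OF cr subr _ t1(1), of "- b'" "- a" t])
      show "- b' \<le> - a" using b' by simp
      show "reflect u (- b', s) < reflect u (- a, t)" if "t1 \<le> s" "s \<le> t" for s
        using close[of b' s t1] that b' m t1 by (auto simp: reflect_def)
      show "reflect u (x, t1) < reflect u (- a, t)" if x: "- b' \<le> x" "x \<le> - a" for x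
      proof -
        have "a \<le> - x" "- x \<le> b'" using x by auto
        then have "lo < u (- x, t1)" using n not_le by blast
        then show ?thesis using m by (simp add: reflect_def)
      qed
    qed (use t1 m t0 in auto)
  qed
  then obtain a' where a': "a \<le> a'" "a' \<le> b'" "u (a', t1) \<le> lo" by blast
  have "t \<le> t1" by (rule min[of a' b']) (use a' b' m t1 in auto)
  then show False using t1 by simp
qed

text \<open>If \<open>u\<close> has risen above \<open>u (b, 0)\<close>, then near
  \<open>(b, t)\<close> it exceeds \<open>u (c, 0)\<close> for some \<open>c > b\<close>. By
  \<open>zero_source_decreasing\<close> it is nonincreasing on a box to the left of
  \<open>b\<close>, against \<open>no_flat\<close>.\<close>

lemma zero_source_le:
  assumes cu: "continuous_on (QTbar T) u" and sub: "prod_sub T (\<lambda>_. 0) u" and super: "prod_super T (\<lambda>_. 0) u"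
    and init: "\<And>x y. x \<le> y \<Longrightarrow> u (x, 0) \<le> u (y, 0)" and nf: "no_flat T u" and t: "0 < t" "t < T"
  shows "u (b, t) \<le> u (b, 0)"
proof (rule ccontr)
  assume n: "\<not> u (b, t) \<le> u (b, 0)"
  define m where "m = (u (b, t) + u (b, 0)) / 2"
  have m: "u (b, 0) < m" "m < u (b, t)" using n by (auto simp: m_def)
  have "continuous_on UNIV (\<lambda>x. u (x, 0))"
    by (rule continuous_on_compose2[OF cu]) (use t in \<open>auto simp: QTbar_def intro!: continuous_intros\<close>)
  then have "isCont (\<lambda>x. u (x, 0)) b" by (simp add: continuous_on_eq_continuous_at)
  from isCont_tendsto_compose[OF this filterlim_ident] have "((\<lambda>x. u (x, 0)) \<longlongrightarrow> u (b, 0)) (nhds b)" by simp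
  then have "\<forall>\<^sub>F x in nhds b. u (x, 0) < m" using m(1) by (rule order_tendstoD(2))
  then obtain e0 where e0: "e0 > 0" "\<And>x. dist x b < e0 \<Longrightarrow> u (x, 0) < m" unfolding eventually_nhds_metric by blast
  define c where "c = b + e0 / 2"
  have c: "b \<le> c" "u (c, 0) < m" using e0 by (auto simp: c_def dist_real_def)
  have cQ: "continuous_on (QT T) u" using cu by (rule continuous_on_subset) (auto simp: QT_def QTbar_def)
  then have "isCont u (b, t)" using open_QT t by (simp add: continuous_on_eq_continuous_at QT_def)
  then have "(u \<longlongrightarrow> u (b, t)) (nhds (b, t))" by (simp add: continuous_at tendsto_at_iff_tendsto_nhds)
  then have "\<forall>\<^sub>F p in nhds (b, t). m < u p" using m(2) by (rule order_tendstoD(1))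
  then obtain e where e: "e > 0" "\<And>p. dist p (b, t) < e \<Longrightarrow> m < u p" unfolding eventually_nhds_metric by blast
  define d where "d = min (e / 2) (min t (T - t) / 2)"
  have "d > 0" "d \<le> e / 2" using e(1) t by (simp_all add: d_def)
  moreover have "d \<le> min t (T - t) / 2" unfolding d_def by (rule min.cobounded2)
  then have "d \<le> t / 2" "d \<le> (T - t) / 2" by auto
  ultimately have d: "d > 0" "2 * d \<le> e" "0 < t - d" "t + d < T" using t by auto
  have "u (y, s) \<le> u (x, s)" if "t - d < s" "s < t + d" "b - d < x" "x \<le> y" "y < b" for s x y
  proof (rule zero_source_decreasing[OF cu sub super init that(4)])
    show "y \<le> c" using that c by simp
    have "dist (y, s) (b, t) < e" using dist_pair_le[of y s b t] that d by auto
    then show "u (c, 0) < u (y, s)" using e(2) c(2) by force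
  qed (use that d in auto)
  then show False using nf[unfolded no_flat_def, rule_format, of "b - d" b "t - d" "t + d"] d by auto
qed

text \<open>The second inequality is the first one for the reflected solution.\<close>

lemma zero_source_constant:
  assumes cu: "continuous_on (QTbar T) u" and sub: "prod_sub T (\<lambda>_. 0) u" and super: "prod_super T (\<lambda>_. 0) u"
    and init: "\<And>x y. x \<le> y \<Longrightarrow> u (x, 0) \<le> u (y, 0)" and nf: "no_flat T u" and t: "0 < t" "t < T"
  shows "u (x, t) = u (x, 0)"
proof (rule antisym)
  show "u (x, t) \<le> u (x, 0)" by (rule zero_source_le[OF cu sub super init nf t])
  have "reflect u (- x, t) \<le> reflect u (- x, 0)"
  proof (rule zero_source_le[OF _ _ _ _ _ t])
    show "continuous_on (QTbar T) (reflect u)" by (rule reflect_cont[OF cu QT_reflect(2)])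
    show "prod_sub T (\<lambda>_. 0) (reflect u)" "prod_super T (\<lambda>_. 0) (reflect u)"
      using prod_super_reflect[OF super] prod_sub_reflect[OF sub] by (simp_all only: reflect_zero)
    show "no_flat T (reflect u)" by (rule no_flat_reflect[OF nf])
  qed (simp add: reflect_def init)
  then show "u (x, 0) \<le> u (x, t)" by (simp add: reflect_def)
qed

lemma mono_of_locally_mono:
  fixes g :: "real \<Rightarrow> real"
  assumes loc: "\<And>x. y \<le> x \<Longrightarrow> x \<le> z \<Longrightarrow> \<exists>r>0. \<forall>v w. x - r < v \<and> v \<le> w \<and> w < x + r \<longrightarrow> g v \<le> g w" and yz: "y \<le> z"
  shows "g y \<le> g z"
proof -
  have "y \<le> z \<longrightarrow> g y \<le> g z"
  proof (rule Bolzano[OF yz, where P = "\<lambda>v w. v \<le> w \<longrightarrow> g v \<le> g w"])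
    fix x assume "y \<le> x" "x \<le> z"
    then obtain r where r: "r > 0" "\<And>v w. x - r < v \<and> v \<le> w \<and> w < x + r \<Longrightarrow> g v \<le> g w" using loc by blast
    show "\<exists>d>0. \<forall>a b. a \<le> x \<and> x \<le> b \<and> b - a < d \<longrightarrow> a \<le> b \<longrightarrow> g a \<le> g b"
    proof (intro exI[of _ r] conjI allI impI r(1))
      fix a b assume "a \<le> x \<and> x \<le> b \<and> b - a < r" "a \<le> b"
      then show "g a \<le> g b" by (intro r(2)) auto
    qed
  qed auto
  then show ?thesis using yz by simp
qed

section \<open>Existence and uniqueness\<close>

lemma AE_slices:
  assumes "AE p in lborel. P (p :: real \<times> real)"
  shows "AE t in lborel. AE x in lborel. P (x, t)"
proof -
  obtain N where N: "{p \<in> space lborel. \<not> P p} \<subseteq> N" "emeasure lborel N = 0" "N \<in> sets lborel"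
    using AE_E[OF assms] by blast
  have Ns: "N \<in> sets (lborel \<Otimes>\<^sub>M lborel :: (real \<times> real) measure)" using N(3) by (simp only: lborel_prod)
  have "(\<integral>\<^sup>+t. emeasure lborel ((\<lambda>x. (x, t)) -` N) \<partial>lborel) = 0"
    using lborel_pair.emeasure_pair_measure_alt2[OF Ns] N(2) by (simp add: lborel_prod)
  then have "AE t in lborel. emeasure lborel ((\<lambda>x. (x, t)) -` N) = 0"
    using nn_integral_0_iff_AE[OF lborel_pair.measurable_emeasure_Pair2[OF Ns]] by simp
  then show ?thesis
  proof eventually_elim
    case (elim t)
    have "(\<lambda>x. (x, t)) -` N \<in> sets lborel" using sets_Pair2[OF Ns, of t] by simp
    then show ?case
      by (intro AE_I[OF _ elim]) (use N(1) in auto)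
  qed
qed

lemma AE_open_ex:
  fixes U :: "'a::euclidean_space set"
  assumes ae: "AE p in lborel. P p" and U: "open U" "U \<noteq> {}"
  shows "\<exists>p\<in>U. P p"
proof (rule ccontr)
  assume n: "\<not> ?thesis"
  obtain N where N: "{p \<in> space lborel. \<not> P p} \<subseteq> N" "emeasure lborel N = 0" "N \<in> sets lborel"
    using AE_E[OF ae] by blast
  then have "N \<in> null_sets lebesgue" by (intro null_sets_completionI) (auto simp: null_sets_def)
  then have "negligible N" by (simp add: negligible_iff_null_sets)
  then have "negligible U" by (rule negligible_subset) (use N(1) n in auto)
  then show False using open_not_negligible U by blast
qed

lemma sint_add_const:
  assumes h: "continuous_on UNIV h"
  shows "sint (\<lambda>z. h z + c) x = sint h x + c * x"
proof -
  have "continuous_on UNIV (\<lambda>z. h z + c)" by (intro continuous_intros h)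
  then have "sint (\<lambda>z. h z + c) x = x * integral {0..1} (\<lambda>r. h (x * r) + c)" by (rule sint_scale)
  also have "integral {0..1} (\<lambda>r. h (x * r) + c) = integral {0..1} (\<lambda>r. h (x * r)) + integral {0..1} (\<lambda>r::real. c)"
  proof (rule Henstock_Kurzweil_Integration.integral_add)
    show "(\<lambda>r. h (x * r)) integrable_on {0..1}"
      by (rule integrable_continuous_real, rule continuous_on_compose2[OF h]) (auto intro!: continuous_intros)
  qed (rule integrable_const_ivl)
  finally show ?thesis using sint_scale[OF h, of x] by (simp add: distrib_left mult.commute)
qed

lemma sint_const: "sint (\<lambda>_. c) x = c * x"
  using sint_add_const[of "\<lambda>_. 0" c x] by (simp add: sint_def)

text \<open>Adding \<open>L * x\<close> makes \<open>g\<close> monotone and shifts both sides of the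
  estimate alike.\<close>

lemma increment_ge_sint_lipschitz:
  assumes lip: "\<And>x y. \<bar>g x - g y\<bar> \<le> L * \<bar>x - y\<bar>" and w: "continuous_on UNIV w" "\<And>x. 0 \<le> w x"
    and ae: "AE x in lborel. g differentiable (at x) \<and> w x \<le> deriv g x" and ab: "a \<le> b"
  shows "sint w b - sint w a \<le> g b - g a"
proof -
  have L: "L \<ge> 0" using lip[of 0 1] by simp
  have "L-lipschitz_on UNIV g" using lip L by (auto simp: lipschitz_on_def dist_real_def)
  then have cg: "continuous_on UNIV g" by (rule lipschitz_on_continuous_on)
  have "sint (\<lambda>x. w x + L) b - sint (\<lambda>x. w x + L) a \<le> (g b + L * b) - (g a + L * a)"
  proof (rule increment_ge_sint[OF _ _ _ _ _ ab])
    show "mono (\<lambda>x. g x + L * x)"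
    proof (rule monoI)
      fix x y :: real assume "x \<le> y"
      then show "g x + L * x \<le> g y + L * y" using lip[of x y] by (simp add: algebra_simps abs_le_iff)
    qed
    show "AE x in lborel. (\<lambda>x. g x + L * x) differentiable (at x) \<and> w x + L \<le> deriv (\<lambda>x. g x + L * x) x"
      using ae
    proof eventually_elim
      case (elim x)
      then have "(g has_real_derivative deriv g x) (at x)" by (simp add: DERIV_deriv_iff_real_differentiable)
      then have D: "((\<lambda>x. g x + L * x) has_real_derivative deriv g x + L) (at x)" by (auto intro!: derivative_eq_intros)
      show ?case using DERIV_imp_deriv[OF D] elim D real_differentiable_def by auto
    qed
  qed (use w L in \<open>auto intro!: continuous_intros cg\<close>)
  then show ?thesis by (simp add: sint_add_const[OF w(1)])
qed

section \<open>Monotonicity and slope of a competitor\<close>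

context heat_data
begin

lemma visc_sub_imp:
  assumes "visc_sub T (heat_sol \<rho>0) u" shows "prod_sub T src u"
  unfolding prod_sub_def
proof (intro ballI allI impI)
  fix p a b assume p: "p \<in> QT T" and d: "superdiff_on UNIV u p a b"
  obtain \<phi> \<phi>x \<phi>t r where *: "C1_with UNIV \<phi> \<phi>x \<phi>t" "r > 0" "\<And>q. q \<in> ball p r \<Longrightarrow> u q - \<phi> q \<le> u p - \<phi> p" "\<phi>x p = a" "\<phi>t p = b"
    using d unfolding superdiff_on_def by blast
  have "C1_with (QT T) \<phi> \<phi>x \<phi>t" by (rule C1_with_subset[OF *(1)]) simp
  moreover have "local_max_in (QT T) (\<lambda>q. u q - \<phi> q) p"
    unfolding local_max_in_def using p * by (intro conjI exI[of _ r]) (auto simp: dist_commute)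
  ultimately have "Ham (heat_sol \<rho>0) p (\<phi>x p) (\<phi>t p) \<le> 0" using assms unfolding visc_sub_def by blast
  then show "a * b \<le> src p" using * by (simp add: Ham_eq)
qed

lemma visc_super_imp:
  assumes "visc_super T (heat_sol \<rho>0) u" shows "prod_super T src u"
  unfolding prod_super_def
proof (intro ballI allI impI)
  fix p a b assume p: "p \<in> QT T" and d: "subdiff_on UNIV u p a b"
  obtain \<phi> \<phi>x \<phi>t r where *: "C1_with UNIV \<phi> \<phi>x \<phi>t" "r > 0" "\<And>q. q \<in> ball p r \<Longrightarrow> - u q - \<phi> q \<le> - u p - \<phi> p" "\<phi>x p = - a" "\<phi>t p = - b"
    using d unfolding superdiff_on_def subdiff_on_def by blast
  have "C1_with (QT T) (\<lambda>p. - \<phi> p) (\<lambda>p. - \<phi>x p) (\<lambda>p. - \<phi>t p)" by (rule C1_with_minus[OF C1_with_subset[OF *(1)]]) simp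
  moreover have "local_min_in (QT T) (\<lambda>q. u q - - \<phi> q) p"
    unfolding local_min_in_def
  proof (intro conjI exI[of _ r] ballI impI p *(2))
    fix q assume "dist q p < r"
    then show "u p - - \<phi> p \<le> u q - - \<phi> q" using *(3)[of q] by (simp add: dist_commute)
  qed
  ultimately have "Ham (heat_sol \<rho>0) p (- \<phi>x p) (- \<phi>t p) \<ge> 0" using assms unfolding visc_super_def by blast
  then show "src p \<le> a * b" using * by (simp add: Ham_eq)
qed

lemma grad_cond_iff:
  "grad_cond T \<epsilon> (heat_sol \<rho>0) u \<longleftrightarrow> (AE p in lborel. p \<in> QTbar T \<longrightarrow>
      (\<lambda>y. u (y, snd p)) differentiable (at (fst p)) \<and> B p \<le> deriv (\<lambda>y. u (y, snd p)) (fst p))"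
  unfolding grad_cond_def dx_\<rho> B_def by simp

text \<open>The bound holds at some point of every open box in the strip, and the positive
  derivative there makes \<open>u\<close> larger just to the right.\<close>

lemma grad_cond_no_flat:
  assumes "grad_cond T \<epsilon> (heat_sol \<rho>0) u"
  shows "no_flat T u"
  unfolding no_flat_def
proof (intro allI impI notI)
  fix a b t1 t2 assume ab: "a < b" "t1 < t2" "0 < t1" "t2 < T"
    and dec: "\<forall>t x y. t1 < t \<and> t < t2 \<and> a < x \<and> x \<le> y \<and> y < b \<longrightarrow> u (y, t) \<le> u (x, t)"
  have "({a<..<b} \<times> {t1<..<t2} :: (real \<times> real) set) \<noteq> {}" using ab by simp
  then obtain p where p: "p \<in> {a<..<b} \<times> {t1<..<t2}" "p \<in> QTbar T \<longrightarrow> (\<lambda>y. u (y, snd p)) differentiable (at (fst p)) \<and> B p \<le> deriv (\<lambda>y. u (y, snd p)) (fst p)"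
    using AE_open_ex[OF assms[unfolded grad_cond_iff] open_Times[OF open_greaterThanLessThan open_greaterThanLessThan]] by blast
  obtain x t where xt: "p = (x, t)" by (cases p)
  have r: "a < x" "x < b" "t1 < t" "t < t2" using p(1) xt by auto
  then have "p \<in> QTbar T" using xt ab by (auto simp: QTbar_def)
  then have "((\<lambda>y. u (y, t)) has_real_derivative deriv (\<lambda>y. u (y, t)) x) (at x)" "0 < deriv (\<lambda>y. u (y, t)) x"
    using p(2) xt B_pos[of p] by (auto simp: DERIV_deriv_iff_real_differentiable)
  then obtain d where d: "d > 0" "\<And>h. 0 < h \<Longrightarrow> h < d \<Longrightarrow> u (x, t) < u (x + h, t)"
    using DERIV_pos_inc_right by blast
  define h where "h = min d (b - x) / 2"
  have h: "0 < h" "h < d" "x + h < b" using d r by (auto simp: h_def min_def field_simps)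
  then show False using d(2)[of h] dec[rule_format, of t x "x + h"] r by force
qed

text \<open>Where the source is negative, \<open>reflect\<close> exchanges the two inequalities and
  makes it positive.\<close>

lemma mono_where_nonzero:
  assumes cu: "continuous_on (QT T) u" and sub: "prod_sub T src u" and super: "prod_super T src u" and nf: "no_flat T u"
    and t: "0 < t" "t < T" and nz: "src (x, t) \<noteq> 0"
  shows "\<exists>r>0. \<forall>v w. x - r < v \<and> v \<le> w \<and> w < x + r \<longrightarrow> u (v, t) \<le> u (w, t)"
proof -
  have "isCont src (x, t)" using src_cont[of UNIV] by (simp add: continuous_on_eq_continuous_at)
  then have lim: "(src \<longlongrightarrow> src (x, t)) (nhds (x, t))" by (simp add: continuous_at tendsto_at_iff_tendsto_nhds)
  show ?thesis
  proof (cases "src (x, t) > 0")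
    case True
    then have "\<forall>\<^sub>F p in nhds (x, t). 0 < src p" using lim by (intro order_tendstoD(1))
    then obtain e where e: "e > 0" "\<And>p. dist p (x, t) < e \<Longrightarrow> 0 < src p" unfolding eventually_nhds_metric by blast
    have pos: "0 < src (y, s)" if "x - e/2 < y" "y < x + e/2" "\<bar>s - t\<bar> < e / 2" for y s
    proof (rule e(2))
      have "\<bar>y - x\<bar> < e / 2" using that by linarith
      then show "dist (y, s) (x, t) < e" using dist_pair_le[of y s x t] that(3) by linarith
    qed
    show ?thesis
    proof (intro exI[of _ "e/2"] conjI allI impI)
      fix v w assume vw: "x - e/2 < v \<and> v \<le> w \<and> w < x + e/2"
      show "u (v, t) \<le> u (w, t)"
      proof (rule mono_where_positive[OF cu super nf _ _ t, where \<tau> = "e/2" and a = "x - e/2" and b = "x + e/2"])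
        show "0 < src (y, s)" if "x - e/2 < y" "y < x + e/2" "\<bar>s - t\<bar> < e / 2" for y s by (rule pos[OF that])
      qed (use vw e(1) in auto)
    qed (use e in simp)
  next
    case False
    then have "src (x, t) < 0" using nz by simp
    then have "\<forall>\<^sub>F p in nhds (x, t). src p < 0" using lim by (intro order_tendstoD(2))
    then obtain e where e: "e > 0" "\<And>p. dist p (x, t) < e \<Longrightarrow> src p < 0" unfolding eventually_nhds_metric by blast
    have pos: "0 < reflect src (y, s)" if "- x - e/2 < y" "y < - x + e/2" "\<bar>s - t\<bar> < e / 2" for y s
    proof -
      have "\<bar>- y - x\<bar> < e / 2" using that by linarith
      then have "dist (- y, s) (x, t) < e" using dist_pair_le[of "- y" s x t] that(3) by linarith
      then have "src (- y, s) < 0" by (rule e(2))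
      then show ?thesis by (simp add: reflect_def)
    qed
    show ?thesis
    proof (intro exI[of _ "e/2"] conjI allI impI)
      fix v w assume vw: "x - e/2 < v \<and> v \<le> w \<and> w < x + e/2"
      have "reflect u (- w, t) \<le> reflect u (- v, t)"
      proof (rule mono_where_positive[OF reflect_cont[OF cu QT_reflect(1)] prod_sub_reflect[OF sub] no_flat_reflect[OF nf] _ _ t,
            where \<tau> = "e/2" and a = "- x - e/2" and b = "- x + e/2"])
        show "0 < reflect src (y, s)" if "- x - e/2 < y" "y < - x + e/2" "\<bar>s - t\<bar> < e / 2" for y s by (rule pos[OF that])
      qed (use vw e(1) in auto)
      then show "u (v, t) \<le> u (w, t)" by (simp add: reflect_def)
    qed (use e in simp)
  qed
qed

text \<open>For nonzero \<open>\<rho>0\<close> the slice is locally monotone away from isolated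
  points, and continuity carries monotonicity across these. For zero \<open>\<rho>0\<close> the
  solution keeps its monotone initial values.\<close>

lemma solution_mono:
  assumes cu: "continuous_on (QTbar T) u" and sub: "prod_sub T src u" and super: "prod_super T src u" and nf: "no_flat T u"
    and init: "\<And>x y. x \<le> y \<Longrightarrow> u (x, 0) \<le> u (y, 0)" and t: "0 < t" "t < T" and yz: "y \<le> z"
  shows "u (y, t) \<le> u (z, t)"
proof (cases "\<forall>y. \<rho>0 y = 0")
  case True
  then have s0: "src = (\<lambda>_. 0)" using src_eq_0 by (intro ext) auto
  show ?thesis
    using zero_source_constant[OF cu sub[unfolded s0] super[unfolded s0] init nf t] init[OF yz] by simp
next
  case False
  then obtain y0 where y0: "\<rho>0 y0 \<noteq> 0" by blast
  have cQ: "continuous_on (QT T) u" using cu by (rule continuous_on_subset) (auto simp: QT_def QTbar_def)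
  define g where "g = (\<lambda>x. u (x, t))"
  have cg: "continuous_on UNIV g"
    unfolding g_def by (rule continuous_on_compose2[OF cu]) (use t in \<open>auto simp: QTbar_def intro!: continuous_intros\<close>)
  then have lim: "(g \<longlongrightarrow> g x) (at x within S)" for x S
    by (meson continuous_on_eq_continuous_within continuous_within iso_tuple_UNIV_I tendsto_within_subset top_greatest)
  have loc: "\<exists>r>0. \<forall>v w. x - r < v \<and> v \<le> w \<and> w < x + r \<longrightarrow> g v \<le> g w" if "src (x, t) \<noteq> 0" for x
    unfolding g_def by (rule mono_where_nonzero[OF cQ sub super nf t that])
  have "g y \<le> g z"
  proof (rule mono_of_locally_mono[OF _ yz])
    fix x
    obtain r where r: "r > 0" "\<And>y. 0 < \<bar>y - x\<bar> \<and> \<bar>y - x\<bar> < r \<Longrightarrow> src (y, t) \<noteq> 0"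
      using src_isolated_zeros[OF y0 t(1), of x] by blast
    have L: "g v \<le> g w" if "x - r < v" "v \<le> w" "w < x" for v w
      by (rule mono_of_locally_mono[OF loc]) (use that r in auto)
    have R: "g v \<le> g w" if "x < v" "v \<le> w" "w < x + r" for v w
      by (rule mono_of_locally_mono[OF loc]) (use that r in auto)
    have Lx: "g v \<le> g x" if "x - r < v" "v \<le> x" for v
    proof (cases "v = x")
      case False
      then have "v < x" using that by simp
      then have "\<forall>\<^sub>F w in at_left x. v < w \<and> w < x" by (simp add: eventually_at_left_real eventually_conj_iff eventually_at_left_field) (metis)
      then have "\<forall>\<^sub>F w in at_left x. g v \<le> g w" by eventually_elim (use L that in auto)
      then show ?thesis by (intro tendsto_lowerbound[OF lim]) auto
    qed simp
    have Rx: "g x \<le> g v" if "x \<le> v" "v < x + r" for v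
    proof (cases "v = x")
      case False
      then have "x < v" using that by simp
      then have "\<forall>\<^sub>F w in at_right x. x < w \<and> w < v" by (simp add: eventually_at_right_field) (metis)
      then have "\<forall>\<^sub>F w in at_right x. g w \<le> g v" by eventually_elim (use R that in auto)
      then show ?thesis by (intro tendsto_upperbound[OF lim]) auto
    qed simp
    show "\<exists>r>0. \<forall>v w. x - r < v \<and> v \<le> w \<and> w < x + r \<longrightarrow> g v \<le> g w"
    proof (intro exI[of _ r] conjI allI impI r(1))
      fix v w assume vw: "x - r < v \<and> v \<le> w \<and> w < x + r"
      consider "w < x" | "x < v" | "v \<le> x" "x \<le> w" by linarith
      then show "g v \<le> g w"
      proof cases
        case 3
        then show ?thesis using Lx[of v] Rx[of w] vw by linarith
      qed (use L R vw in auto)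
    qed
  qed
  then show ?thesis by (simp add: g_def)
qed

text \<open>The gradient bound is available on almost every time slice only. The times that violate
  the claim for given \<open>y\<close>, \<open>z\<close> form an open set, so a violation would also
  occur on a slice with the bound.\<close>

lemma solution_slope:
  assumes cu: "continuous_on (QTbar T) u" and gc: "grad_cond T \<epsilon> (heat_sol \<rho>0) u"
    and mono: "\<And>t y z. 0 < t \<Longrightarrow> t < T \<Longrightarrow> y \<le> z \<Longrightarrow> u (y, t) \<le> u (z, t)"
    and t: "0 < t" "t < T" and yz: "y \<le> z"
  shows "\<epsilon> * (z - y) \<le> u (z, t) - u (y, t)"
proof (rule ccontr)
  assume n: "\<not> ?thesis"
  have slice: "continuous_on {0<..<T} (\<lambda>t. u (x, t))" for x
    by (rule continuous_on_compose2[OF cu]) (auto simp: QTbar_def intro!: continuous_intros)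
  define D where "D = {s \<in> {0<..<T}. u (z, s) - u (y, s) < \<epsilon> * (z - y)}"
  have "\<exists>A. open A \<and> A \<inter> {0<..<T} = {s \<in> {0<..<T}. u (z, s) - u (y, s) < \<epsilon> * (z - y)}"
    by (rule open_Collect_less_Int) (intro continuous_intros slice)+
  then have "open D" unfolding D_def by (metis open_Int open_greaterThanLessThan)
  moreover have "t \<in> D" using n t by (simp add: D_def)
  ultimately obtain s where s: "s \<in> D" "AE x in lborel. (x, s) \<in> QTbar T \<longrightarrow>
      (\<lambda>y. u (y, snd (x, s))) differentiable (at (fst (x, s))) \<and> B (x, s) \<le> deriv (\<lambda>y. u (y, snd (x, s))) (fst (x, s))"
    using AE_open_ex[OF AE_slices[OF gc[unfolded grad_cond_iff]]] by blast
  have s0: "0 < s" "s < T" "u (z, s) - u (y, s) < \<epsilon> * (z - y)" using s(1) by (auto simp: D_def)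
  have "sint (\<lambda>_. \<epsilon>) z - sint (\<lambda>_. \<epsilon>) y \<le> u (z, s) - u (y, s)"
  proof (rule increment_ge_sint[OF _ _ _ _ _ yz])
    show "mono (\<lambda>x. u (x, s))" using mono s0 by (intro monoI) auto
    show "continuous_on UNIV (\<lambda>x. u (x, s))"
      by (rule continuous_on_compose2[OF cu]) (use s0 in \<open>auto simp: QTbar_def intro!: continuous_intros\<close>)
    show "AE x in lborel. (\<lambda>x. u (x, s)) differentiable (at x) \<and> \<epsilon> \<le> deriv (\<lambda>x. u (x, s)) x"
      using s(2)
    proof eventually_elim
      case (elim x)
      then show ?case using s0 B_ge[of "(x, s)"] by (auto simp: QTbar_def)
    qed
  qed (use \<epsilon> in auto)
  then show False using s0(3) by (simp add: sint_const algebra_simps)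
qed

lemma superdiff_slope:
  assumes slope: "\<And>y z. y \<le> z \<Longrightarrow> \<epsilon> * (z - y) \<le> u (z, snd p) - u (y, snd p)" and d: "superdiff u p a b"
  shows "\<epsilon> \<le> a"
proof -
  have "\<epsilon> \<le> a * fst (1 :: real, 0 :: real) + b * snd (1 :: real, 0 :: real)"
  proof (rule superdiff_direction[OF d, of 1])
    fix s :: real assume "0 < s"
    then show "u p + \<epsilon> * s \<le> u (p + s *\<^sub>R (1, 0))" using slope[of "fst p" "fst p + s"] by (cases p) auto
  qed simp
  then show ?thesis by simp
qed

lemma subdiff_slope:
  assumes slope: "\<And>y z. y \<le> z \<Longrightarrow> \<epsilon> * (z - y) \<le> u (z, snd p) - u (y, snd p)" and d: "subdiff u p a b"
  shows "\<epsilon> \<le> a"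
proof -
  have "\<epsilon> \<le> (- a) * fst (-1 :: real, 0 :: real) + (- b) * snd (-1 :: real, 0 :: real)"
  proof (rule superdiff_direction[OF d[unfolded subdiff_def], of 1])
    fix s :: real assume "0 < s"
    then show "- u p + \<epsilon> * s \<le> - u (p + s *\<^sub>R (-1, 0))" using slope[of "fst p - s" "fst p"] by (cases p) auto
  qed simp
  then show ?thesis by simp
qed

text \<open>For slopes of at least \<open>\<epsilon>\<close> the cutoff is inactive, and division by
  \<open>a > 0\<close> turns the product form into the evolution form.\<close>

lemma G_slope: "\<epsilon> \<le> a \<Longrightarrow> b \<le> G p a \<longleftrightarrow> a * b \<le> src p" "\<epsilon> \<le> a \<Longrightarrow> G p a \<le> b \<longleftrightarrow> src p \<le> a * b"
  using \<epsilon> by (auto simp: G_def max_absorb1 field_simps)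

end

section \<open>The Perron function as the solution\<close>

locale kappa_data = heat_data +
  fixes \<kappa>0 :: "real \<Rightarrow> real"
  assumes lip0: "Lip UNIV \<kappa>0"
    and grad0: "AE x in lborel. \<kappa>0 differentiable (at x) \<and> deriv \<kappa>0 x \<ge> sqrt ((deriv \<rho>0 x)\<^sup>2 + \<epsilon>\<^sup>2)"
begin

lemma \<kappa>0_increment:
  assumes "x \<le> y" shows "k (y, 0) - k (x, 0) \<le> \<kappa>0 y - \<kappa>0 x"
proof -
  obtain L where L: "L-lipschitz_on UNIV \<kappa>0" using lip0 by (auto simp: Lip_def)
  have "sint (\<lambda>z. B (z, 0)) y - sint (\<lambda>z. B (z, 0)) x \<le> \<kappa>0 y - \<kappa>0 x"
  proof (rule increment_ge_sint_lipschitz[OF _ _ _ _ assms])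
    show "\<bar>\<kappa>0 a - \<kappa>0 b\<bar> \<le> L * \<bar>a - b\<bar>" for a b using lipschitz_onD[OF L, of a b] by (simp add: dist_real_def)
    show "continuous_on UNIV (\<lambda>z. B (z, 0))" by (rule slice_cont[OF B_cont])
    show "0 \<le> B (z, 0)" for z using B_pos[of "(z, 0)"] by simp
    show "AE z in lborel. \<kappa>0 differentiable (at z) \<and> B (z, 0) \<le> deriv \<kappa>0 z"
      using grad0 by eventually_elim (simp add: B_def r1_def heat_sol_nonpos)
  qed
  then show ?thesis by (simp add: k_def)
qed

lemma k_increment: "x \<le> y \<Longrightarrow> \<epsilon> * (y - x) \<le> k (y, t) - k (x, t)"
proof -
  assume xy: "x \<le> y"
  have "k (x, t) - \<epsilon> * x \<le> k (y, t) - \<epsilon> * y"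
  proof (rule DERIV_nonneg_imp_nondecreasing[OF xy])
    fix z
    have "((\<lambda>x. k (x, t) - \<epsilon> * x) has_real_derivative B (z, t) - \<epsilon>) (at z)"
      by (auto intro!: derivative_eq_intros k_x)
    then show "\<exists>d. ((\<lambda>x. k (x, t) - \<epsilon> * x) has_real_derivative d) (at z) \<and> 0 \<le> d" using B_ge[of "(z, t)"] by auto
  qed
  then show ?thesis by (simp add: algebra_simps)
qed


lemma \<kappa>0_mono: "x \<le> y \<Longrightarrow> \<kappa>0 x \<le> \<kappa>0 y"
  using \<kappa>0_increment[of x y] k_increment[of x y 0] mult_nonneg_nonneg[OF less_imp_le[OF \<epsilon>], of "y - x"] by simp

end

locale kappa_ivp = kappa_data \<rho>0 \<epsilon> \<kappa>0 + hamiltonian_ivp "heat_data.G \<rho>0 \<epsilon>" C L K \<kappa>0 L0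
  for \<rho>0 \<epsilon> \<kappa>0 C L K L0
begin

lemma perron_k_increment:
  assumes "0 \<le> t" "x \<le> y"
  shows "k (y, t) - k (x, t) \<le> perron (y, t) - perron (x, t)"
proof (cases "t = 0")
  case True
  then show ?thesis using \<kappa>0_increment[OF assms(2)] by (simp add: perron_initial)
next
  case False
  show ?thesis
    by (rule increment_lower_bound[OF perron_cont perron_sub perron_super k_C1 k_cont flux_mono _ assms(2)])
      (use False assms \<kappa>0_increment in \<open>auto simp: perron_initial\<close>)
qed

lemma perron_slope: "0 \<le> t \<Longrightarrow> y \<le> z \<Longrightarrow> \<epsilon> * (z - y) \<le> perron (z, t) - perron (y, t)"
  using perron_k_increment[of t y z] k_increment[of y z t] by simp

text \<open>Test functions inherit the slope \<open>\<epsilon>\<close> of the Perron function, so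
  they see the equation without the cutoff.\<close>

lemma perron_visc: "visc_sub T (heat_sol \<rho>0) perron" "visc_super T (heat_sol \<rho>0) perron"
proof -
  have QT: "QT T \<subseteq> Qpos" "QT T \<subseteq> Qnonneg" by (auto simp: QT_def)
  have c: "continuous_on (QT T) perron" by (rule continuous_on_subset[OF perron_cont QT(2)])
  show "visc_sub T (heat_sol \<rho>0) perron"
    unfolding visc_sub_def
  proof (intro conjI c allI impI, elim conjE)
    fix \<phi> \<phi>x \<phi>t p assume C1: "C1_with (QT T) \<phi> \<phi>x \<phi>t" and m: "local_max_in (QT T) (\<lambda>q. perron q - \<phi> q) p"
    obtain r where r: "p \<in> QT T" "r > 0" "\<And>q. q \<in> QT T \<Longrightarrow> dist q p < r \<Longrightarrow> perron q - \<phi> q \<le> perron p - \<phi> p"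
      using m unfolding local_max_in_def by blast
    obtain r' where r': "r' > 0" "ball p r' \<subseteq> QT T" by (rule openE[OF open_QT r(1)])
    have d: "superdiff perron p (\<phi>x p) (\<phi>t p)"
    proof (rule superdiffI[of "min r r'" _ \<phi> \<phi>x \<phi>t])
      show "C1_with (ball p (min r r')) \<phi> \<phi>x \<phi>t" by (rule C1_with_subset[OF C1]) (use r' in auto)
      show "perron q - \<phi> q \<le> perron p - \<phi> p" if "q \<in> ball p (min r r')" for q
      proof (rule r(3))
        have "q \<in> ball p r'" using that by simp
        then show "q \<in> QT T" using r'(2) by blast
        show "dist q p < r" using that by (simp add: dist_commute)
      qed
    qed (use r r' in auto)
    have "\<phi>t p \<le> G p (\<phi>x p)" by (rule HJ_subD[OF perron_sub _ d]) (use r(1) QT in blast)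
    moreover have "\<epsilon> \<le> \<phi>x p" by (rule superdiff_slope[OF perron_slope d]) (use r(1) in \<open>auto simp: QT_def\<close>)
    ultimately show "Ham (heat_sol \<rho>0) p (\<phi>x p) (\<phi>t p) \<le> 0" by (simp add: Ham_eq G_slope)
  qed
  show "visc_super T (heat_sol \<rho>0) perron"
    unfolding visc_super_def
  proof (intro conjI c allI impI, elim conjE)
    fix \<phi> \<phi>x \<phi>t p assume C1: "C1_with (QT T) \<phi> \<phi>x \<phi>t" and m: "local_min_in (QT T) (\<lambda>q. perron q - \<phi> q) p"
    obtain r where r: "p \<in> QT T" "r > 0" "\<And>q. q \<in> QT T \<Longrightarrow> dist q p < r \<Longrightarrow> perron p - \<phi> p \<le> perron q - \<phi> q"
      using m unfolding local_min_in_def by blast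
    obtain r' where r': "r' > 0" "ball p r' \<subseteq> QT T" by (rule openE[OF open_QT r(1)])
    have d: "subdiff perron p (\<phi>x p) (\<phi>t p)"
    proof (rule subdiff_on_imp_subdiff[OF subdiff_onI[of p "QT T" \<phi> \<phi>x \<phi>t "min r r'"] open_QT])
      show "perron p - \<phi> p \<le> perron q - \<phi> q" if "q \<in> ball p (min r r')" for q
      proof (rule r(3))
        have "q \<in> ball p r'" using that by simp
        then show "q \<in> QT T" using r'(2) by blast
        show "dist q p < r" using that by (simp add: dist_commute)
      qed
    qed (use r r' C1 in auto)
    have "G p (\<phi>x p) \<le> \<phi>t p" by (rule HJ_superD[OF perron_super _ d]) (use r(1) QT in blast)
    moreover have "\<epsilon> \<le> \<phi>x p" by (rule subdiff_slope[OF perron_slope d]) (use r(1) in \<open>auto simp: QT_def\<close>)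
    ultimately show "Ham (heat_sol \<rho>0) p (\<phi>x p) (\<phi>t p) \<ge> 0" by (simp add: Ham_eq G_slope)
  qed
qed

text \<open>Each slice is Lipschitz with slope at least \<open>\<epsilon>\<close>, so its gap sets
  are null. Forming the gap sets in the plane makes them Borel sets there, and integrating over the
  slices yields one planar null set.\<close>

lemma perron_grad_cond: "grad_cond T \<epsilon> (heat_sol \<rho>0) perron"
proof -
  \<comment> \<open>Continued constantly below time 0, because \<open>gap_set_borel\<close> asks for
    quotients that are continuous on the whole plane.\<close>
  define u where "u = (\<lambda>p :: real \<times> real. perron (fst p, max 0 (snd p)))"
  have cu: "continuous_on UNIV u"
    unfolding u_def by (rule continuous_on_compose2[OF perron_cont]) (auto intro!: continuous_intros)
  define Q where "Q = (\<lambda>p s. (u (fst p + s, snd p) - u p) / s)"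
  have low: "\<epsilon> * (y - x) \<le> u (y, t) - u (x, t)" if "x \<le> y" for x y t
    unfolding u_def fst_conv snd_conv by (rule perron_slope) (use that in auto)
  have lip: "\<bar>u (x, t) - u (y, t)\<bar> \<le> (L0 + L * max 0 t) * \<bar>x - y\<bar>" for x y t
    unfolding u_def fst_conv snd_conv by (rule perron_lip_x) simp
  have Qs: "Q (x, t) s = dquot (\<lambda>x. u (x, t)) x s" for x t s by (simp add: Q_def dquot_def)
  have Qc: "continuous_on UNIV (\<lambda>p. Q p s)" if "s \<noteq> 0" for s
    unfolding Q_def by (intro continuous_intros continuous_on_compose2[OF cu]) (use that in auto)
  have null: "gap_set Q r r' \<in> null_sets lborel" if r: "0 < r" "r < r'" for r r'
  proof -
    have b: "gap_set Q r r' \<in> sets borel" by (rule gap_set_borel[OF Qc])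
    then have bp: "gap_set Q r r' \<in> sets (lborel \<Otimes>\<^sub>M lborel :: (real \<times> real) measure)" by (simp only: lborel_prod sets_lborel)
    have "emeasure lborel ((\<lambda>x. (x, t)) -` gap_set Q r r') = 0" for t
    proof -
      have e: "(\<lambda>x. (x, t)) -` gap_set Q r r' = gap_set (dquot (\<lambda>x. u (x, t))) r r'"
        by (simp add: gap_set_def Qs)
      have n: "emeasure lebesgue (gap_set (dquot (\<lambda>x. u (x, t))) r r') = 0"
        by (rule null_setsD1[OF gap_set_null[OF \<epsilon> low lip r]])
      have "gap_set (dquot (\<lambda>x. u (x, t))) r r' \<in> sets lborel" using sets_Pair2[OF bp, of t] by (simp only: e)
      then show ?thesis using n unfolding e by (simp add: main_part_sets)
    qed
    then have "emeasure (lborel \<Otimes>\<^sub>M lborel) (gap_set Q r r') = 0"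
      unfolding lborel_pair.emeasure_pair_measure_alt2[OF bp] by simp
    then show ?thesis using b by (simp add: null_sets_def lborel_prod)
  qed
  define N where "N = (\<Union>r\<in>\<rat>. \<Union>r'\<in>\<rat>. if 0 < r \<and> r < r' then gap_set Q r r' else {})"
  have "N \<in> null_sets lborel"
    unfolding N_def by (intro null_sets_UN' countable_rat) (use null in auto)
  then have "AE p in lborel. p \<notin> N" by (rule AE_not_in)
  then show ?thesis
    unfolding grad_cond_iff
  proof (eventually_elim, intro impI)
    fix p assume p: "p \<notin> N" "p \<in> QTbar T"
    obtain x t where xt: "p = (x, t)" by (cases p)
    have t: "0 \<le> t" using p xt by (simp add: QTbar_def)
    define g where "g = (\<lambda>y. perron (y, t))"
    have gu: "(\<lambda>x. u (x, t)) = g" using t by (simp add: u_def g_def)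
    have "g differentiable (at x)"
    proof (rule ccontr)
      assume nd: "\<not> g differentiable (at x)"
      have "\<exists>r\<in>\<rat>. \<exists>r'\<in>\<rat>. 0 < r \<and> r < r' \<and> x \<in> gap_set (dquot g) r r'"
      proof (rule not_differentiable_gap[OF _ \<epsilon> nd, of "L0 + L * max 0 t"])
        fix s :: real assume s: "s \<noteq> 0"
        define M where "M = L0 + L * max 0 t"
        have gy: "u (y, t) = g y" for y using gu by (rule fun_cong)
        have "\<epsilon> \<le> dquot g x s \<and> dquot g x s \<le> M"
        proof (cases "s > 0")
          case True
          have "\<epsilon> * s \<le> g (x + s) - g x" "g (x + s) - g x \<le> M * s"
            using low[of x "x + s" t] lip[of "x + s" t x] True unfolding gy M_def[symmetric] by auto
          then show ?thesis using True by (simp add: dquot_def field_simps)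
        next
          case False
          then have "s < 0" using s by simp
          have "\<epsilon> * (- s) \<le> g x - g (x + s)" "g x - g (x + s) \<le> M * (- s)"
            using low[of "x + s" x t] lip[of x t "x + s"] \<open>s < 0\<close> unfolding gy M_def[symmetric] by auto
          then show ?thesis using \<open>s < 0\<close> by (simp add: dquot_def field_simps)
        qed
        then show "\<epsilon> \<le> dquot g x s \<and> dquot g x s \<le> L0 + L * max 0 t" by (simp only: M_def)
      qed
      then obtain r r' where rr: "r \<in> \<rat>" "r' \<in> \<rat>" "0 < r" "r < r'" "x \<in> gap_set (dquot g) r r'" by blast
      have "(x, t) \<in> gap_set Q r r'" using rr(5) by (simp add: gap_set_def Qs gu)
      then have "p \<in> N" unfolding N_def xt using rr by auto
      then show False using p by simp
    qed
    moreover from this have D: "(g has_real_derivative deriv g x) (at x)" by (simp add: DERIV_deriv_iff_real_differentiable)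
    \<comment> \<open>The increments of \<open>perron\<close> dominate those of \<open>k\<close>, so
      the difference is monotone in \<open>y\<close>.\<close>
    have "0 \<le> deriv g x - B (x, t)"
    proof (rule mono_on_imp_deriv_nonneg[of UNIV])
      show "mono_on UNIV (\<lambda>y. g y - k (y, t))"
        using perron_k_increment[OF t] by (intro mono_onI) (force simp: g_def)
      show "((\<lambda>y. g y - k (y, t)) has_real_derivative deriv g x - B (x, t)) (at x)" by (intro DERIV_diff D k_x)
    qed simp
    ultimately show "(\<lambda>y. perron (y, snd p)) differentiable (at (fst p)) \<and> B p \<le> deriv (\<lambda>y. perron (y, snd p)) (fst p)"
      by (simp add: xt g_def)
  qed
qed

lemma solution_unique:
  assumes T: "T > 0" and sol: "visc_sol_IVP T (heat_sol \<rho>0) \<kappa>0 u" and gc: "grad_cond T \<epsilon> (heat_sol \<rho>0) u"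
    and p: "p \<in> QTbar T"
  shows "u p = perron p"
proof -
  have cu: "continuous_on (QTbar T) u" and u0: "\<And>x. u (x, 0) = \<kappa>0 x"
    and sub: "prod_sub T src u" and super: "prod_super T src u"
    using sol visc_sub_imp visc_super_imp by (auto simp: visc_sol_IVP_def)
  have cp: "continuous_on (QTbar T) perron"
    by (rule continuous_on_subset[OF perron_cont]) (auto simp: QTbar_def)
  have mono: "u (y, t) \<le> u (z, t)" if "0 < t" "t < T" "y \<le> z" for t y z
    by (rule solution_mono[OF cu sub super grad_cond_no_flat[OF gc] _ that]) (simp add: u0 \<kappa>0_mono)
  have slope: "\<epsilon> * (z - y) \<le> u (z, t) - u (y, t)" if "0 < t" "t < T" "y \<le> z" for t y z
    by (rule solution_slope[OF cu gc mono that])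
  have QT: "0 < snd q" "snd q < T" if "q \<in> QT T" for q using that by (auto simp: QT_def)
  have us: "b \<le> G q a" if q: "q \<in> QT T" and d: "superdiff_on UNIV u q a b" for q a b
  proof -
    have "\<epsilon> \<le> a" by (rule superdiff_slope[OF slope superdiff_on_imp_superdiff[OF d open_UNIV]]) (use QT[OF q] in auto)
    moreover have "a * b \<le> src q" using sub q d unfolding prod_sub_def by blast
    ultimately show ?thesis by (simp add: G_slope)
  qed
  have uS: "G q a \<le> b" if q: "q \<in> QT T" and d: "subdiff_on UNIV u q a b" for q a b
  proof -
    have "\<epsilon> \<le> a" by (rule subdiff_slope[OF slope subdiff_on_imp_subdiff[OF d open_UNIV]]) (use QT[OF q] in auto)
    moreover have "src q \<le> a * b" using super q d unfolding prod_super_def by blast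
    ultimately show ?thesis by (simp add: G_slope)
  qed
  have ps: "b \<le> G q a" if q: "q \<in> QT T" and d: "superdiff_on UNIV perron q a b" for q a b
    by (rule HJ_subD[OF perron_sub _ superdiff_on_imp_superdiff[OF d open_UNIV]]) (use QT[OF q] in simp)
  have pS: "G q a \<le> b" if q: "q \<in> QT T" and d: "subdiff_on UNIV perron q a b" for q a b
    by (rule HJ_superD[OF perron_super _ subdiff_on_imp_subdiff[OF d open_UNIV]]) (use QT[OF q] in simp)
  have eq: "u (x, t) = perron (x, t)" if "0 < t" "t < T" for x t
  proof (rule antisym)
    show "u (x, t) \<le> perron (x, t)" by (rule comparison[OF T cu cp us pS _ that]) (simp_all add: u0 perron_initial)
    show "perron (x, t) \<le> u (x, t)" by (rule comparison[OF T cp cu ps uS _ that]) (simp_all add: u0 perron_initial)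
  qed
  obtain x t where xt: "p = (x, t)" by (cases p)
  \<comment> \<open>Comparison covers \<open>0 < t < T\<close>; continuity adds the two end
    times.\<close>
  have "u (x, t) - perron (x, t) = 0"
  proof (rule continuous_constant_on_closure[where S = "{0<..<T}" and f = "\<lambda>t. u (x, t) - perron (x, t)"])
    have cl: "closure {0<..<T} = {0..T}" using T by (rule closure_greaterThanLessThan)
    show "continuous_on (closure {0<..<T}) (\<lambda>t. u (x, t) - perron (x, t))"
      unfolding cl by (intro continuous_intros continuous_on_compose2[OF cu] continuous_on_compose2[OF cp]) (auto simp: QTbar_def)
    show "t \<in> closure {0<..<T}" unfolding cl using p xt by (simp add: QTbar_def)
  qed (simp add: eq)
  then show ?thesis by (simp add: xt)
qed

end

theorem theorem1p2:
  fixes T \<epsilon> :: real and \<kappa>0 \<rho>0 :: "real \<Rightarrow> real"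
  assumes "T > 0" and "\<epsilon> > 0"
    and "Lip UNIV \<kappa>0" and "C0_infty \<rho>0"
    and "AE x in lborel. \<kappa>0 differentiable (at x) \<and>
           deriv \<kappa>0 x \<ge> sqrt ((deriv \<rho>0 x)\<^sup>2 + \<epsilon>\<^sup>2)"
  shows "\<exists>\<kappa>. Lip (QTbar T) \<kappa> \<and> visc_sol_IVP T (heat_sol \<rho>0) \<kappa>0 \<kappa>
           \<and> grad_cond T \<epsilon> (heat_sol \<rho>0) \<kappa>
           \<and> (\<forall>\<kappa>'. visc_sol_IVP T (heat_sol \<rho>0) \<kappa>0 \<kappa>' \<and> grad_cond T \<epsilon> (heat_sol \<rho>0) \<kappa>'
                  \<longrightarrow> (\<forall>p\<in>QTbar T. \<kappa>' p = \<kappa> p))"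
proof -
  interpret kappa_data \<rho>0 \<epsilon> \<kappa>0 by unfold_locales (use assms in auto)
  obtain C L K where "hamiltonian G C L K" by (rule hamiltonian_G)
  then interpret hamiltonian G C L K .
  obtain L0 where L0: "L0-lipschitz_on UNIV \<kappa>0" using assms(3) by (auto simp: Lip_def)
  interpret kappa_ivp \<rho>0 \<epsilon> \<kappa>0 C L K L0
    by unfold_locales (use lipschitz_on_nonneg[OF L0] lipschitz_onD[OF L0] in \<open>auto simp: dist_real_def\<close>)
  have "Lip (QTbar T) perron" using perron_Lip[of T] assms(1) by (simp add: QTbar_def)
  moreover have "visc_sol_IVP T (heat_sol \<rho>0) \<kappa>0 perron"
    unfolding visc_sol_IVP_def using perron_visc perron_initial
    by (auto intro!: continuous_on_subset[OF perron_cont] simp: QTbar_def)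
  ultimately show ?thesis
    using perron_grad_cond solution_unique[OF assms(1)] by (intro exI[of _ perron]) blast
qed

end
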